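(* Let $p>1$, $\alpha\ge0$, and let $\{S_t=u_tC_{\phi_t}:t\in\,]0,1[\}\subset\mathcal L(A^p_\alpha)$ be a family of (weighted composition) operators such that $t\mapsto S_tf$ is continuous for every $f\in A^p_\alpha$ and $\int_0^1\|S_t\|_{\mathcal L(A^p_\alpha)}\,dt<\infty$. If there exists no sequence $(f_n)\in W_0(\partial B_{A^p_\alpha})$ such that $\lim_n\|S_tf_n\|_{A^p_\alpha}=\|S_t\|_e$ for almost every $t\in\,]0,1[$, then $$\Big\|\int_0^1u_tC_{\phi_t}\,dt\Big\|_{e}<\int_0^1\|u_tC_{\phi_t}\|_{e}\,dt .$$
   Context: $\mathbb D$ is the open unit disk in $\mathbb C$, $\mathcal H(\mathbb D)$ the holomorphic functions on $\mathbb D$, $dA(x+iy)=dx\,dy/\pi$, $dA_\alpha(z)=(1+\alpha)(1-|z|^2)^\alpha dA(z)$. For $p>1$, $\alpha\ge0$, $A^p_\alpha=\{f\in\mathcal H(\mathbb D):\|f\|^p_{A^p_\alpha}=\int_{\mathbb D}|f|^p\,dA_\alpha<\infty\}$. For a Banach space $X$: $\mathcal L(X)$ = bounded linear operators, $\mathcal K(X)$ = compact operators, $\|S\|_e=\inf_{K\in\mathcal K(X)}\|S-K\|$ (essential norm); $\partial B_X$ is the unit sphere, and $W_0(\partial B_X)$ is the set of weakly null sequences in $\partial B_X$. Here $u_t\in\mathcal H(\mathbb D)$, $\phi_t:\mathbb D\to\mathbb D$ is holomorphic, and $u_tC_{\phi_t}f=u_t\,(f\circ\phi_t)$. The operator $\int_0^1S_t\,dt$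 is $f\mapsto\int_0^1S_tf\,dt$ (vector-valued integral in $A^p_\alpha$). *)

theory Defs
  imports "HOL-Complex_Analysis.Complex_Analysis"
begin

section \<open>Normed spaces of complex-valued functions\<close>

text \<open>
  The Bergman space depends on real parameters and hence is not a type.  A normed space is therefore
  given by a carrier \<open>X\<close>, a set of functions closed under the pointwise complex vector space
  operations, together with a norm \<open>N\<close> that is meaningful only on \<open>X\<close>.  Operators and functionals are
  total functions of which only the restriction to \<open>X\<close> matters.
\<close>

definition bounded_ops ::
  "('a \<Rightarrow> complex) set \<Rightarrow> (('a \<Rightarrow> complex) \<Rightarrow> real) \<Rightarrow> (('a \<Rightarrow> complex) \<Rightarrow> 'a \<Rightarrow> complex) set" where
  "bounded_ops X N = {T.
     (\<forall>f\<in>X. T f \<in> X) \<and>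
     (\<forall>f\<in>X. \<forall>g\<in>X. \<forall>a b. T (\<lambda>z. a * f z + b * g z) = (\<lambda>z. a * T f z + b * T g z)) \<and>
     (\<exists>C. \<forall>f\<in>X. N (T f) \<le> C * N f)}"

definition bounded_functionals ::
  "('a \<Rightarrow> complex) set \<Rightarrow> (('a \<Rightarrow> complex) \<Rightarrow> real) \<Rightarrow> (('a \<Rightarrow> complex) \<Rightarrow> complex) set" where
  "bounded_functionals X N = {l.
     (\<forall>f\<in>X. \<forall>g\<in>X. \<forall>a b. l (\<lambda>z. a * f z + b * g z) = a * l f + b * l g) \<and>
     (\<exists>C. \<forall>f\<in>X. norm (l f) \<le> C * N f)}"

definition op_norm ::
  "('a \<Rightarrow> complex) set \<Rightarrow> (('a \<Rightarrow> complex) \<Rightarrow> real) \<Rightarrow> (('a \<Rightarrow> complex) \<Rightarrow> 'a \<Rightarrow> complex) \<Rightarrow> real" where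
  "op_norm X N T = (SUP f\<in>{f \<in> X. N f \<le> 1}. N (T f))"

definition compact_ops ::
  "('a \<Rightarrow> complex) set \<Rightarrow> (('a \<Rightarrow> complex) \<Rightarrow> real) \<Rightarrow> (('a \<Rightarrow> complex) \<Rightarrow> 'a \<Rightarrow> complex) set" where
  "compact_ops X N = {T \<in> bounded_ops X N.
     \<forall>F :: nat \<Rightarrow> 'a \<Rightarrow> complex. (\<forall>n. F n \<in> X \<and> N (F n) \<le> 1) \<longrightarrow>
       (\<exists>g\<in>X. \<exists>r :: nat \<Rightarrow> nat. strict_mono r \<and>
          (\<lambda>n. N (\<lambda>z. T (F (r n)) z - g z)) \<longlonglongrightarrow> 0)}"

definition ess_norm ::
  "('a \<Rightarrow> complex) set \<Rightarrow> (('a \<Rightarrow> complex) \<Rightarrow> real) \<Rightarrow> (('a \<Rightarrow> complex) \<Rightarrow> 'a \<Rightarrow> complex) \<Rightarrow> real" where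
  "ess_norm X N T = (INF K\<in>compact_ops X N. op_norm X N (\<lambda>f z. T f z - K f z))"

definition weakly_null_sphere ::
  "('a \<Rightarrow> complex) set \<Rightarrow> (('a \<Rightarrow> complex) \<Rightarrow> real) \<Rightarrow> (nat \<Rightarrow> 'a \<Rightarrow> complex) set" where
  "weakly_null_sphere X N = {F.
     (\<forall>n. F n \<in> X \<and> N (F n) = 1) \<and>
     (\<forall>l\<in>bounded_functionals X N. (\<lambda>n. l (F n)) \<longlonglongrightarrow> 0)}"

definition norm_continuous_on ::
  "(('a \<Rightarrow> complex) \<Rightarrow> real) \<Rightarrow> real set \<Rightarrow> (real \<Rightarrow> 'a \<Rightarrow> complex) \<Rightarrow> bool" where
  "norm_continuous_on N I h \<longleftrightarrow>
     (\<forall>t\<in>I. ((\<lambda>s. N (\<lambda>z. h s z - h t z)) \<longlongrightarrow> 0) (at t within I))"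

text \<open>
  The Bochner integral of an \<open>X\<close>-valued function, following \<^const>\<open>has_bochner_integral\<close>, which is
  not applicable because it integrates functions with values in a normed type.
\<close>

definition simple_integral ::
  "'t measure \<Rightarrow> ('t \<Rightarrow> 'a \<Rightarrow> complex) \<Rightarrow> 'a \<Rightarrow> complex" where
  "simple_integral M s =
     (\<lambda>z. \<Sum>y\<in>s ` space M. of_real (measure M {t \<in> space M. s t = y}) * y z)"

text \<open>
  Strong measurability of \<open>h\<close> almost everywhere follows from the approximation by simple functions;
  the measurability of the scalar functions is required because \<^const>\<open>nn_integral\<close> is a lower
  integral on non-measurable functions.
\<close>

definition has_integral_in ::
  "('a \<Rightarrow> complex) set \<Rightarrow> (('a \<Rightarrow> complex) \<Rightarrow> real) \<Rightarrow> 't measure \<Rightarrow>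
   ('t \<Rightarrow> 'a \<Rightarrow> complex) \<Rightarrow> ('a \<Rightarrow> complex) \<Rightarrow> bool" where
  "has_integral_in X N M h g \<longleftrightarrow>
     g \<in> X \<and> (\<forall>t\<in>space M. h t \<in> X) \<and>
     (\<exists>s :: nat \<Rightarrow> 't \<Rightarrow> 'a \<Rightarrow> complex.
        (\<forall>i. simple_function M (s i) \<and> (\<forall>t\<in>space M. s i t \<in> X) \<and>
             emeasure M {t \<in> space M. s i t \<noteq> (\<lambda>_. 0)} \<noteq> \<infinity> \<and>
             (\<lambda>t. N (\<lambda>z. h t z - s i t z)) \<in> borel_measurable M) \<and>
        (\<lambda>i. \<integral>\<^sup>+ t. ennreal (N (\<lambda>z. h t z - s i t z)) \<partial>M) \<longlonglongrightarrow> 0 \<and>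
        (\<lambda>i. N (\<lambda>z. simple_integral M (s i) z - g z)) \<longlonglongrightarrow> 0)"

definition integral_in ::
  "('a \<Rightarrow> complex) set \<Rightarrow> (('a \<Rightarrow> complex) \<Rightarrow> real) \<Rightarrow> 't measure \<Rightarrow>
   ('t \<Rightarrow> 'a \<Rightarrow> complex) \<Rightarrow> 'a \<Rightarrow> complex" where
  "integral_in X N M h = (THE g. has_integral_in X N M h g)"

section \<open>Weighted Bergman spaces and weighted composition operators\<close>

abbreviation unit_disk :: "complex set" where
  "unit_disk \<equiv> ball 0 1"

definition dA :: "real \<Rightarrow> complex measure" where
  "dA \<alpha> = density (restrict_space lborel unit_disk)
     (\<lambda>z. ennreal ((1 + \<alpha>) * (1 - (norm z)\<^sup>2) powr \<alpha> / pi))"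

text \<open>
  Functions on the disk are represented by their extension by zero, so that equality in the
  Bergman space is equality of functions.
\<close>

definition bergman :: "real \<Rightarrow> real \<Rightarrow> (complex \<Rightarrow> complex) set" where
  "bergman p \<alpha> = {f. f holomorphic_on unit_disk \<and> (\<forall>z. z \<notin> unit_disk \<longrightarrow> f z = 0) \<and>
     integrable (dA \<alpha>) (\<lambda>z. norm (f z) powr p)}"

definition bergman_norm :: "real \<Rightarrow> real \<Rightarrow> (complex \<Rightarrow> complex) \<Rightarrow> real" where
  "bergman_norm p \<alpha> f = (LINT z|dA \<alpha>. norm (f z) powr p) powr (1 / p)"

definition wcomp :: "(complex \<Rightarrow> complex) \<Rightarrow> (complex \<Rightarrow> complex) \<Rightarrow>
    (complex \<Rightarrow> complex) \<Rightarrow> complex \<Rightarrow> complex" where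
  "wcomp u \<phi> f = (\<lambda>z. if z \<in> unit_disk then u z * f (\<phi> z) else 0)"

abbreviation lborel01 :: "real measure" where
  "lborel01 \<equiv> restrict_space lborel {0<..<1}"

end

theory Submission
  imports Defs
begin

text \<open>
  On the Bergman space there are compact operators \<open>J n\<close>, averages of dilations, with
  \<open>\<parallel>I - J n\<parallel> \<rightarrow> 1\<close> that tend to the identity locally uniformly on the unit ball.  For every bounded
  \<open>T\<close> the norms of \<open>T (I - J n)\<close> therefore tend to the essential norm of \<open>T\<close>, and some weakly null
  sequence \<open>F\<close> in the unit sphere satisfies \<open>\<parallel>T (F n)\<parallel> \<rightarrow> \<parallel>T\<parallel>\<^sub>e\<close>, whereas \<open>\<parallel>S (F n)\<parallel>\<close> has upper limit
  at most \<open>\<parallel>S\<parallel>\<^sub>e\<close> for every bounded \<open>S\<close>.  The first fact also makes \<open>t \<mapsto> \<parallel>S t\<parallel>\<^sub>e\<close> a limit of lower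
  semicontinuous functions, hence measurable.

  Apply this to the integral \<open>T\<close> of the family \<open>S t\<close>.  If \<open>\<parallel>T\<parallel>\<^sub>e\<close> were at least the integral of
  \<open>\<parallel>S t\<parallel>\<^sub>e\<close>, then, as \<open>\<parallel>T (F n)\<parallel>\<close> is at most the integral of \<open>\<parallel>S t (F n)\<parallel>\<close>, dominated convergence of
  the positive part of \<open>\<parallel>S t (F n)\<parallel> - \<parallel>S t\<parallel>\<^sub>e\<close> would force this difference to tend to \<open>0\<close> in \<open>L\<^sup>1\<close>, so
  almost everywhere along a subsequence of \<open>F\<close>.
\<close>

section \<open>$L^p$ seminorms\<close>

text \<open>Two obstacles shape the construction. A single \<open>dilate r\<close> is compact and
  close to the identity on compact sets, but the bound available for \<open>I - dilate r\<close>
  exceeds 1, and normalising \<open>R n (x n)\<close> would then reach only a fraction of the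
  essential norm. Averaging repairs this: the errors of suitable dilations live on almost disjoint
  annuli, where p-th powers of norms add, so a sum of n errors grows like
  \<open>n powr (1 / p)\<close> and the average tends to 0. This is where p > 1 enters. The same
  growth rate makes bounded sequences that vanish locally uniformly weakly null, so neither a
  description of the dual space nor reflexivity is invoked. Cut-offs to annuli are not holomorphic;
  hence the estimates take place in \<open>Lp_space\<close>, a seminormed space of functions rather
  than of classes. Measurability of the essential norm needs an argument because it is an infimum
  over an uncountable family, and the integral of a non-measurable function is 0 by convention,
  which would make the strict inequality false.\<close>

definition Lp_space :: "'a measure \<Rightarrow> real \<Rightarrow> ('a \<Rightarrow> complex) set" where
  "Lp_space M p = {f \<in> borel_measurable M. integrable M (\<lambda>z. norm (f z) powr p)}"

definition Lp_norm :: "'a measure \<Rightarrow> real \<Rightarrow> ('a \<Rightarrow> complex) \<Rightarrow> real" where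
  "Lp_norm M p f = (LINT z|M. norm (f z) powr p) powr (1 / p)"

lemma Lp_spaceD:
  assumes "f \<in> Lp_space M p"
  shows "f \<in> borel_measurable M" "integrable M (\<lambda>z. norm (f z) powr p)"
  using assms by (auto simp: Lp_space_def)

lemma Lp_norm_nonneg [simp]: "0 \<le> Lp_norm M p f"
  by (simp add: Lp_norm_def)

lemma Lp_norm_powr:
  assumes "p > 0"
  shows "Lp_norm M p f powr p = (LINT z|M. norm (f z) powr p)"
  using assms by (simp add: Lp_norm_def powr_powr)

lemma Lp_norm_le_iff:
  assumes "p > 0" "C \<ge> 0"
  shows "Lp_norm M p f \<le> C \<longleftrightarrow> (LINT z|M. norm (f z) powr p) \<le> C powr p"
proof -
  have "Lp_norm M p f \<le> C \<longleftrightarrow> Lp_norm M p f powr p \<le> C powr p"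
    using assms powr_mono2[of p "Lp_norm M p f" C] powr_less_mono2[of p C "Lp_norm M p f"]
    by (meson Lp_norm_nonneg less_imp_le not_le)
  then show ?thesis using assms by (simp add: Lp_norm_powr)
qed

lemma Lp_dominated:
  assumes "p > 0" "g \<in> Lp_space M p" "f \<in> borel_measurable M"
    and "\<And>z. z \<in> space M \<Longrightarrow> norm (f z) \<le> norm (g z)"
  shows "f \<in> Lp_space M p" "Lp_norm M p f \<le> Lp_norm M p g"
proof -
  have [measurable]: "f \<in> borel_measurable M" by fact
  have le: "norm (f z) powr p \<le> norm (g z) powr p" if "z \<in> space M" for z
    using assms that by (intro powr_mono2) auto
  have int: "integrable M (\<lambda>z. norm (f z) powr p)"
    by (rule Bochner_Integration.integrable_bound[OF Lp_spaceD(2)[OF assms(2)]]) (auto simp: le)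
  then show "f \<in> Lp_space M p" by (simp add: Lp_space_def)
  show "Lp_norm M p f \<le> Lp_norm M p g"
    unfolding Lp_norm_def
    by (rule powr_mono2) (use assms in \<open>auto intro!: integral_mono int Lp_spaceD le\<close>)
qed

lemma Lp_scale:
  assumes "f \<in> Lp_space M p"
  shows "(\<lambda>z. c * f z) \<in> Lp_space M p"
  using Lp_spaceD[OF assms] by (auto simp: Lp_space_def norm_mult powr_mult)

lemma Lp_norm_scale:
  assumes "p > 0"
  shows "Lp_norm M p (\<lambda>z. c * f z) = norm c * Lp_norm M p f"
  using assms by (simp add: Lp_norm_def norm_mult powr_mult powr_powr)

lemma Lp_zero: "(\<lambda>_. 0) \<in> Lp_space M p" "p > 0 \<Longrightarrow> Lp_norm M p (\<lambda>_. 0) = 0"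
  by (auto simp: Lp_space_def Lp_norm_def)

text \<open>Convexity is applied at positive points only; if one argument is 0, the claim reduces to
  s^p <= s for 0 < s <= 1.\<close>

lemma powr_convex_combination:
  fixes x y s t p :: real
  assumes "p \<ge> 1" "x \<ge> 0" "y \<ge> 0" "s > 0" "t > 0" "s + t = 1"
  shows "(s * x + t * y) powr p \<le> s * x powr p + t * y powr p"
proof -
  have *: "(s * x) powr p \<le> s * x powr p" if "0 < s" "s \<le> 1" "x \<ge> 0" for s x :: real
  proof -
    have "s powr p \<le> s powr 1" using that assms(1) by (intro powr_mono') auto
    then show ?thesis using that by (simp add: powr_mult mult_right_mono)
  qed
  consider "x = 0" | "y = 0" | "x > 0" "y > 0" using assms by linarith
  then show ?thesis
  proof cases
    case 3
    have "s = 1 - t" using assms by simp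
    with 3 show ?thesis
      using convex_onD[OF powr_convex[OF assms(1)], of t x y] assms(4,5) by simp
  qed (use *[of t y] *[of s x] assms in auto)
qed

text \<open>f + g is a + b times the convex combination of f / a and g / b with weights a / (a + b)
  and b / (a + b). Pointwise convexity of the p-th power then replaces Hoelder's inequality.\<close>

lemma Minkowski:
  assumes "p \<ge> 1" and f: "f \<in> Lp_space M p" and g: "g \<in> Lp_space M p"
  shows "(\<lambda>z. f z + g z) \<in> Lp_space M p"
    and "Lp_norm M p (\<lambda>z. f z + g z) \<le> Lp_norm M p f + Lp_norm M p g"
proof -
  have p: "p > 0" using assms by simp
  note [measurable] = Lp_spaceD(1)[OF f] Lp_spaceD(1)[OF g]
  note int [intro, simp] = Lp_spaceD(2)[OF f] Lp_spaceD(2)[OF g]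
  have key: "norm (f z + g z) powr p \<le>
      (a + b) powr p * ((a / (a + b)) * (norm (f z) powr p / a powr p)
        + (b / (a + b)) * (norm (g z) powr p / b powr p))"
    if "a > 0" "b > 0" for a b z
  proof -
    have "norm (f z + g z) powr p \<le>
        ((a + b) * ((a / (a + b)) * (norm (f z) / a) + (b / (a + b)) * (norm (g z) / b))) powr p"
      using that p norm_triangle_ineq[of "f z" "g z"]
      by (intro powr_mono2) (auto simp: distrib_left)
    also have "\<dots> = (a + b) powr p *
        ((a / (a + b)) * (norm (f z) / a) + (b / (a + b)) * (norm (g z) / b)) powr p"
      using that by (intro powr_mult)
    also have "\<dots> \<le> (a + b) powr p *
        ((a / (a + b)) * (norm (f z) / a) powr p + (b / (a + b)) * (norm (g z) / b) powr p)"
      using that assms(1)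
      by (intro mult_left_mono powr_convex_combination) (auto simp: add_divide_distrib[symmetric])
    finally show ?thesis
      using that by (simp add: powr_divide)
  qed
  \<comment> \<open>For integrability any positive a and b will do; both are taken to be 1.\<close>
  have int_sum: "integrable M (\<lambda>z. norm (f z + g z) powr p)"
    by (rule Bochner_Integration.integrable_bound[where f = "\<lambda>z. (1 + 1) powr p * ((1 / (1 + 1)) *
          (norm (f z) powr p / 1 powr p) + (1 / (1 + 1)) * (norm (g z) powr p / 1 powr p))"])
       (use key[of 1 1] in \<open>auto intro!: integrable_add integrable_mult_right\<close>)
  then show "(\<lambda>z. f z + g z) \<in> Lp_space M p" by (simp add: Lp_space_def)
  show "Lp_norm M p (\<lambda>z. f z + g z) \<le> Lp_norm M p f + Lp_norm M p g"
  proof (rule field_le_epsilon)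
    fix e :: real assume "e > 0"
    \<comment> \<open>The extra \<open>e / 2\<close> keeps a and b positive even if a norm
      vanishes.\<close>
    define a b where "a = Lp_norm M p f + e / 2" and "b = Lp_norm M p g + e / 2"
    have ab: "a > 0" "b > 0"
      using \<open>e > 0\<close> by (auto simp: a_def b_def add_nonneg_pos)
    have fa: "(LINT z|M. norm (f z) powr p) \<le> a powr p"
      and gb: "(LINT z|M. norm (g z) powr p) \<le> b powr p"
      using p \<open>e > 0\<close> ab by (auto simp: Lp_norm_le_iff[symmetric] less_imp_le) (auto simp: a_def b_def)
    have "(LINT z|M. norm (f z + g z) powr p) \<le>
        (LINT z|M. (a + b) powr p * ((a / (a + b)) * (norm (f z) powr p / a powr p)
        + (b / (a + b)) * (norm (g z) powr p / b powr p)))"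
      by (intro integral_mono int_sum key ab) auto
    also have "\<dots> = (a + b) powr p * ((a / (a + b)) * ((LINT z|M. norm (f z) powr p) / a powr p)
        + (b / (a + b)) * ((LINT z|M. norm (g z) powr p) / b powr p))"
      by simp
    also have "\<dots> \<le> (a + b) powr p * ((a / (a + b)) * 1 + (b / (a + b)) * 1)"
      using ab fa gb by (intro mult_left_mono add_mono) (auto simp: divide_le_eq)
    also have "\<dots> = (a + b) powr p"
      using ab by (simp add: add_divide_distrib[symmetric])
    finally have "Lp_norm M p (\<lambda>z. f z + g z) \<le> a + b"
      using ab p by (subst Lp_norm_le_iff) auto
    then show "Lp_norm M p (\<lambda>z. f z + g z) \<le> Lp_norm M p f + Lp_norm M p g + e"
      by (simp add: a_def b_def)
  qed
qed

lemma Lp_diff: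
  assumes "p \<ge> 1" "f \<in> Lp_space M p" "g \<in> Lp_space M p"
  shows "(\<lambda>z. f z - g z) \<in> Lp_space M p"
    and "Lp_norm M p (\<lambda>z. f z - g z) \<le> Lp_norm M p f + Lp_norm M p g"
proof -
  have m: "(\<lambda>z. (-1) * g z) \<in> Lp_space M p"
    "Lp_norm M p (\<lambda>z. (-1) * g z) = Lp_norm M p g"
    using assms Lp_scale[of g M p "-1"] Lp_norm_scale[of p M "-1" g] by auto
  show "(\<lambda>z. f z - g z) \<in> Lp_space M p"
    "Lp_norm M p (\<lambda>z. f z - g z) \<le> Lp_norm M p f + Lp_norm M p g"
    using Minkowski[OF assms(1,2) m(1)] m(2) by auto
qed

lemma Lp_sum:
  assumes "p \<ge> 1" "finite I" "\<And>i. i \<in> I \<Longrightarrow> f i \<in> Lp_space M p"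
  shows "(\<lambda>z. \<Sum>i\<in>I. f i z) \<in> Lp_space M p \<and>
    Lp_norm M p (\<lambda>z. \<Sum>i\<in>I. f i z) \<le> (\<Sum>i\<in>I. Lp_norm M p (f i))"
  using assms(2,3)
proof (induction I rule: finite_induct)
  case empty
  then show ?case using assms(1) by (simp add: Lp_zero)
next
  case (insert i I)
  then show ?case
    using Minkowski[OF assms(1), of "f i" M "\<lambda>z. \<Sum>i\<in>I. f i z"] by force
qed

lemma Lp_indicator:
  assumes "p > 0" "f \<in> Lp_space M p" "B \<in> sets M"
  shows "(\<lambda>z. indicator B z * f z) \<in> Lp_space M p"
    and "Lp_norm M p (\<lambda>z. indicator B z * f z) \<le> Lp_norm M p f"
proof -
  note [measurable] = Lp_spaceD(1)[OF assms(2)] assms(3)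
  have "(\<lambda>z. indicator B z * f z :: complex) \<in> borel_measurable M"
    by measurable
  note * = Lp_dominated[OF assms(1,2) this]
  show "(\<lambda>z. indicator B z * f z) \<in> Lp_space M p"
       "Lp_norm M p (\<lambda>z. indicator B z * f z) \<le> Lp_norm M p f"
    by (rule *; simp add: indicator_def)+
qed

lemma (in finite_measure) Lp_bounded:
  assumes "p > 0" "f \<in> borel_measurable M" "\<And>z. z \<in> space M \<Longrightarrow> norm (f z) \<le> C"
    "\<And>z. z \<in> space M - B \<Longrightarrow> f z = 0" "B \<in> sets M" "C \<ge> 0"
  shows "f \<in> Lp_space M p" "Lp_norm M p f \<le> C * measure M B powr (1 / p)"
proof -
  have eq: "(\<lambda>z. norm (indicator B z * complex_of_real C) powr p) = (\<lambda>z. C powr p * indicator B z)"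
    using assms by (auto simp: indicator_def norm_mult)
  have "(\<lambda>z. indicator B z * complex_of_real C) \<in> Lp_space M p"
    using assms by (auto simp: Lp_space_def eq less_top[symmetric])
  note * = Lp_dominated[OF assms(1) this assms(2)]
  have le: "norm (f z) \<le> norm (indicator B z * complex_of_real C)" if "z \<in> space M" for z
    using assms(3,4)[of z] that assms(6) by (auto simp: indicator_def)
  show "f \<in> Lp_space M p" using * le by blast
  have "Lp_norm M p (\<lambda>z. indicator B z * complex_of_real C) = C * measure M B powr (1 / p)"
    using assms sets.sets_into_space[of B M]
    by (simp add: Lp_norm_def eq powr_mult powr_powr Int_absorb1)
  then show "Lp_norm M p f \<le> C * measure M B powr (1 / p)" using * le by metis
qed

text \<open>On disjoint supports p-th powers of norms add. The exponent 1 / p, instead of the 1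
  given by the triangle inequality, is the gain behind the whole construction.\<close>

lemma Lp_norm_disjoint_sum:
  assumes "p \<ge> 1" "finite I" "disjoint_family_on B I" "C \<ge> 0"
    and "\<And>i. i \<in> I \<Longrightarrow> B i \<in> sets M"
    and "\<And>i. i \<in> I \<Longrightarrow> g i \<in> Lp_space M p"
    and "\<And>i. i \<in> I \<Longrightarrow> Lp_norm M p (g i) \<le> C"
  shows "Lp_norm M p (\<lambda>z. \<Sum>i\<in>I. indicator (B i) z * g i z) \<le> C * card I powr (1 / p)"
proof -
  have p: "p > 0" using assms by simp
  have ind: "(\<lambda>z. indicator (B i) z * g i z) \<in> Lp_space M p" 
       "Lp_norm M p (\<lambda>z. indicator (B i) z * g i z) \<le> C" if "i \<in> I" for i
    using that Lp_indicator[OF p assms(6) assms(5)] assms(7)[OF that] by force+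
  \<comment> \<open>At every point at most one summand is nonzero, so the p-th power passes inside
    the sum.\<close>
  have eq: "norm (\<Sum>i\<in>I. indicator (B i) z * g i z) powr p =
      (\<Sum>i\<in>I. norm (indicator (B i) z * g i z) powr p)" for z
  proof (cases "\<exists>j\<in>I. z \<in> B j")
    case True
    then obtain j where j: "j \<in> I" "z \<in> B j" by blast
    then have "z \<notin> B i" if "i \<in> I - {j}" for i
      using assms(3) that by (auto simp: disjoint_family_on_def)
    then have *: "indicator (B i) z * g i z = 0" if "i \<in> I - {j}" for i
      using that by simp
    have "(\<Sum>i\<in>I - {j}. indicator (B i) z * g i z) = 0"
         "(\<Sum>i\<in>I - {j}. norm (indicator (B i) z * g i z) powr p) = 0"
      using * by (intro sum.neutral ballI; simp)+
    then show ?thesis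
      by (simp only: sum.remove[OF assms(2) j(1)] add_0_right)
  qed (auto simp: indicator_def)
  have "(LINT z|M. norm (\<Sum>i\<in>I. indicator (B i) z * g i z) powr p) =
      (\<Sum>i\<in>I. LINT z|M. norm (indicator (B i) z * g i z) powr p)"
    unfolding eq using Lp_spaceD(2)[OF ind(1)] by (intro Bochner_Integration.integral_sum) auto
  also have "\<dots> \<le> (\<Sum>i\<in>I. C powr p)"
    using ind(2) assms(4) p by (intro sum_mono) (auto simp: Lp_norm_le_iff)
  also have "\<dots> = (C * card I powr (1 / p)) powr p"
    using p by (simp add: powr_mult powr_powr)
  finally show ?thesis
    using p assms(4) by (subst Lp_norm_le_iff) auto
qed

text \<open>The main parts, cut off to the sets \<open>B i\<close>, profit from disjointness; the
  remainders are so small that the triangle inequality is affordable.\<close>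

lemma Lp_norm_almost_disjoint_sum:
  fixes C e :: real
  assumes "p \<ge> 1" "finite I" "disjoint_family_on B I" "C \<ge> 0"
    and B: "\<And>i. i \<in> I \<Longrightarrow> B i \<in> sets M"
    and g: "\<And>i. i \<in> I \<Longrightarrow> g i \<in> Lp_space M p"
    and gC: "\<And>i. i \<in> I \<Longrightarrow> Lp_norm M p (g i) \<le> C"
    and ge: "\<And>i. i \<in> I \<Longrightarrow> Lp_norm M p (\<lambda>z. indicator (space M - B i) z * g i z) \<le> e"
  shows "Lp_norm M p (\<lambda>z. \<Sum>i\<in>I. g i z) \<le> C * card I powr (1 / p) + card I * e"
proof -
  have p: "p > 0" using assms by simp
  let ?a = "\<lambda>z. \<Sum>i\<in>I. indicator (B i) z * g i z"
  let ?b = "\<lambda>z. \<Sum>i\<in>I. indicator (space M - B i) z * g i z"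
  have a: "?a \<in> Lp_space M p"
    using Lp_sum[OF assms(1,2) Lp_indicator(1)[OF p g B]] by auto
  have b: "?b \<in> Lp_space M p"
    and be: "Lp_norm M p ?b \<le> (\<Sum>i\<in>I. Lp_norm M p (\<lambda>z. indicator (space M - B i) z * g i z))"
    using Lp_sum[OF assms(1,2) Lp_indicator(1)[OF p g sets.compl_sets[OF B]]] by auto
  have "Lp_norm M p (\<lambda>z. \<Sum>i\<in>I. g i z) = Lp_norm M p (\<lambda>z. ?a z + ?b z)"
    unfolding Lp_norm_def
    by (intro arg_cong2[where f = "(powr)"] Bochner_Integration.integral_cong refl)
       (auto simp: sum.distrib[symmetric] indicator_def intro!: sum.cong arg_cong2[where f = "(powr)"] arg_cong[where f = norm])
  also have "\<dots> \<le> Lp_norm M p ?a + Lp_norm M p ?b"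
    by (rule Minkowski(2)[OF assms(1) a b])
  also have "\<dots> \<le> C * card I powr (1 / p) + (\<Sum>i\<in>I. e :: real)"
    by (intro add_mono Lp_norm_disjoint_sum order_trans[OF be] sum_mono assms)
  finally show ?thesis by simp
qed

section \<open>Operators on a normed space of functions with bounded point evaluations\<close>

lemma null_sequence_squeeze:
  fixes a b :: "nat \<Rightarrow> real"
  assumes "\<And>n. 0 \<le> a n" "\<And>n. a n \<le> b n" "b \<longlonglongrightarrow> 0"
  shows "a \<longlonglongrightarrow> 0"
  using assms by (intro tendsto_sandwich[OF _ _ tendsto_const assms(3)]) auto

text \<open>Bounded point evaluations make \<open>N\<close> definite and let values at single points
  identify norm limits, weak limits and integrals. Completeness is required only where integrals are
  constructed.\<close>

locale evaluation_space =
  fixes X :: "('a \<Rightarrow> complex) set" and N :: "('a \<Rightarrow> complex) \<Rightarrow> real"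
  assumes zero_mem [simp]: "(\<lambda>_. 0) \<in> X"
    and lin_mem: "f \<in> X \<Longrightarrow> g \<in> X \<Longrightarrow> (\<lambda>z. a * f z + b * g z) \<in> X"
    and nonneg: "f \<in> X \<Longrightarrow> 0 \<le> N f"
    and triangle: "f \<in> X \<Longrightarrow> g \<in> X \<Longrightarrow> N (\<lambda>z. f z + g z) \<le> N f + N g"
    and scale: "f \<in> X \<Longrightarrow> N (\<lambda>z. c * f z) = norm c * N f"
    and eval_bounded: "\<exists>C. \<forall>f\<in>X. norm (f z) \<le> C * N f"
begin

abbreviation B where "B \<equiv> bounded_ops X N"
abbreviation K where "K \<equiv> compact_ops X N"

lemma scale_mem: "f \<in> X \<Longrightarrow> (\<lambda>z. c * f z) \<in> X"
  using lin_mem[of f f c 0] by simp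

lemma add_mem: "f \<in> X \<Longrightarrow> g \<in> X \<Longrightarrow> (\<lambda>z. f z + g z) \<in> X"
  using lin_mem[of f g 1 1] by simp

lemma diff_mem: "f \<in> X \<Longrightarrow> g \<in> X \<Longrightarrow> (\<lambda>z. f z - g z) \<in> X"
  using lin_mem[of f g 1 "-1"] by simp

lemma norm_zero_fun [simp]: "N (\<lambda>_. 0) = 0"
  using scale[of "\<lambda>_. 0" 0] by simp

lemma norm_minus_commute_fun:
  "f \<in> X \<Longrightarrow> g \<in> X \<Longrightarrow> N (\<lambda>z. f z - g z) = N (\<lambda>z. g z - f z)"
  using scale[OF diff_mem, of f g "-1"] by simp

lemma triangle_diff: "f \<in> X \<Longrightarrow> g \<in> X \<Longrightarrow> N (\<lambda>z. f z - g z) \<le> N f + N g"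
  using triangle[OF _ scale_mem, of f g "-1"] scale[of g "-1"] by simp

lemma triangle_via:
  assumes "f \<in> X" "g \<in> X" "h \<in> X"
  shows "N (\<lambda>z. f z - h z) \<le> N (\<lambda>z. f z - g z) + N (\<lambda>z. g z - h z)"
  using triangle[OF diff_mem diff_mem, OF assms(1,2,2,3)] by simp

lemma triangle_reverse:
  assumes "f \<in> X" "g \<in> X"
  shows "\<bar>N f - N g\<bar> \<le> N (\<lambda>z. f z - g z)"
  using triangle[OF diff_mem, OF assms assms(2)] triangle[OF diff_mem, OF assms(2,1) assms(1)]
    norm_minus_commute_fun[OF assms] by simp

lemma sum_mem:
  assumes "finite I" "\<And>i. i \<in> I \<Longrightarrow> f i \<in> X"
  shows "(\<lambda>z. \<Sum>i\<in>I. f i z) \<in> X \<and> N (\<lambda>z. \<Sum>i\<in>I. f i z) \<le> (\<Sum>i\<in>I. N (f i))"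
  using assms
proof (induction I rule: finite_induct)
  case (insert i I)
  then show ?case
    using add_mem[of "f i" "\<lambda>z. \<Sum>i\<in>I. f i z"] triangle[of "f i" "\<lambda>z. \<Sum>i\<in>I. f i z"] by force
qed simp

section \<open>Bounded operators and the operator norm\<close>

lemma opD:
  assumes "T \<in> B" "f \<in> X"
  shows "T f \<in> X"
  using assms by (auto simp: bounded_ops_def)

lemma op_lin:
  assumes "T \<in> B" "f \<in> X" "g \<in> X"
  shows "T (\<lambda>z. a * f z + b * g z) = (\<lambda>z. a * T f z + b * T g z)"
  using assms by (auto simp: bounded_ops_def)

lemma op_scale:
  assumes "T \<in> B" "f \<in> X"
  shows "T (\<lambda>z. a * f z) = (\<lambda>z. a * T f z)"
  using op_lin[OF assms assms(2), of a 0] by simp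

lemma op_diff:
  assumes "T \<in> B" "f \<in> X" "g \<in> X"
  shows "T (\<lambda>z. f z - g z) = (\<lambda>z. T f z - T g z)"
  using op_lin[OF assms, of 1 "-1"] by simp

lemma bounded_opsI:
  assumes "\<And>f. f \<in> X \<Longrightarrow> T f \<in> X"
    and "\<And>f g a b. f \<in> X \<Longrightarrow> g \<in> X \<Longrightarrow> T (\<lambda>z. a * f z + b * g z) = (\<lambda>z. a * T f z + b * T g z)"
    and "\<And>f. f \<in> X \<Longrightarrow> N (T f) \<le> C * N f"
  shows "T \<in> B"
  using assms unfolding bounded_ops_def by blast

lemma op_bound:
  assumes "T \<in> B"
  obtains C where "C \<ge> 0" "\<And>f. f \<in> X \<Longrightarrow> N (T f) \<le> C * N f"
proof -
  obtain C where C: "\<And>f. f \<in> X \<Longrightarrow> N (T f) \<le> C * N f"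
    using assms unfolding bounded_ops_def by blast
  have "N (T f) \<le> max C 0 * N f" if "f \<in> X" for f
    using C[OF that] mult_right_mono[of C "max C 0" "N f"] nonneg[OF that] by linarith
  then show ?thesis using that[of "max C 0"] by auto
qed

lemma op_norm_bdd_above:
  assumes "T \<in> B"
  shows "bdd_above ((\<lambda>f. N (T f)) ` {f \<in> X. N f \<le> 1})"
proof -
  obtain C where C: "C \<ge> 0" "\<And>f. f \<in> X \<Longrightarrow> N (T f) \<le> C * N f"
    using op_bound[OF assms] by blast
  have "N (T f) \<le> C" if "f \<in> X" "N f \<le> 1" for f
    using C(2)[OF that(1)] mult_left_mono[OF that(2) C(1)] by linarith
  then show ?thesis by (auto intro!: bdd_aboveI2)
qed

lemma op_norm_upper1:
  assumes "T \<in> B" "f \<in> X" "N f \<le> 1"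
  shows "N (T f) \<le> op_norm X N T"
  unfolding op_norm_def by (rule cSUP_upper[OF _ op_norm_bdd_above]) (use assms in auto)

lemma op_norm_nonneg:
  assumes "T \<in> B" shows "0 \<le> op_norm X N T"
  using op_norm_upper1[OF assms, of "\<lambda>_. 0"] nonneg[OF opD[OF assms zero_mem]] by simp

lemma op_norm_upper:
  assumes "T \<in> B" "f \<in> X"
  shows "N (T f) \<le> op_norm X N T * N f"
proof (cases "N f = 0")
  case True
  obtain C where C: "C \<ge> 0" "\<And>f. f \<in> X \<Longrightarrow> N (T f) \<le> C * N f"
    using op_bound[OF assms(1)] by blast
  show ?thesis using C(2)[OF assms(2)] True by simp
next
  case False
  then have pos: "N f > 0" using nonneg[OF assms(2)] by simp
  define c where "c = complex_of_real (1 / N f)"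
  have nc: "norm c = 1 / N f" using pos by (simp add: c_def norm_divide)
  have "N (T (\<lambda>z. c * f z)) \<le> op_norm X N T"
    by (rule op_norm_upper1[OF assms(1) scale_mem[OF assms(2)]])
       (use pos in \<open>simp add: scale[OF assms(2)] nc\<close>)
  then have "N (T f) / N f \<le> op_norm X N T"
    by (simp add: op_scale[OF assms] scale[OF opD[OF assms]] nc)
  then show ?thesis using pos by (simp add: divide_le_eq)
qed

lemma unit_ball_nonempty: "{f \<in> X. N f \<le> 1} \<noteq> {}"
  using zero_mem norm_zero_fun by (metis (mono_tags, lifting) empty_iff mem_Collect_eq zero_le_one)

lemma op_norm_least:
  assumes "\<And>f. f \<in> X \<Longrightarrow> N f \<le> 1 \<Longrightarrow> N (T f) \<le> C"
  shows "op_norm X N T \<le> C"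
  unfolding op_norm_def by (rule cSUP_least[OF unit_ball_nonempty]) (use assms in simp)

text \<open>In this form the superlevel sets of an operator norm are unions over the unit ball,
  which later gives lower semicontinuity in a parameter; it also supplies almost maximising
  vectors.\<close>

lemma op_norm_less_iff:
  assumes "T \<in> B"
  shows "a < op_norm X N T \<longleftrightarrow> (\<exists>f\<in>X. N f \<le> 1 \<and> a < N (T f))"
  unfolding op_norm_def less_cSUP_iff[OF unit_ball_nonempty op_norm_bdd_above[OF assms]] by blast

lemma op_combination:
  assumes "T \<in> B" "U \<in> B"
  shows "(\<lambda>f z. a * T f z + b * U f z) \<in> B"
proof -
  obtain C where C: "\<And>f. f \<in> X \<Longrightarrow> N (T f) \<le> C * N f" using op_bound[OF assms(1)] by blast
  obtain D where D: "\<And>f. f \<in> X \<Longrightarrow> N (U f) \<le> D * N f" using op_bound[OF assms(2)] by blast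
  show ?thesis
  proof (rule bounded_opsI[where C = "norm a * C + norm b * D"])
    fix f assume f: "f \<in> X"
    show "(\<lambda>z. a * T f z + b * U f z) \<in> X" by (rule lin_mem[OF opD[OF assms(1) f] opD[OF assms(2) f]])
    have "N (\<lambda>z. a * T f z + b * U f z) \<le> norm a * N (T f) + norm b * N (U f)"
      using triangle[OF scale_mem scale_mem, OF opD opD, OF assms(1) f assms(2) f, of a b]
      by (simp add: scale opD[OF assms(1) f] opD[OF assms(2) f])
    also have "\<dots> \<le> norm a * (C * N f) + norm b * (D * N f)"
      by (intro add_mono mult_left_mono C D f) auto
    finally show "N (\<lambda>z. a * T f z + b * U f z) \<le> (norm a * C + norm b * D) * N f"
      by (simp add: algebra_simps)
  next
    fix f g c d assume "f \<in> X" "g \<in> X"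
    then show "(\<lambda>z. a * T (\<lambda>z. c * f z + d * g z) z + b * U (\<lambda>z. c * f z + d * g z) z) =
        (\<lambda>z. c * (a * T f z + b * U f z) + d * (a * T g z + b * U g z))"
      unfolding op_lin[OF assms(1) \<open>f \<in> X\<close> \<open>g \<in> X\<close>] op_lin[OF assms(2) \<open>f \<in> X\<close> \<open>g \<in> X\<close>]
      by (simp add: algebra_simps)
  qed
qed

lemma op_minus:
  assumes "T \<in> B" "U \<in> B"
  shows "(\<lambda>f z. T f z - U f z) \<in> B"
  using op_combination[OF assms, of 1 "-1"] by simp

lemma op_comp:
  assumes "T \<in> B" "U \<in> B"
  shows "(\<lambda>f. T (U f)) \<in> B"
proof -
  obtain C where C: "C \<ge> 0" "\<And>f. f \<in> X \<Longrightarrow> N (T f) \<le> C * N f" using op_bound[OF assms(1)] by blast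
  obtain D where D: "\<And>f. f \<in> X \<Longrightarrow> N (U f) \<le> D * N f" using op_bound[OF assms(2)] by blast
  show ?thesis
  proof (rule bounded_opsI[where C = "C * D"])
    fix f assume f: "f \<in> X"
    show "T (U f) \<in> X" by (rule opD[OF assms(1) opD[OF assms(2) f]])
    have "N (T (U f)) \<le> C * (D * N f)"
      using C(2)[OF opD[OF assms(2) f]] mult_left_mono[OF D[OF f] C(1)] by linarith
    then show "N (T (U f)) \<le> C * D * N f" by (simp add: mult.assoc)
  next
    fix f g c d assume "f \<in> X" "g \<in> X"
    then show "T (U (\<lambda>z. c * f z + d * g z)) = (\<lambda>z. c * T (U f) z + d * T (U g) z)"
      using op_lin[OF assms(2), of f g c d] op_lin[OF assms(1), of "U f" "U g" c d]
        opD[OF assms(2)] by simp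
  qed
qed

lemma op_id: "(\<lambda>f. f) \<in> B"
  by (rule bounded_opsI[where C = 1]) simp_all

lemma op_zero: "(\<lambda>f _. 0) \<in> B"
  by (rule bounded_opsI[where C = 0]) simp_all

section \<open>Compact operators\<close>

lemma compactD: "T \<in> K \<Longrightarrow> T \<in> B"
  by (simp add: compact_ops_def)

lemma compact_extract:
  assumes "T \<in> K" "\<And>n. F n \<in> X" "\<And>n. N (F n) \<le> 1"
  obtains g and r :: "nat \<Rightarrow> nat"
  where "g \<in> X" "strict_mono r" "(\<lambda>n. N (\<lambda>z. T (F (r n)) z - g z)) \<longlonglongrightarrow> 0"
  using assms unfolding compact_ops_def by blast

lemma compact_zero: "(\<lambda>f _. 0) \<in> K"
  unfolding compact_ops_def
proof safe
  fix F :: "nat \<Rightarrow> 'a \<Rightarrow> complex"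
  show "\<exists>g\<in>X. \<exists>r :: nat \<Rightarrow> nat. strict_mono r \<and> (\<lambda>n. N (\<lambda>z. 0 - g z)) \<longlonglongrightarrow> 0"
    by (rule bexI[of _ "(\<lambda>_. 0) :: 'a \<Rightarrow> complex"], rule exI[of _ "id :: nat \<Rightarrow> nat"])
       (simp_all add: strict_mono_def)
qed (rule op_zero)

lemma compact_combination:
  assumes T: "T \<in> K" and U: "U \<in> K"
  shows "(\<lambda>f z. a * T f z + b * U f z) \<in> K"
  unfolding compact_ops_def
proof safe
  show "(\<lambda>f z. a * T f z + b * U f z) \<in> B"
    by (intro op_combination compactD assms)
  fix F :: "nat \<Rightarrow> 'a \<Rightarrow> complex" assume F: "\<forall>n. F n \<in> X \<and> N (F n) \<le> 1"
  obtain g r where g: "g \<in> X" "strict_mono (r :: nat \<Rightarrow> nat)"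
    "(\<lambda>n. N (\<lambda>z. T (F (r n)) z - g z)) \<longlonglongrightarrow> 0"
    using compact_extract[OF T, of F] F by blast
  obtain h s where h: "h \<in> X" "strict_mono (s :: nat \<Rightarrow> nat)"
    "(\<lambda>n. N (\<lambda>z. U (F (r (s n))) z - h z)) \<longlonglongrightarrow> 0"
    using compact_extract[OF U, of "F \<circ> r"] F by (auto simp: o_def)
  have g': "(\<lambda>n. N (\<lambda>z. T (F (r (s n))) z - g z)) \<longlonglongrightarrow> 0"
    using LIMSEQ_subseq_LIMSEQ[OF g(3) h(2)] by (simp add: o_def)
  have TX: "T (F n) \<in> X" and UX: "U (F n) \<in> X" for n
    using F opD[OF compactD[OF T]] opD[OF compactD[OF U]] by auto
  have sc: "N (\<lambda>z. c * f z - c * h z) = norm c * N (\<lambda>z. f z - h z)" if "f \<in> X" "h \<in> X" for c f h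
    using scale[OF diff_mem[OF that], of c] by (simp add: right_diff_distrib)
  have le: "N (\<lambda>z. a * T (F n) z + b * U (F n) z - (a * g z + b * h z)) \<le>
      norm a * N (\<lambda>z. T (F n) z - g z) + norm b * N (\<lambda>z. U (F n) z - h z)" for n
    using triangle[OF diff_mem diff_mem, OF scale_mem[OF TX] scale_mem[OF g(1)]
        scale_mem[OF UX] scale_mem[OF h(1)], of a n a b n b]
    unfolding sc[OF TX g(1)] sc[OF UX h(1)] by (simp add: add_diff_add)
  have "(\<lambda>n. norm a * N (\<lambda>z. T (F (r (s n))) z - g z) + norm b * N (\<lambda>z. U (F (r (s n))) z - h z))
      \<longlonglongrightarrow> norm a * 0 + norm b * 0"
    by (intro tendsto_intros g' h)
  then have lim: "(\<lambda>n. N (\<lambda>z. a * T (F (r (s n))) z + b * U (F (r (s n))) z - (a * g z + b * h z))) \<longlonglongrightarrow> 0"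
    using null_sequence_squeeze[OF nonneg le] by (simp add: diff_mem lin_mem TX UX g h)
  show "\<exists>g\<in>X. \<exists>r :: nat \<Rightarrow> nat. strict_mono r \<and> (\<lambda>n. N (\<lambda>z. a * T (F (r n)) z + b * U (F (r n)) z - g z)) \<longlonglongrightarrow> 0"
    by (rule bexI[of _ "\<lambda>z. a * g z + b * h z"], rule exI[of _ "r \<circ> s"])
       (use lim in \<open>simp_all add: strict_mono_o g h lin_mem\<close>)
qed

lemma compact_sum:
  assumes "finite I" "\<And>i. i \<in> I \<Longrightarrow> T i \<in> K"
  shows "(\<lambda>f z. c * (\<Sum>i\<in>I. T i f z)) \<in> K"
  using assms
proof (induction I rule: finite_induct)
  case (insert i I)
  then show ?case
    using compact_combination[of "T i" "\<lambda>f z. c * (\<Sum>i\<in>I. T i f z)" c 1]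
    by (simp add: distrib_left)
qed (simp add: compact_zero)

lemma compact_comp:
  assumes T: "T \<in> B" and U: "U \<in> K"
  shows "(\<lambda>f. T (U f)) \<in> K"
  unfolding compact_ops_def
proof safe
  show "(\<lambda>f. T (U f)) \<in> B" by (rule op_comp[OF T compactD[OF U]])
  fix F :: "nat \<Rightarrow> 'a \<Rightarrow> complex" assume F: "\<forall>n. F n \<in> X \<and> N (F n) \<le> 1"
  obtain g r where g: "g \<in> X" "strict_mono (r :: nat \<Rightarrow> nat)"
    "(\<lambda>n. N (\<lambda>z. U (F (r n)) z - g z)) \<longlonglongrightarrow> 0"
    using compact_extract[OF U, of F] F by blast
  have UX: "U (F n) \<in> X" for n
    using F opD[OF compactD[OF U]] by auto
  have le: "N (\<lambda>z. T (U (F n)) z - T g z) \<le> op_norm X N T * N (\<lambda>z. U (F n) z - g z)" for n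
    using op_norm_upper[OF T diff_mem, OF UX g(1)] by (simp add: op_diff[OF T UX g(1)])
  have "(\<lambda>n. op_norm X N T * N (\<lambda>z. U (F (r n)) z - g z)) \<longlonglongrightarrow> op_norm X N T * 0"
    by (intro tendsto_intros g)
  then have lim: "(\<lambda>n. N (\<lambda>z. T (U (F (r n))) z - T g z)) \<longlonglongrightarrow> 0"
    using null_sequence_squeeze[OF nonneg le] by (simp add: diff_mem opD[OF T] UX g)
  then show "\<exists>h\<in>X. \<exists>r. strict_mono r \<and> (\<lambda>n. N (\<lambda>z. T (U (F (r n))) z - h z)) \<longlonglongrightarrow> 0"
    by (intro bexI[OF _ opD[OF T g(1)]] exI[of _ r] conjI g(2) lim)
qed

section \<open>The essential norm\<close>

lemma ess_norm_bdd_below: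
  assumes "T \<in> B"
  shows "bdd_below ((\<lambda>U. op_norm X N (\<lambda>f z. T f z - U f z)) ` K)"
proof (rule bdd_belowI2)
  fix U assume "U \<in> K"
  show "0 \<le> op_norm X N (\<lambda>f z. T f z - U f z)"
    by (rule op_norm_nonneg[OF op_minus[OF assms compactD[OF \<open>U \<in> K\<close>]]])
qed

lemma ess_norm_le:
  assumes "T \<in> B" "U \<in> K"
  shows "ess_norm X N T \<le> op_norm X N (\<lambda>f z. T f z - U f z)"
  unfolding ess_norm_def by (rule cINF_lower[OF ess_norm_bdd_below[OF assms(1)] assms(2)])

lemma ess_norm_approx:
  assumes "T \<in> B" "e > 0"
  obtains U where "U \<in> K" "op_norm X N (\<lambda>f z. T f z - U f z) < ess_norm X N T + e"
proof -
  have "(INF U\<in>K. op_norm X N (\<lambda>f z. T f z - U f z)) < ess_norm X N T + e"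
    using assms(2) by (simp add: ess_norm_def)
  moreover have "K \<noteq> {}" using compact_zero by blast
  ultimately show ?thesis
    using that cINF_less_iff[OF _ ess_norm_bdd_below[OF assms(1)]] by auto
qed

lemma ess_norm_nonneg:
  assumes "T \<in> B" shows "0 \<le> ess_norm X N T"
proof -
  have "K \<noteq> {}" using compact_zero by blast
  then show ?thesis unfolding ess_norm_def
    by (rule cINF_greatest) (rule op_norm_nonneg[OF op_minus[OF assms compactD]])
qed

lemma ess_norm_le_op_norm:
  assumes "T \<in> B" shows "ess_norm X N T \<le> op_norm X N T"
  using ess_norm_le[OF assms compact_zero] by simp

section \<open>Weakly null sequences\<close>

text \<open>Boundedness is built in, so that the uniform boundedness principle is not
  invoked.\<close>

definition weakly_null :: "(nat \<Rightarrow> 'a \<Rightarrow> complex) \<Rightarrow> bool" where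
  "weakly_null F \<longleftrightarrow> (\<forall>n. F n \<in> X) \<and> (\<exists>C. \<forall>n. N (F n) \<le> C) \<and>
     (\<forall>l\<in>bounded_functionals X N. (\<lambda>n. l (F n)) \<longlonglongrightarrow> 0)"

text \<open>These functionals are the ones on which weak nullity is tested when the limit of a
  sequence of images under \<open>T\<close> has to be identified.\<close>

lemma eval_comp_functional:
  assumes "T \<in> B"
  shows "(\<lambda>f. T f z) \<in> bounded_functionals X N"
proof -
  obtain D where D0: "\<forall>f\<in>X. norm (f z) \<le> D * N f" using eval_bounded[of z] ..
  have D: "norm (f z) \<le> \<bar>D\<bar> * N f" if "f \<in> X" for f
  proof -
    have "norm (f z) \<le> D * N f" using D0 that by simp
    also have "\<dots> \<le> \<bar>D\<bar> * N f" by (rule mult_right_mono[OF abs_ge_self nonneg[OF that]])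
    finally show ?thesis .
  qed
  obtain C where C: "C \<ge> 0" "\<And>f. f \<in> X \<Longrightarrow> N (T f) \<le> C * N f" using op_bound[OF assms] by blast
  have "norm (T f z) \<le> \<bar>D\<bar> * C * N f" if "f \<in> X" for f
    using D[OF opD[OF assms that]] mult_left_mono[OF C(2)[OF that], of "\<bar>D\<bar>"] by (simp add: mult.assoc)
  then have "\<exists>C. \<forall>f\<in>X. norm (T f z) \<le> C * N f" by blast
  moreover have "\<forall>f\<in>X. \<forall>g\<in>X. \<forall>a b. T (\<lambda>z. a * f z + b * g z) z = a * T f z + b * T g z"
  proof (intro ballI allI)
    fix f g a b assume "f \<in> X" "g \<in> X"
    show "T (\<lambda>z. a * f z + b * g z) z = a * T f z + b * T g z"
      unfolding op_lin[OF assms \<open>f \<in> X\<close> \<open>g \<in> X\<close>] ..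
  qed
  ultimately show ?thesis unfolding bounded_functionals_def by simp
qed

lemma norm_tendsto_eval:
  assumes "\<And>n. F n \<in> X" "g \<in> X" "(\<lambda>n. N (\<lambda>z. F n z - g z)) \<longlonglongrightarrow> 0"
  shows "(\<lambda>n. F n z) \<longlonglongrightarrow> g z"
proof -
  obtain D where D: "\<forall>f\<in>X. norm (f z) \<le> D * N f" using eval_bounded[of z] ..
  have "norm (F n z - g z) \<le> D * N (\<lambda>z. F n z - g z)" for n
    by (rule bspec[OF D diff_mem[OF assms(1,2)]])
  moreover have "(\<lambda>n. D * N (\<lambda>z. F n z - g z)) \<longlonglongrightarrow> 0"
    by (rule tendsto_mult_right_zero[OF assms(3)])
  ultimately have "(\<lambda>n. F n z - g z) \<longlonglongrightarrow> 0"
    by (rule Lim_null_comparison[OF always_eventually[OF allI]])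
  then show ?thesis by (simp add: LIM_zero_iff)
qed

lemma weakly_nullD:
  assumes "weakly_null F"
  shows "F n \<in> X" "\<exists>C>0. \<forall>n. N (F n) \<le> C"
    and "l \<in> bounded_functionals X N \<Longrightarrow> (\<lambda>n. l (F n)) \<longlonglongrightarrow> 0"
proof -
  obtain C where "\<forall>n. N (F n) \<le> C" using assms unfolding weakly_null_def by blast
  then have "\<forall>n. N (F n) \<le> max C 1" by (simp add: le_max_iff_disj)
  then show "\<exists>C>0. \<forall>n. N (F n) \<le> C" by (intro exI[of _ "max C 1"]) simp
  show "F n \<in> X" "l \<in> bounded_functionals X N \<Longrightarrow> (\<lambda>n. l (F n)) \<longlonglongrightarrow> 0"
    using assms unfolding weakly_null_def by blast+
qed

lemma not_null_subseq:
  fixes a :: "nat \<Rightarrow> real"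
  assumes "\<not> a \<longlonglongrightarrow> 0" "\<And>n. 0 \<le> a n"
  obtains e and q :: "nat \<Rightarrow> nat" where "e > 0" "strict_mono q" "\<And>n. e \<le> a (q n)"
proof -
  obtain e where e: "e > 0" "\<forall>m. \<exists>n\<ge>m. e \<le> a n"
    using assms(1) unfolding LIMSEQ_def by (auto simp: assms(2) not_less)
  then have "infinite {n. e \<le> a n}"
    by (auto simp: infinite_nat_iff_unbounded_le)
  then obtain q :: "nat \<Rightarrow> nat" where "strict_mono q" "\<forall>n. q n \<in> {n. e \<le> a n}"
    using infinite_enumerate by blast
  then show ?thesis using that e(1) by simp
qed

text \<open>Otherwise some subsequence of images stays away from 0 in norm. Compactness gives it a
  further norm limit, whose value at every point is 0 by weak nullity, a contradiction.\<close>

lemma compact_weakly_null: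
  assumes T: "T \<in> K" and F: "weakly_null F"
  shows "(\<lambda>n. N (T (F n))) \<longlonglongrightarrow> 0"
proof (rule ccontr)
  assume *: "\<not> ?thesis"
  note FX = weakly_nullD(1)[OF F]
  have TX: "T f \<in> X" if "f \<in> X" for f by (rule opD[OF compactD[OF T] that])
  obtain C where C: "C > 0" "\<And>n. N (F n) \<le> C" using weakly_nullD(2)[OF F] by blast
  obtain e and q :: "nat \<Rightarrow> nat"
    where q: "e > 0" "strict_mono q" "\<And>n. e \<le> N (T (F (q n)))"
    using not_null_subseq[OF * nonneg[OF TX[OF FX]]] by blast
  \<comment> \<open>\<open>compact_ops\<close> speaks of the unit ball only, hence the scaling by 1
    / C.\<close>
  define c where "c = complex_of_real (1 / C)"
  have nc: "norm c = 1 / C" using C by (simp add: c_def norm_divide)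
  define H where "H n = (\<lambda>z. c * F (q n) z)" for n
  have H: "H n \<in> X" "N (H n) \<le> 1" "T (H n) = (\<lambda>z. c * T (F (q n)) z)" for n
    using C scale_mem[OF FX] by (simp_all add: H_def scale[OF FX] nc op_scale[OF compactD[OF T] FX])
  obtain g r where g: "g \<in> X" "strict_mono (r :: nat \<Rightarrow> nat)"
    "(\<lambda>n. N (\<lambda>z. T (H (r n)) z - g z)) \<longlonglongrightarrow> 0"
    by (rule compact_extract[OF T, of H]) (use H in auto)
  have "g z = 0" for z
  proof -
    have "(\<lambda>n. T (F n) z) \<longlonglongrightarrow> 0"
      by (rule weakly_nullD(3)[OF F eval_comp_functional[OF compactD[OF T]]])
    from LIMSEQ_subseq_LIMSEQ[OF this strict_mono_o[OF q(2) g(2)]]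
    have "(\<lambda>n. c * T (F (q (r n))) z) \<longlonglongrightarrow> 0"
      by (intro tendsto_mult_right_zero) (simp add: o_def)
    then have "(\<lambda>n. T (H (r n)) z) \<longlonglongrightarrow> 0" by (simp add: H(3))
    moreover have "(\<lambda>n. T (H (r n)) z) \<longlonglongrightarrow> g z"
      by (rule norm_tendsto_eval[OF TX[OF H(1)] g(1) g(3)])
    ultimately show "g z = 0"
      using LIMSEQ_unique by blast
  qed
  then have "(\<lambda>n. N (T (F (q (r n)))) / C) \<longlonglongrightarrow> 0"
    using g(3) by (simp add: H(3) scale[OF TX[OF FX]] nc)
  moreover have "e / C \<le> N (T (F (q (r n)))) / C" for n
    using q(3) C(1) by (simp add: divide_right_mono)
  ultimately have "e / C \<le> 0"
    by (intro LIMSEQ_le_const[where X = "\<lambda>n. N (T (F (q (r n)))) / C"]) auto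
  then show False using q(1) C(1) by (simp add: divide_le_0_iff)
qed

lemma weakly_null_sphereD:
  assumes "F \<in> weakly_null_sphere X N"
  shows "weakly_null F" "F n \<in> X" "N (F n) = 1"
  using assms unfolding weakly_null_sphere_def weakly_null_def by auto

text \<open>A nearly optimal compact \<open>U\<close> satisfies \<open>U (F n)\<close>
  \<longlonglongrightarrow> 0, so asymptotically only the norm of \<open>T - U\<close> is felt on
  the sequence.\<close>

lemma ess_norm_limsup:
  assumes T: "T \<in> B" and F: "F \<in> weakly_null_sphere X N" and "e > 0"
  shows "\<forall>\<^sub>F n in sequentially. N (T (F n)) < ess_norm X N T + e"
proof -
  obtain U where U: "U \<in> K" "op_norm X N (\<lambda>f z. T f z - U f z) < ess_norm X N T + e / 2"
    using ess_norm_approx[OF T, of "e / 2"] \<open>e > 0\<close> by auto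
  have "\<forall>\<^sub>F n in sequentially. N (U (F n)) < e / 2"
    by (rule order_tendstoD(2)[OF compact_weakly_null[OF U(1) weakly_null_sphereD(1)[OF F]]])
       (use \<open>e > 0\<close> in simp)
  then show ?thesis
  proof eventually_elim
    case (elim n)
    note FX = weakly_null_sphereD(2,3)[OF F, of n]
    have "N (\<lambda>z. T (F n) z - U (F n) z) \<le> op_norm X N (\<lambda>f z. T f z - U f z)"
      by (rule op_norm_upper1[OF op_minus[OF T compactD[OF U(1)]]]) (use FX in auto)
    moreover have "N (T (F n)) \<le> N (\<lambda>z. T (F n) z - U (F n) z) + N (U (F n))"
      using triangle[OF diff_mem, of "T (F n)" "U (F n)" "U (F n)"] opD[OF T FX(1)]
        opD[OF compactD[OF U(1)] FX(1)] by simp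
    ultimately show ?case using elim U(2) by linarith
  qed
qed

end

section \<open>The essential norm through an almost isometric approximation of the identity\<close>

text \<open>
  \<open>J\<close> is a sequence of compact operators with \<open>\<parallel>I - J n\<parallel> \<le> 1 + \<delta> n\<close> and \<open>I - J n \<rightarrow> 0\<close> in a weak sense
  that is uniform on the unit ball.
\<close>

locale approximable_space = evaluation_space +
  fixes J :: "nat \<Rightarrow> ('a \<Rightarrow> complex) \<Rightarrow> 'a \<Rightarrow> complex" and \<delta> :: "nat \<Rightarrow> real"
  assumes J_compact: "J n \<in> compact_ops X N"
    and J_bound: "f \<in> X \<Longrightarrow> N (\<lambda>z. f z - J n f z) \<le> (1 + \<delta> n) * N f"
    and \<delta>_null: "\<delta> \<longlonglongrightarrow> 0" and \<delta>_nonneg: "0 \<le> \<delta> n"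
    and J_weakly_null: "(\<And>n. F n \<in> X) \<Longrightarrow> (\<And>n. N (F n) \<le> 1) \<Longrightarrow>
      weakly_null (\<lambda>n z. F n z - J n (F n) z)"
    and sphere_nonempty: "weakly_null_sphere X N \<noteq> {}"
begin

definition R :: "nat \<Rightarrow> ('a \<Rightarrow> complex) \<Rightarrow> 'a \<Rightarrow> complex" where
  "R n = (\<lambda>f z. f z - J n f z)"

lemma R_op: "R n \<in> B"
  unfolding R_def by (rule op_minus[OF op_id compactD[OF J_compact]])

lemma R_bound: "f \<in> X \<Longrightarrow> N (R n f) \<le> (1 + \<delta> n) * N f"
  unfolding R_def by (rule J_bound)

lemma R_bound1:
  assumes "f \<in> X" "N f \<le> 1"
  shows "N (R n f) \<le> 1 + \<delta> n"
proof -
  have "(1 + \<delta> n) * N f \<le> (1 + \<delta> n) * 1"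
    by (rule mult_left_mono[OF assms(2)]) (simp add: \<delta>_nonneg)
  then have "(1 + \<delta> n) * N f \<le> 1 + \<delta> n" by simp
  with R_bound[OF assms(1)] show ?thesis by (rule order_trans)
qed

lemma R_weakly_null:
  "(\<And>n. F n \<in> X) \<Longrightarrow> (\<And>n. N (F n) \<le> 1) \<Longrightarrow> weakly_null (\<lambda>n. R n (F n))"
  unfolding R_def by (rule J_weakly_null)

text \<open>\<open>T\<close> differs from its composition with \<open>R n\<close> by that with
  \<open>J n\<close>, which is compact.\<close>

lemma ess_norm_le_R:
  assumes "T \<in> B"
  shows "ess_norm X N T \<le> op_norm X N (\<lambda>f. T (R n f))"
proof -
  have "ess_norm X N T \<le> op_norm X N (\<lambda>f z. T f z - T (J n f) z)"
    by (rule ess_norm_le[OF assms compact_comp[OF assms J_compact]])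
  also have "\<dots> = op_norm X N (\<lambda>f. T (R n f))"
    unfolding op_norm_def R_def
    by (rule SUP_cong) (use op_diff[OF assms _ opD[OF compactD[OF J_compact]]] in auto)
  finally show ?thesis .
qed

text \<open>The supremum in an operator norm need not be attained; the slack disappears in the
  limit.\<close>

lemma op_norm_R_attained:
  assumes "\<And>n. T n \<in> B"
  obtains x where "\<And>n. x n \<in> X" "\<And>n. N (x n) \<le> 1"
    "\<And>n. op_norm X N (\<lambda>f. T n (R n f)) - 1 / real (Suc n) < N (T n (R n (x n)))"
proof -
  have "\<exists>f\<in>X. N f \<le> 1 \<and> op_norm X N (\<lambda>f. T n (R n f)) - 1 / real (Suc n) < N (T n (R n f))" for n
    by (rule op_norm_less_iff[OF op_comp[OF assms R_op], THEN iffD1]) simp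
  then show ?thesis using that by metis
qed

text \<open>Almost maximising vectors \<open>x n\<close> form an arbitrary sequence in the unit
  ball, yet \<open>R n (x n)\<close> is weakly null. This is the use of uniformity on the unit ball
  in the locale assumption.\<close>

lemma op_norm_R_compact_null:
  assumes U: "U \<in> K"
  shows "(\<lambda>n. op_norm X N (\<lambda>f. U (R n f))) \<longlonglongrightarrow> 0"
proof -
  note UB = compactD[OF U]
  obtain x where x: "\<And>n. x n \<in> X" "\<And>n. N (x n) \<le> 1"
    "\<And>n. op_norm X N (\<lambda>f. U (R n f)) - 1 / real (Suc n) < N (U (R n (x n)))"
    using op_norm_R_attained[of "\<lambda>_. U", OF UB] by blast
  have "(\<lambda>n. N (U (R n (x n))) + 1 / real (Suc n)) \<longlonglongrightarrow> 0 + 0"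
    by (rule tendsto_add[OF compact_weakly_null[OF U R_weakly_null[OF x(1,2)]] LIMSEQ_Suc[OF lim_1_over_n]])
  then have lim: "(\<lambda>n. N (U (R n (x n))) + 1 / real (Suc n)) \<longlonglongrightarrow> 0" by simp
  have "op_norm X N (\<lambda>f. U (R n f)) \<le> N (U (R n (x n))) + 1 / real (Suc n)" for n
    using x(3)[of n] by linarith
  then show ?thesis
    by (rule null_sequence_squeeze[OF op_norm_nonneg[OF op_comp[OF UB R_op]] _ lim])
qed

text \<open>The upper estimate splits \<open>T\<close> as \<open>(T - U) + U\<close> with
  \<open>U\<close> compact and nearly optimal. The first part costs the factor
  \<open>1 + \<delta> n\<close>, which tends to 1, and the second vanishes in the limit.\<close>

lemma op_norm_R_tendsto:
  assumes T: "T \<in> B"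
  shows "(\<lambda>n. op_norm X N (\<lambda>f. T (R n f))) \<longlonglongrightarrow> ess_norm X N T"
proof (rule order_tendstoI)
  fix a assume "a < ess_norm X N T"
  then show "\<forall>\<^sub>F n in sequentially. a < op_norm X N (\<lambda>f. T (R n f))"
    by (intro always_eventually allI) (rule less_le_trans[OF _ ess_norm_le_R[OF T]])
next
  fix a assume "ess_norm X N T < a"
  then obtain U where U: "U \<in> K" "op_norm X N (\<lambda>f z. T f z - U f z) < a"
    using ess_norm_approx[OF T, of "a - ess_norm X N T"] by auto
  note UB = compactD[OF U(1)]
  define c where "c = op_norm X N (\<lambda>f z. T f z - U f z)"
  have c: "c \<ge> 0" unfolding c_def by (rule op_norm_nonneg[OF op_minus[OF T UB]])
  have le: "op_norm X N (\<lambda>f. T (R n f)) \<le> c * (1 + \<delta> n) + op_norm X N (\<lambda>f. U (R n f))" for n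
  proof (rule op_norm_least)
    fix f assume f: "f \<in> X" "N f \<le> 1"
    have RX: "R n f \<in> X" by (rule opD[OF R_op f(1)])
    have "N (T (R n f)) \<le> N (\<lambda>z. T (R n f) z - U (R n f) z) + N (U (R n f))"
      using triangle[OF diff_mem, OF opD[OF T RX] opD[OF UB RX] opD[OF UB RX]] by simp
    also have "N (\<lambda>z. T (R n f) z - U (R n f) z) \<le> c * N (R n f)"
      unfolding c_def by (rule op_norm_upper[OF op_minus[OF T UB] RX])
    also have "N (R n f) \<le> 1 + \<delta> n"
      by (rule R_bound1[OF f])
    also have "N (U (R n f)) \<le> op_norm X N (\<lambda>f. U (R n f))"
      by (rule op_norm_upper1[OF op_comp[OF UB R_op] f])
    finally show "N (T (R n f)) \<le> c * (1 + \<delta> n) + op_norm X N (\<lambda>f. U (R n f))"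
      using c by (simp add: mult_left_mono)
  qed
  have "(\<lambda>n. c * (1 + \<delta> n) + op_norm X N (\<lambda>f. U (R n f))) \<longlonglongrightarrow> c * (1 + 0) + 0"
    by (intro tendsto_add tendsto_mult tendsto_const \<delta>_null op_norm_R_compact_null[OF U(1)])
  then have "\<forall>\<^sub>F n in sequentially. c * (1 + \<delta> n) + op_norm X N (\<lambda>f. U (R n f)) < a"
    using U(2) by (intro order_tendstoD) (auto simp: c_def)
  then show "\<forall>\<^sub>F n in sequentially. op_norm X N (\<lambda>f. T (R n f)) < a"
    by eventually_elim (rule le_less_trans[OF le])
qed

text \<open>The upper half of the convergence holds for every weakly null sequence on the sphere, so
  a lower estimate suffices.\<close>

lemma weakly_null_sphere_tendstoI:
  assumes T: "T \<in> B" and F: "F \<in> weakly_null_sphere X N"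
    and "\<And>n. w n \<le> N (T (F n))" and "w \<longlonglongrightarrow> ess_norm X N T"
  shows "(\<lambda>n. N (T (F n))) \<longlonglongrightarrow> ess_norm X N T"
proof (rule order_tendstoI)
  fix a assume "a < ess_norm X N T"
  with assms(4) have "\<forall>\<^sub>F n in sequentially. a < w n" by (rule order_tendstoD)
  then show "\<forall>\<^sub>F n in sequentially. a < N (T (F n))"
    by eventually_elim (rule less_le_trans[OF _ assms(3)])
next
  fix a assume "ess_norm X N T < a"
  then show "\<forall>\<^sub>F n in sequentially. N (T (F n)) < a"
    using ess_norm_limsup[OF T F, of "a - ess_norm X N T"] by simp
qed

text \<open>Norms bounded away from 0 are essential: dividing by norms that tend to 0 could destroy
  weak nullity.\<close>

lemma normalize_weakly_null:
  assumes F: "weakly_null F" and c: "c > 0" "\<And>n. c \<le> N (F n)"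
  shows "(\<lambda>n z. complex_of_real (1 / N (F n)) * F n z) \<in> weakly_null_sphere X N"
  unfolding weakly_null_sphere_def mem_Collect_eq
proof (intro conjI allI ballI)
  fix n
  note FX = weakly_nullD(1)[OF F]
  have pos: "N (F n) > 0" for n using c less_le_trans by blast
  show "(\<lambda>z. complex_of_real (1 / N (F n)) * F n z) \<in> X" by (rule scale_mem[OF FX])
  show "N (\<lambda>z. complex_of_real (1 / N (F n)) * F n z) = 1"
    unfolding scale[OF FX] using pos[of n] by (simp add: norm_divide)
  fix l assume l: "l \<in> bounded_functionals X N"
  have eq: "l (\<lambda>z. a * F n z) = a * l (F n)" for a n
  proof -
    have "l (\<lambda>z. a * F n z + 0 * F n z) = a * l (F n) + 0 * l (F n)"
      using l FX unfolding bounded_functionals_def by blast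
    then show ?thesis by simp
  qed
  have "(\<lambda>n. norm (l (F n)) / c) \<longlonglongrightarrow> 0 / c"
    by (rule tendsto_divide[OF tendsto_norm_zero[OF weakly_nullD(3)[OF F l]] tendsto_const]) (use c in simp)
  then have lim: "(\<lambda>n. norm (l (F n)) / c) \<longlonglongrightarrow> 0" by simp
  have "norm (l (\<lambda>z. complex_of_real (1 / N (F n)) * F n z)) \<le> norm (l (F n)) / c" for n
    unfolding eq using c(2)[of n] c(1) pos[of n]
    by (simp add: norm_mult norm_divide frac_le)
  then show "(\<lambda>n. l (\<lambda>z. complex_of_real (1 / N (F n)) * F n z)) \<longlonglongrightarrow> 0"
    by (rule Lim_null_comparison[OF always_eventually[OF allI] lim])
qed

lemma weakly_null_subseq:
  assumes "weakly_null F" "strict_mono (r :: nat \<Rightarrow> nat)"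
  shows "weakly_null (\<lambda>n. F (r n))"
proof -
  have "(\<lambda>n. l (F (r n))) \<longlonglongrightarrow> 0" if "l \<in> bounded_functionals X N" for l
    using LIMSEQ_subseq_LIMSEQ[OF weakly_nullD(3)[OF assms(1) that] assms(2)] by (simp add: o_def)
  then show ?thesis
    using weakly_nullD(1,2)[OF assms(1)] unfolding weakly_null_def by blast
qed

lemma weakly_null_sphere_subseq:
  assumes "F \<in> weakly_null_sphere X N" "strict_mono (r :: nat \<Rightarrow> nat)"
  shows "(\<lambda>n. F (r n)) \<in> weakly_null_sphere X N"
  using weakly_null_subseq[OF weakly_null_sphereD(1)[OF assms(1)] assms(2)]
    weakly_null_sphereD(2,3)[OF assms(1)]
  unfolding weakly_null_sphere_def weakly_null_def by blast

text \<open>Almost maximising vectors \<open>x n\<close> for \<open>T\<close> composed with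
  \<open>R n\<close> give the weakly null sequence \<open>R n (x n)\<close>. Its norms are at most
  \<open>1 + \<delta> n\<close>, so normalising costs nothing in the limit.\<close>

lemma ess_norm_attained:
  assumes T: "T \<in> B"
  obtains F where "F \<in> weakly_null_sphere X N" "(\<lambda>n. N (T (F n))) \<longlonglongrightarrow> ess_norm X N T"
proof (cases "ess_norm X N T = 0")
  case True
  \<comment> \<open>If the essential norm is 0, every weakly null sequence on the sphere will
    do.\<close>
  obtain F where F: "F \<in> weakly_null_sphere X N" using sphere_nonempty by blast
  have "(\<lambda>n. N (T (F n))) \<longlonglongrightarrow> ess_norm X N T"
    by (rule weakly_null_sphere_tendstoI[OF T F, of "\<lambda>_. 0"])
       (use True nonneg[OF opD[OF T weakly_null_sphereD(2)[OF F]]] in auto)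
  then show ?thesis using that F by blast
next
  case False
  define \<epsilon> where "\<epsilon> = ess_norm X N T"
  have \<epsilon>: "\<epsilon> > 0" using False ess_norm_nonneg[OF T] by (simp add: \<epsilon>_def)
  define C where "C = op_norm X N T"
  have C: "C > 0" using \<epsilon> ess_norm_le_op_norm[OF T] by (simp add: \<epsilon>_def C_def)
  obtain x where x: "\<And>n. x n \<in> X" "\<And>n. N (x n) \<le> 1"
    "\<And>n. op_norm X N (\<lambda>f. T (R n f)) - 1 / real (Suc n) < N (T (R n (x n)))"
    using op_norm_R_attained[of "\<lambda>_. T", OF T] by blast
  define f where "f n = R n (x n)" for n
  have f: "weakly_null f" unfolding f_def by (rule R_weakly_null[OF x(1,2)])
  note fX = weakly_nullD(1)[OF f]
  have f_le: "N (f n) \<le> 1 + \<delta> n" for n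
    unfolding f_def by (rule R_bound1[OF x(1,2)])
  define v where "v n = op_norm X N (\<lambda>f. T (R n f)) - 1 / real (Suc n)" for n
  have v: "v \<longlonglongrightarrow> \<epsilon> - 0"
    unfolding v_def \<epsilon>_def by (rule tendsto_diff[OF op_norm_R_tendsto[OF T] LIMSEQ_Suc[OF lim_1_over_n]])
  have v_le: "v n \<le> N (T (f n))" for n using x(3)[of n] by (simp add: v_def f_def)
  have "\<forall>\<^sub>F n in sequentially. \<epsilon> / 2 < v n"
    by (rule order_tendstoD(1)[OF v]) (use \<epsilon> in simp)
  then obtain n0 where n0: "\<And>n. n \<ge> n0 \<Longrightarrow> \<epsilon> / 2 < v n"
    unfolding eventually_sequentially by blast
  have mono: "strict_mono (\<lambda>n. n + n0)" by (simp add: strict_mono_def)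
  \<comment> \<open>Dropping the first \<open>n0\<close> terms leaves images of norm at least
    \<epsilon> / 2, hence vectors of norm at least \<epsilon> / (2 C), as normalisation
    requires.\<close>
  define h where "h n = f (n + n0)" for n
  have h: "weakly_null h" unfolding h_def by (rule weakly_null_subseq[OF f mono])
  have h_ge: "\<epsilon> / 2 / C \<le> N (h n)" for n
  proof -
    have "\<epsilon> / 2 \<le> N (T (h n))" using n0[of "n + n0"] v_le[of "n + n0"] by (simp add: h_def)
    also have "\<dots> \<le> C * N (h n)"
      unfolding C_def by (rule op_norm_upper[OF T weakly_nullD(1)[OF h]])
    finally show ?thesis using C by (simp add: divide_le_eq ac_simps)
  qed
  define F where "F n = (\<lambda>z. complex_of_real (1 / N (h n)) * h n z)" for n
  have F: "F \<in> weakly_null_sphere X N"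
    unfolding F_def by (rule normalize_weakly_null[OF h _ h_ge]) (use \<epsilon> C in simp)
  have pos: "N (h n) > 0" for n
    by (rule less_le_trans[OF _ h_ge]) (use \<epsilon> C in simp)
  \<comment> \<open>Replacing \<open>N (h n)\<close> by its upper bound
    \<open>1 + \<delta> (n + n0)\<close> gives a lower estimate that converges to
    \<epsilon>.\<close>
  have "v (n + n0) / (1 + \<delta> (n + n0)) \<le> N (T (F n))" for n
  proof -
    have "v (n + n0) / (1 + \<delta> (n + n0)) \<le> v (n + n0) / N (h n)"
      using n0[of "n + n0"] \<epsilon> f_le[of "n + n0"] pos[of n] by (intro divide_left_mono) (auto simp: h_def)
    also have "\<dots> \<le> N (T (h n)) / N (h n)"
      using v_le[of "n + n0"] pos[of n] by (intro divide_right_mono) (auto simp: h_def)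
    also have "\<dots> = N (T (F n))"
      unfolding F_def op_scale[OF T weakly_nullD(1)[OF h]] scale[OF opD[OF T weakly_nullD(1)[OF h]]]
      using pos[of n] by (simp add: norm_divide)
    finally show ?thesis .
  qed
  moreover have "(\<lambda>n. v (n + n0) / (1 + \<delta> (n + n0))) \<longlonglongrightarrow> (\<epsilon> - 0) / (1 + 0)"
    using LIMSEQ_subseq_LIMSEQ[OF v mono] LIMSEQ_subseq_LIMSEQ[OF \<delta>_null mono]
    by (intro tendsto_intros) (auto simp: o_def)
  ultimately have "(\<lambda>n. N (T (F n))) \<longlonglongrightarrow> ess_norm X N T"
    by (intro weakly_null_sphere_tendstoI[OF T F]) (auto simp: \<epsilon>_def)
  then show ?thesis using that F by blast
qed

end

section \<open>Integrals of functions with values in a function space\<close>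

text \<open>As \<open>s\<close> takes finitely many values, \<open>\<psi>\<close> may be arbitrary;
  it will be a point evaluation or the norm \<open>N\<close>.\<close>

lemma simple_function_integral:
  fixes \<psi> :: "'b \<Rightarrow> 'c :: {banach, second_countable_topology}"
  assumes "finite_measure M" "simple_function M s"
  shows "has_bochner_integral M (\<lambda>t. \<psi> (s t))
    (\<Sum>y\<in>s ` space M. measure M {t \<in> space M. s t = y} *\<^sub>R \<psi> y)"
proof -
  interpret finite_measure M by fact
  have fin: "finite (s ` space M)" using assms(2) by (simp add: simple_function_def)
  have meas: "{t \<in> space M. s t = y} \<in> sets M" if "y \<in> s ` space M" for y
  proof -
    have "s -` {y} \<inter> space M \<in> sets M" using assms(2) that unfolding simple_function_def by blast
    moreover have "s -` {y} \<inter> space M = {t \<in> space M. s t = y}" by auto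
    ultimately show ?thesis by simp
  qed
  have eq: "\<psi> (s t) = (\<Sum>y\<in>s ` space M. indicator {t \<in> space M. s t = y} t *\<^sub>R \<psi> y)"
    if t: "t \<in> space M" for t
  proof -
    have "(\<Sum>y\<in>s ` space M. indicator {t \<in> space M. s t = y} t *\<^sub>R \<psi> y) =
        (\<Sum>y\<in>s ` space M. if y = s t then \<psi> y else 0)"
      using t by (intro sum.cong) (auto simp: indicator_def)
    then show ?thesis using fin t by simp
  qed
  have "has_bochner_integral M (\<lambda>t. \<Sum>y\<in>s ` space M. indicator {t \<in> space M. s t = y} t *\<^sub>R \<psi> y)
    (\<Sum>y\<in>s ` space M. measure M {t \<in> space M. s t = y} *\<^sub>R \<psi> y)"
  proof (intro has_bochner_integral_sum)
    fix y assume "y \<in> s ` space M"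
    then show "has_bochner_integral M (\<lambda>t. indicator {t \<in> space M. s t = y} t *\<^sub>R \<psi> y)
        (measure M {t \<in> space M. s t = y} *\<^sub>R \<psi> y)"
      using meas[of y] by (intro has_bochner_integral_indicator) (auto simp: less_top[symmetric])
  qed
  then show ?thesis
    by (rule has_bochner_integral_cong[OF refl _ refl, THEN iffD1, rotated]) (simp add: eq)
qed

lemma simple_integral_eval:
  assumes "finite_measure M" "simple_function M s"
  shows "integrable M (\<lambda>t. s t z)" "(LINT t|M. s t z) = simple_integral M s z"
  using simple_function_integral[OF assms, of "\<lambda>y. y z"]
  by (auto simp: has_bochner_integral_iff simple_integral_def scaleR_conv_of_real)

lemma borel_measurable_lborel01:
  fixes f :: "real \<Rightarrow> 'b :: topological_space"
  assumes "continuous_on {0<..<1} f"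
  shows "f \<in> borel_measurable lborel01"
proof -
  have "f \<in> borel_measurable (restrict_space borel {0<..<1})"
    by (rule borel_measurable_continuous_on_restrict[OF assms])
  then show ?thesis
    by (simp cong: measurable_cong_sets add: sets_restrict_space measurable_def space_restrict_space)
qed

lemma space_lborel01 [simp]: "space lborel01 = {0<..<1}"
  by (simp add: space_restrict_space)

lemma emeasure_lborel01 [simp]: "emeasure lborel01 {0<..<1} = 1"
  by (subst emeasure_restrict_space) auto

lemma finite_measure_lborel01: "finite_measure lborel01"
  by (rule finite_measureI) simp

text \<open>Relatively open superlevel sets are open, since the interval is.\<close>

lemma borel_measurable_lborel01_lower_semicontinuous:
  fixes f :: "real \<Rightarrow> real"
  assumes "\<And>a. openin (top_of_set {0<..<1}) {t \<in> {0<..<1}. a < f t}"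
  shows "f \<in> borel_measurable lborel01"
  unfolding borel_measurable_iff_greater
proof
  fix a
  have "open {t \<in> {0<..<1}. a < f t}"
    using assms[of a] by (simp add: openin_open_eq)
  then have "{0<..<1} \<inter> {t \<in> {0<..<1}. a < f t} \<in> sets lborel01"
    by (intro sets_restrict_space_iff[THEN iffD2]) auto
  moreover have "{0<..<1} \<inter> {t \<in> {0<..<1}. a < f t} = {w \<in> space lborel01. a < f w}" by auto
  ultimately show "{w \<in> space lborel01. a < f w} \<in> sets lborel01" by simp
qed

context evaluation_space
begin

lemma simple_integral_norm:
  assumes M: "finite_measure M" and s: "simple_function M s" "\<And>t. t \<in> space M \<Longrightarrow> s t \<in> X"
  shows "simple_integral M s \<in> X" "integrable M (\<lambda>t. N (s t))"
    "N (simple_integral M s) \<le> (LINT t|M. N (s t))"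
proof -
  have fin: "finite (s ` space M)" using s(1) by (simp add: simple_function_def)
  have mem: "y \<in> X" if "y \<in> s ` space M" for y using s(2) that by auto
  have sm: "(\<lambda>z. \<Sum>y\<in>s ` space M. of_real (measure M {t \<in> space M. s t = y}) * y z) \<in> X \<and>
      N (\<lambda>z. \<Sum>y\<in>s ` space M. of_real (measure M {t \<in> space M. s t = y}) * y z) \<le>
      (\<Sum>y\<in>s ` space M. N (\<lambda>z. of_real (measure M {t \<in> space M. s t = y}) * y z))"
    by (rule sum_mem[OF fin scale_mem[OF mem]])
  show "simple_integral M s \<in> X" using sm unfolding simple_integral_def by blast
  note int = simple_function_integral[OF M s(1), of N]
  show "integrable M (\<lambda>t. N (s t))" using int by (simp add: has_bochner_integral_iff)
  have "N (simple_integral M s) \<le>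
      (\<Sum>y\<in>s ` space M. N (\<lambda>z. of_real (measure M {t \<in> space M. s t = y}) * y z))"
    using sm unfolding simple_integral_def by blast
  also have "\<dots> = (\<Sum>y\<in>s ` space M. measure M {t \<in> space M. s t = y} *\<^sub>R N y)"
    by (rule sum.cong[OF refl]) (simp add: scale[OF mem])
  also have "\<dots> = (LINT t|M. N (s t))"
    using int by (simp add: has_bochner_integral_iff)
  finally show "N (simple_integral M s) \<le> (LINT t|M. N (s t))" .
qed

lemma eval_bound:
  obtains C where "C \<ge> 0" "\<And>f. f \<in> X \<Longrightarrow> norm (f z) \<le> C * N f"
proof -
  obtain D where D: "\<forall>f\<in>X. norm (f z) \<le> D * N f" using eval_bounded[of z] ..
  have "norm (f z) \<le> \<bar>D\<bar> * N f" if "f \<in> X" for f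
    using bspec[OF D that] mult_right_mono[OF abs_ge_self[of D] nonneg[OF that]] by linarith
  then show ?thesis using that[of "\<bar>D\<bar>"] by simp
qed

text \<open>Point evaluations are bounded, so they commute with the limit of simple integrals. Thus
  the vector-valued integral is computed pointwise, and the norm inequality passes to the limit from
  simple functions.\<close>

lemma has_integral_in_imp:
  assumes M: "finite_measure M" and h: "has_integral_in X N M h g"
    and meas: "\<And>z. (\<lambda>t. h t z) \<in> borel_measurable M"
    and int: "integrable M (\<lambda>t. N (h t))"
  shows "g \<in> X" "g z = (LINT t|M. h t z)" "integrable M (\<lambda>t. h t z)" "N g \<le> (LINT t|M. N (h t))"
proof -
  from h obtain s where gX: "g \<in> X" and hX: "\<And>t. t \<in> space M \<Longrightarrow> h t \<in> X"
    and s: "\<And>i::nat. simple_function M (s i)" "\<And>i t. t \<in> space M \<Longrightarrow> s i t \<in> X"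
    and m: "\<And>i. (\<lambda>t. N (\<lambda>z. h t z - s i t z)) \<in> borel_measurable M"
    and lim: "(\<lambda>i. \<integral>\<^sup>+ t. ennreal (N (\<lambda>z. h t z - s i t z)) \<partial>M) \<longlonglongrightarrow> 0"
    and lim_g: "(\<lambda>i. N (\<lambda>z. simple_integral M (s i) z - g z)) \<longlonglongrightarrow> 0"
    unfolding has_integral_in_def by blast
  show "g \<in> X" by fact
  define \<phi> where "\<phi> i t = N (\<lambda>z. h t z - s i t z)" for i t
  have \<phi>_nonneg: "0 \<le> \<phi> i t" if "t \<in> space M" for i t
    unfolding \<phi>_def by (rule nonneg[OF diff_mem[OF hX s(2)]]) fact+
  have sn: "simple_integral M (s i) \<in> X" "integrable M (\<lambda>t. N (s i t))"
    "N (simple_integral M (s i)) \<le> (LINT t|M. N (s i t))" for i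
    using simple_integral_norm[OF M s(1)] s(2) by blast+
  \<comment> \<open>The definition controls the error by a \<open>nn_integral\<close>; integrability
    converts this into a statement about Bochner integrals.\<close>
  have \<phi>_int: "integrable M (\<phi> i)" for i
  proof (rule Bochner_Integration.integrable_bound[OF Bochner_Integration.integrable_add[OF int sn(2)[of i]]])
    show "\<phi> i \<in> borel_measurable M" unfolding \<phi>_def by (rule m)
    show "AE t in M. norm (\<phi> i t) \<le> norm (N (h t) + N (s i t))"
    proof (rule AE_I2)
      fix t assume t: "t \<in> space M"
      show "norm (\<phi> i t) \<le> norm (N (h t) + N (s i t))"
        using triangle_diff[OF hX[OF t] s(2)[OF t, of i]] \<phi>_nonneg[OF t, of i] by (simp add: \<phi>_def)
    qed
  qed
  have lim_\<phi>: "(\<lambda>i. LINT t|M. \<phi> i t) \<longlonglongrightarrow> 0"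
  proof -
    have "(\<integral>\<^sup>+ t. ennreal (N (\<lambda>z. h t z - s i t z)) \<partial>M) = ennreal (LINT t|M. \<phi> i t)" for i
      using nn_integral_eq_integral[OF \<phi>_int AE_I2[OF \<phi>_nonneg], of i] by (simp add: \<phi>_def)
    with lim have "(\<lambda>i. ennreal (LINT t|M. \<phi> i t)) \<longlonglongrightarrow> ennreal 0" by simp
    then show ?thesis
      by (rule tendsto_ennrealD) (auto intro!: always_eventually integral_nonneg_AE AE_I2 \<phi>_nonneg)
  qed
  obtain C where C: "C \<ge> 0" "\<And>f. f \<in> X \<Longrightarrow> norm (f z) \<le> C * N f" using eval_bound by blast
  show hz: "integrable M (\<lambda>t. h t z)"
  proof (rule Bochner_Integration.integrable_bound[OF integrable_mult_right[OF int] meas])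
    show "AE t in M. norm (h t z) \<le> norm (C * N (h t))"
      by (rule AE_I2) (use C(2)[OF hX] in \<open>force\<close>)
  qed
  have "norm (simple_integral M (s i) z - (LINT t|M. h t z)) \<le> C * (LINT t|M. \<phi> i t)" for i
  proof -
    note se = simple_integral_eval[OF M s(1)[of i], of z]
    have "simple_integral M (s i) z - (LINT t|M. h t z) = (LINT t|M. s i t z - h t z)"
      using se hz by simp
    also have "norm \<dots> \<le> (LINT t|M. norm (s i t z - h t z))"
      by (rule integral_norm_bound)
    also have "\<dots> \<le> (LINT t|M. C * \<phi> i t)"
    proof (rule integral_mono)
      fix t assume t: "t \<in> space M"
      show "norm (s i t z - h t z) \<le> C * \<phi> i t"
        using C(2)[OF diff_mem[OF hX[OF t] s(2)[OF t, of i]]] by (simp add: \<phi>_def norm_minus_commute)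
    qed (use se hz \<phi>_int in auto)
    finally show ?thesis by simp
  qed
  then have "(\<lambda>i. simple_integral M (s i) z - (LINT t|M. h t z)) \<longlonglongrightarrow> 0"
    by (intro Lim_null_comparison[OF always_eventually[OF allI] tendsto_mult_right_zero[OF lim_\<phi>, of C]])
  then have "(\<lambda>i. simple_integral M (s i) z) \<longlonglongrightarrow> (LINT t|M. h t z)" by (simp add: LIM_zero_iff)
  moreover have "(\<lambda>i. simple_integral M (s i) z) \<longlonglongrightarrow> g z"
    by (rule norm_tendsto_eval[OF sn(1) gX lim_g])
  ultimately show "g z = (LINT t|M. h t z)" by (rule LIMSEQ_unique[THEN sym])
  \<comment> \<open>Both error terms in parentheses tend to 0 as i grows.\<close>
  have "N g \<le> (LINT t|M. N (h t)) + (N (\<lambda>z. simple_integral M (s i) z - g z) + (LINT t|M. \<phi> i t))" for i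
  proof -
    have "N g \<le> N (simple_integral M (s i)) + N (\<lambda>z. simple_integral M (s i) z - g z)"
      using triangle_reverse[OF sn(1)[of i] gX] by linarith
    also have "N (simple_integral M (s i)) \<le> (LINT t|M. N (s i t))" by (rule sn(3))
    also have "\<dots> \<le> (LINT t|M. N (h t) + \<phi> i t)"
    proof (rule integral_mono[OF sn(2) Bochner_Integration.integrable_add[OF int \<phi>_int]])
      fix t assume t: "t \<in> space M"
      show "N (s i t) \<le> N (h t) + \<phi> i t"
        using triangle_reverse[OF hX[OF t] s(2)[OF t, of i]] by (simp add: \<phi>_def)
    qed
    also have "\<dots> = (LINT t|M. N (h t)) + (LINT t|M. \<phi> i t)"
      by (rule Bochner_Integration.integral_add[OF int \<phi>_int])
    finally show ?thesis by simp
  qed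
  note le = this
  have "(\<lambda>i. (LINT t|M. N (h t)) + (N (\<lambda>z. simple_integral M (s i) z - g z) + (LINT t|M. \<phi> i t)))
      \<longlonglongrightarrow> (LINT t|M. N (h t)) + (0 + 0)"
    by (intro tendsto_add tendsto_const lim_g lim_\<phi>)
  then show "N g \<le> (LINT t|M. N (h t))"
    using LIMSEQ_le_const[of _ "(LINT t|M. N (h t)) + (0 + 0)" "N g"] le by auto
qed

text \<open>The definite description denotes because the value of any candidate at z is the scalar
  integral at z.\<close>

lemma integral_in_eqI:
  assumes M: "finite_measure M" and h: "has_integral_in X N M h g"
    and meas: "\<And>z. (\<lambda>t. h t z) \<in> borel_measurable M"
    and int: "integrable M (\<lambda>t. N (h t))"
  shows "integral_in X N M h = g"
  unfolding integral_in_def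
proof (rule the_equality)
  show "has_integral_in X N M h g" by fact
next
  fix g' assume "has_integral_in X N M h g'"
  then have "g' z = g z" for z
    using has_integral_in_imp(2)[OF M _ meas int, of g' z] has_integral_in_imp(2)[OF M h meas int, of z]
    by simp
  then show "g' = g" by (rule ext)
qed

lemma norm_continuous_onD:
  assumes h: "norm_continuous_on N I h" and hX: "\<And>t. t \<in> I \<Longrightarrow> h t \<in> X" and y: "y \<in> X"
  shows "continuous_on I (\<lambda>t. N (\<lambda>z. h t z - y z))" "continuous_on I (\<lambda>t. h t z)"
proof -
  have lim: "((\<lambda>s. N (\<lambda>z. h s z - h t z)) \<longlongrightarrow> 0) (at t within I)" if "t \<in> I" for t
    using h that by (simp add: norm_continuous_on_def)
  show "continuous_on I (\<lambda>t. N (\<lambda>z. h t z - y z))"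
    unfolding continuous_on_def
  proof
    fix t assume t: "t \<in> I"
    have "\<forall>\<^sub>F s in at t within I. norm (N (\<lambda>z. h s z - y z) - N (\<lambda>z. h t z - y z)) \<le> N (\<lambda>z. h s z - h t z)"
      unfolding eventually_at_filter
    proof (rule always_eventually, intro allI impI)
      fix s assume s: "s \<in> I"
      show "norm (N (\<lambda>z. h s z - y z) - N (\<lambda>z. h t z - y z)) \<le> N (\<lambda>z. h s z - h t z)"
        using triangle_reverse[OF diff_mem[OF hX[OF s] y] diff_mem[OF hX[OF t] y]] by simp
    qed
    then show "((\<lambda>t. N (\<lambda>z. h t z - y z)) \<longlongrightarrow> N (\<lambda>z. h t z - y z)) (at t within I)"
      by (rule LIM_zero_cancel[OF Lim_null_comparison[OF _ lim[OF t]]])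
  qed
  obtain C where C: "C \<ge> 0" "\<And>f. f \<in> X \<Longrightarrow> norm (f z) \<le> C * N f" using eval_bound by blast
  show "continuous_on I (\<lambda>t. h t z)"
    unfolding continuous_on_def
  proof
    fix t assume t: "t \<in> I"
    have "\<forall>\<^sub>F s in at t within I. norm (h s z - h t z) \<le> C * N (\<lambda>z. h s z - h t z)"
      unfolding eventually_at_filter
    proof (rule always_eventually, intro allI impI)
      fix s assume s: "s \<in> I"
      show "norm (h s z - h t z) \<le> C * N (\<lambda>z. h s z - h t z)"
        by (rule C(2)[OF diff_mem[OF hX[OF s] hX[OF t]]])
    qed
    then show "((\<lambda>t. h t z) \<longlongrightarrow> h t z) (at t within I)"
      by (rule LIM_zero_cancel[OF Lim_null_comparison[OF _ tendsto_mult_right_zero[OF lim[OF t]]]])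
  qed
qed

lemma norm_continuous_on_norm:
  assumes "norm_continuous_on N I h" "\<And>t. t \<in> I \<Longrightarrow> h t \<in> X"
  shows "continuous_on I (\<lambda>t. N (h t))"
  using norm_continuous_onD(1)[OF assms zero_mem] by simp

end

context evaluation_space
begin

text \<open>A continuous curve on the interval has separable range: each \<open>h t\<close> lies
  within e / 2 of some \<open>h (q k)\<close> with \<open>q\<close> running through a countable
  dense set. Choosing the least such k is measurable, and cutting off at a large n leaves finitely
  many values.\<close>

lemma simple_approximation:
  assumes h: "norm_continuous_on N {0<..<1} h" and hX: "\<And>t. t \<in> {0<..<1} \<Longrightarrow> h t \<in> X"
    and int: "integrable lborel01 (\<lambda>t. N (h t))" and "e > 0"
  obtains s where "simple_function lborel01 s" "\<And>t. t \<in> {0<..<1} \<Longrightarrow> s t \<in> X"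
    "integrable lborel01 (\<lambda>t. N (\<lambda>z. h t z - s t z))"
    "(LINT t|lborel01. N (\<lambda>z. h t z - s t z)) < e"
proof -
  interpret finite_measure lborel01 by (rule finite_measure_lborel01)
  let ?I = "{0<..<1::real}"
  have cont: "continuous_on ?I (\<lambda>t. N (\<lambda>z. h t z - y z))" if "y \<in> X" for y
    by (rule norm_continuous_onD(1)[OF h hX that])
  obtain D :: "real set" where D: "countable D"
    "\<And>U. open U \<Longrightarrow> U \<noteq> {} \<Longrightarrow> \<exists>d\<in>D. d \<in> U"
    by (rule countable_dense_setE) blast
  define D' where "D' = D \<inter> ?I"
  have D': "countable D'" "D' \<noteq> {}" using D(1) D(2)[of ?I] by (auto simp: D'_def)
  define q where "q = from_nat_into D'"
  have qI: "q k \<in> ?I" for k using from_nat_into[OF D'(2), of k] by (simp add: q_def D'_def)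
  have ex: "\<exists>k. N (\<lambda>z. h t z - h (q k) z) < e / 2" if t: "t \<in> ?I" for t
  proof -
    define U where "U = {s \<in> ?I. N (\<lambda>z. h s z - h t z) < e / 2}"
    have "openin (top_of_set ?I) (?I \<inter> (\<lambda>s. N (\<lambda>z. h s z - h t z)) -` {..<e / 2})"
      by (rule continuous_openin_preimage_gen[OF cont[OF hX[OF t]]]) simp
    moreover have "U = ?I \<inter> (\<lambda>s. N (\<lambda>z. h s z - h t z)) -` {..<e / 2}" by (auto simp: U_def)
    ultimately have "open U" by (simp add: openin_open_eq)
    moreover have "t \<in> U" using t \<open>e > 0\<close> by (simp add: U_def)
    ultimately obtain d where d: "d \<in> D" "d \<in> U" using D(2)[of U] by blast
    then have "d \<in> D'" by (auto simp: D'_def U_def)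
    then obtain k where k: "q k = d" using from_nat_into_surj[OF D'(1)] by (auto simp: q_def)
    have "N (\<lambda>z. h d z - h t z) < e / 2" using d by (simp add: U_def)
    moreover have "d \<in> ?I" using d by (simp add: U_def)
    ultimately show ?thesis using norm_minus_commute_fun[OF hX[OF t] hX, of d] k by (intro exI[of _ k]) simp
  qed
  \<comment> \<open>Taking the least index makes the selection measurable.\<close>
  define \<kappa> where "\<kappa> t = (LEAST k. N (\<lambda>z. h t z - h (q k) z) < e / 2)" for t
  have \<kappa>: "N (\<lambda>z. h t z - h (q (\<kappa> t)) z) < e / 2" if "t \<in> ?I" for t
    unfolding \<kappa>_def by (rule LeastI_ex[OF ex[OF that]])
  have meas_diff: "(\<lambda>t. N (\<lambda>z. h t z - y z)) \<in> borel_measurable lborel01" if "y \<in> X" for y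
    by (rule borel_measurable_lborel01[OF cont[OF that]])
  have \<kappa>_meas [measurable]: "\<kappa> \<in> measurable lborel01 (count_space UNIV)"
    unfolding \<kappa>_def using meas_diff[OF hX[OF qI]] by measurable
  \<comment> \<open>From index \<open>n\<close> on the approximation is 0 and the error is all of
    \<open>N (h t)\<close>; dominated convergence makes this contribution, called
    \<open>\<psi> n\<close>, small.\<close>
  define S where "S n k = (if k < n then h (q k) else (\<lambda>_. 0))" for n k :: nat
  have SX: "S n k \<in> X" for n k using hX[OF qI] by (simp add: S_def)
  define \<phi> where "\<phi> n t = N (\<lambda>z. h t z - S n (\<kappa> t) z)" for n t
  define \<psi> where "\<psi> n t = (if \<kappa> t < n then 0 else N (h t))" for n t
  have \<phi>_meas: "\<phi> n \<in> borel_measurable lborel01" for n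
    unfolding \<phi>_def by (rule measurable_compose_countable[OF meas_diff[OF SX] \<kappa>_meas])
  have N_meas [measurable]: "(\<lambda>t. N (h t)) \<in> borel_measurable lborel01"
    using int by (rule borel_measurable_integrable)
  have \<psi>_meas: "\<psi> n \<in> borel_measurable lborel01" for n
    unfolding \<psi>_def by measurable
  have \<phi>_le: "\<phi> n t \<le> e / 2 + \<psi> n t" if "t \<in> ?I" for n t
    using \<kappa>[OF that] \<open>e > 0\<close> nonneg[OF hX[OF that]] by (auto simp: \<phi>_def \<psi>_def S_def)
  have \<phi>_nonneg: "0 \<le> \<phi> n t" if "t \<in> ?I" for n t
    unfolding \<phi>_def by (rule nonneg[OF diff_mem[OF hX[OF that] SX]])
  have \<psi>_bound: "norm (\<psi> n t) \<le> N (h t)" if "t \<in> ?I" for n t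
    using nonneg[OF hX[OF that]] by (simp add: \<psi>_def)
  have \<psi>_int: "integrable lborel01 (\<psi> n)" for n
  proof (rule Bochner_Integration.integrable_bound[OF int \<psi>_meas AE_I2])
    fix t :: real assume "t \<in> space lborel01"
    then show "norm (\<psi> n t) \<le> norm (N (h t))"
      using \<psi>_bound[of t n] by simp
  qed
  have "(\<lambda>n. LINT t|lborel01. \<psi> n t) \<longlonglongrightarrow> (LINT t|lborel01. 0)"
  proof (rule integral_dominated_convergence[OF _ \<psi>_meas int])
    show "AE t in lborel01. (\<lambda>n. \<psi> n t) \<longlonglongrightarrow> 0"
    proof (rule AE_I2)
      fix t
      show "(\<lambda>n. \<psi> n t) \<longlonglongrightarrow> 0"
        by (rule tendsto_eventually, rule eventually_mono[OF eventually_gt_at_top[of "\<kappa> t"]])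
           (simp add: \<psi>_def)
    qed
    show "AE t in lborel01. norm (\<psi> n t) \<le> N (h t)" for n
      by (rule AE_I2) (use \<psi>_bound in simp)
  qed simp
  then have "\<forall>\<^sub>F n in sequentially. (LINT t|lborel01. \<psi> n t) < e / 2"
    by (rule order_tendstoD) (use \<open>e > 0\<close> in simp)
  then obtain n where n: "(LINT t|lborel01. \<psi> n t) < e / 2"
    unfolding eventually_sequentially by blast
  have bound_int: "integrable lborel01 (\<lambda>t. e / 2 + \<psi> n t)"
    by (intro Bochner_Integration.integrable_add integrable_const \<psi>_int)
  have \<phi>_int: "integrable lborel01 (\<phi> n)"
  proof (rule Bochner_Integration.integrable_bound[OF bound_int \<phi>_meas AE_I2])
    fix t :: real assume "t \<in> space lborel01"
    then show "norm (\<phi> n t) \<le> norm (e / 2 + \<psi> n t)"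
      using \<phi>_le[of t n] \<phi>_nonneg[of t n] by simp
  qed
  have "(LINT t|lborel01. \<phi> n t) \<le> (LINT t|lborel01. e / 2 + \<psi> n t)"
    by (rule integral_mono[OF \<phi>_int bound_int]) (use \<phi>_le in simp)
  also have "\<dots> = e / 2 + (LINT t|lborel01. \<psi> n t)"
    using \<psi>_int by (simp add: measure_def)
  finally have lt: "(LINT t|lborel01. \<phi> n t) < e" using n by simp
  \<comment> \<open>Replacing \<open>\<kappa> t\<close> by its minimum with \<open>n\<close> does
    not change \<open>S n\<close>, which is already 0 at index \<open>n\<close>, and makes the index
    take finitely many values.\<close>
  have "simple_function lborel01 (\<lambda>t. min (\<kappa> t) n)"
    unfolding simple_function_def
  proof (intro conjI ballI)
    show "finite ((\<lambda>t. min (\<kappa> t) n) ` space lborel01)"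
      by (rule finite_subset[of _ "{..n}"]) auto
    fix k
    have "(\<lambda>t. min (\<kappa> t) n) \<in> measurable lborel01 (count_space UNIV)" by measurable
    then show "(\<lambda>t. min (\<kappa> t) n) -` {k} \<inter> space lborel01 \<in> sets lborel01"
      by (rule measurable_sets) simp
  qed
  then have "simple_function lborel01 (\<lambda>t. S n (min (\<kappa> t) n))" by (rule simple_function_compose1)
  moreover have "S n (min k n) = S n k" for k by (simp add: S_def min_def)
  ultimately have "simple_function lborel01 (\<lambda>t. S n (\<kappa> t))" by simp
  then show ?thesis
    by (rule that[of "\<lambda>t. S n (\<kappa> t)"]) (use SX \<phi>_int[unfolded \<phi>_def] lt[unfolded \<phi>_def] in simp_all)
qed

text \<open>Integrals of simple functions differ in norm by at most their L^1 distance. Approximants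
  with error below 1 / (i + 1) therefore have Cauchy integrals, and completeness provides the
  limit.\<close>

lemma has_integral_in_exists:
  assumes complete: "\<And>F. (\<And>n::nat. F n \<in> X) \<Longrightarrow>
      (\<And>e. e > 0 \<Longrightarrow> \<exists>M. \<forall>m\<ge>M. \<forall>n\<ge>M. N (\<lambda>z. F m z - F n z) < e) \<Longrightarrow>
      \<exists>g\<in>X. (\<lambda>n. N (\<lambda>z. F n z - g z)) \<longlonglongrightarrow> 0"
    and h: "norm_continuous_on N {0<..<1} h" and hX: "\<And>t. t \<in> {0<..<1} \<Longrightarrow> h t \<in> X"
    and int: "integrable lborel01 (\<lambda>t. N (h t))"
  obtains g where "has_integral_in X N lborel01 h g"
proof -
  note M = finite_measure_lborel01
  let ?I = "{0<..<1::real}"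
  define P where "P i s \<longleftrightarrow> simple_function lborel01 s \<and> (\<forall>t\<in>?I. s t \<in> X) \<and>
      integrable lborel01 (\<lambda>t. N (\<lambda>z. h t z - s t z)) \<and>
      (LINT t|lborel01. N (\<lambda>z. h t z - s t z)) < 1 / real (Suc i)"
    for i and s :: "real \<Rightarrow> 'a \<Rightarrow> complex"
  have "\<exists>s. P i s" for i
  proof -
    obtain s where "simple_function lborel01 s" "\<And>t. t \<in> ?I \<Longrightarrow> s t \<in> X"
      "integrable lborel01 (\<lambda>t. N (\<lambda>z. h t z - s t z))"
      "(LINT t|lborel01. N (\<lambda>z. h t z - s t z)) < 1 / real (Suc i)"
      by (rule simple_approximation[OF h _ int, of "1 / real (Suc i)"]) (simp_all add: hX)
    then have "P i s" unfolding P_def by simp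
    then show ?thesis by (rule exI[of "P i" s])
  qed
  then obtain s where P: "P i (s i)" for i using choice[of P] by blast
  have s: "simple_function lborel01 (s i)" "t \<in> ?I \<Longrightarrow> s i t \<in> X"
    and \<phi>_int: "integrable lborel01 (\<lambda>t. N (\<lambda>z. h t z - s i t z))"
    and \<phi>_less: "(LINT t|lborel01. N (\<lambda>z. h t z - s i t z)) < 1 / real (Suc i)" for i t
    using P[of i] unfolding P_def by simp_all
  define \<phi> where "\<phi> i t = N (\<lambda>z. h t z - s i t z)" for i t
  note \<phi>_int = \<phi>_int[folded \<phi>_def] and \<phi>_less = \<phi>_less[folded \<phi>_def]
  have \<phi>_nonneg: "0 \<le> \<phi> i t" if "t \<in> ?I" for i t
    unfolding \<phi>_def by (rule nonneg[OF diff_mem[OF hX[OF that] s(2)[OF that]]])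
  define F where "F i = simple_integral lborel01 (s i)" for i
  have FX: "F i \<in> X" for i
    unfolding F_def using simple_integral_norm(1)[OF M s(1)] s(2) by simp
  \<comment> \<open>The difference of two simple integrals is the integral of the simple difference,
    identified pointwise; the triangle inequality through \<open>h t\<close> then bounds it.\<close>
  have F_diff: "N (\<lambda>z. F i z - F j z) \<le> 1 / real (Suc i) + 1 / real (Suc j)" for i j
  proof -
    let ?d = "\<lambda>t z. s i t z - s j t z"
    have d: "simple_function lborel01 ?d"
      using simple_function_compose2[OF s(1)[of i] s(1)[of j], of "\<lambda>f g z. f z - g z"] .
    have dX: "?d t \<in> X" if "t \<in> space lborel01" for t
      using that by (intro diff_mem s(2)) simp_all
      have nd: "integrable lborel01 (\<lambda>t. N (?d t))"
        "N (simple_integral lborel01 ?d) \<le> (LINT t|lborel01. N (?d t))"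
      using simple_integral_norm(2,3)[OF M d] dX by blast+
    have "simple_integral lborel01 ?d z = F i z - F j z" for z
    proof -
      have "simple_integral lborel01 ?d z = (LINT t|lborel01. s i t z - s j t z)"
        using simple_integral_eval(2)[OF M d, of z] by simp
      also have "\<dots> = (LINT t|lborel01. s i t z) - (LINT t|lborel01. s j t z)"
        by (rule Bochner_Integration.integral_diff[OF simple_integral_eval(1)[OF M s(1)] simple_integral_eval(1)[OF M s(1)]])
      finally show ?thesis
        unfolding F_def simple_integral_eval(2)[OF M s(1)] .
    qed
    then have "simple_integral lborel01 ?d = (\<lambda>z. F i z - F j z)" by (rule ext)
    then have "N (\<lambda>z. F i z - F j z) \<le> (LINT t|lborel01. N (?d t))" using nd(2) by simp
    also have "\<dots> \<le> (LINT t|lborel01. \<phi> i t + \<phi> j t)"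
    proof (rule integral_mono[OF nd(1) Bochner_Integration.integrable_add[OF \<phi>_int \<phi>_int]])
      fix t assume "t \<in> space lborel01"
      then have t: "t \<in> ?I" by simp
      show "N (?d t) \<le> \<phi> i t + \<phi> j t"
        using triangle_via[OF s(2)[OF t, of i] hX[OF t] s(2)[OF t, of j]]
          norm_minus_commute_fun[OF s(2)[OF t, of i] hX[OF t]] by (simp add: \<phi>_def)
    qed
    also have "\<dots> = (LINT t|lborel01. \<phi> i t) + (LINT t|lborel01. \<phi> j t)"
      by (rule Bochner_Integration.integral_add[OF \<phi>_int \<phi>_int])
    finally show ?thesis using \<phi>_less[of i] \<phi>_less[of j] by linarith
  qed
  have Cauchy: "\<exists>M. \<forall>m\<ge>M. \<forall>n\<ge>M. N (\<lambda>z. F m z - F n z) < e" if "e > 0" for e :: real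
  proof -
    obtain M where M: "1 / real (Suc M) < e / 2" using nat_approx_posE[of "e / 2"] \<open>e > 0\<close> by auto
    have le: "1 / real (Suc m) \<le> 1 / real (Suc M)" if "m \<ge> M" for m
      using that by (simp add: frac_le)
    have "N (\<lambda>z. F m z - F n z) < e" if "m \<ge> M" "n \<ge> M" for m n
      using F_diff[of m n] le[OF that(1)] le[OF that(2)] M by linarith
    then show ?thesis by blast
  qed
  obtain g where g: "g \<in> X" "(\<lambda>n. N (\<lambda>z. F n z - g z)) \<longlonglongrightarrow> 0"
    using complete[of F, OF FX Cauchy] ..
  have "(\<lambda>i. \<integral>\<^sup>+ t. ennreal (\<phi> i t) \<partial>lborel01) \<longlonglongrightarrow> 0"
  proof -
    have "(\<lambda>i. LINT t|lborel01. \<phi> i t) \<longlonglongrightarrow> 0"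
      by (rule null_sequence_squeeze[OF _ less_imp_le[OF \<phi>_less] LIMSEQ_Suc[OF lim_1_over_n]])
         (intro Bochner_Integration.integral_nonneg, simp add: \<phi>_nonneg)
    then have "(\<lambda>i. ennreal (LINT t|lborel01. \<phi> i t)) \<longlonglongrightarrow> ennreal 0" by (rule tendsto_ennrealI)
    moreover have "(\<integral>\<^sup>+ t. ennreal (\<phi> i t) \<partial>lborel01) = ennreal (LINT t|lborel01. \<phi> i t)" for i
      by (rule nn_integral_eq_integral[OF \<phi>_int AE_I2]) (simp add: \<phi>_nonneg)
    ultimately show ?thesis by simp
  qed
  moreover have "emeasure lborel01 {t \<in> space lborel01. s i t \<noteq> (\<lambda>_. 0)} \<noteq> \<infinity>" for i
    using finite_measure.emeasure_finite[OF M] by simp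
  ultimately have "has_integral_in X N lborel01 h g"
    unfolding has_integral_in_def space_lborel01
    using g hX s borel_measurable_integrable[OF \<phi>_int]
    by (intro conjI exI[of _ s] allI ballI) (simp_all add: F_def \<phi>_def[abs_def] space_lborel01)
  then show ?thesis using that by blast
qed

end

section \<open>Integrals of families of operators\<close>

locale complete_approximable_space = approximable_space +
  assumes complete: "(\<And>n::nat. F n \<in> X) \<Longrightarrow>
      (\<And>e. e > 0 \<Longrightarrow> \<exists>M. \<forall>m\<ge>M. \<forall>n\<ge>M. N (\<lambda>z. F m z - F n z) < e) \<Longrightarrow>
      \<exists>g\<in>X. (\<lambda>n. N (\<lambda>z. F n z - g z)) \<longlonglongrightarrow> 0"
begin

context
  fixes S :: "real \<Rightarrow> ('a \<Rightarrow> complex) \<Rightarrow> 'a \<Rightarrow> complex"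
  assumes S_op: "\<And>t. t \<in> {0<..<1} \<Longrightarrow> S t \<in> B"
    and S_cont: "\<And>f. f \<in> X \<Longrightarrow> norm_continuous_on N {0<..<1} (\<lambda>t. S t f)"
    and S_int: "integrable lborel01 (\<lambda>t. op_norm X N (S t))"
begin

lemma S_continuous: "f \<in> X \<Longrightarrow> continuous_on {0<..<1} (\<lambda>t. N (S t f))"
  by (rule norm_continuous_on_norm[OF S_cont]) (simp_all add: opD[OF S_op])

lemma S_measurable: "f \<in> X \<Longrightarrow> (\<lambda>t. N (S t f)) \<in> borel_measurable lborel01"
  by (rule borel_measurable_lborel01[OF S_continuous])

lemma S_integrable:
  assumes f: "f \<in> X"
  shows "integrable lborel01 (\<lambda>t. N (S t f))"
proof (rule Bochner_Integration.integrable_bound[OF integrable_mult_left[OF S_int, of "N f"] S_measurable[OF f] AE_I2])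
  fix t :: real assume "t \<in> space lborel01"
  then have t: "t \<in> {0<..<1}" by simp
  show "norm (N (S t f)) \<le> norm (op_norm X N (S t) * N f)"
    using op_norm_upper[OF S_op[OF t] f] nonneg[OF opD[OF S_op[OF t] f]] by simp
qed

lemma ess_norm_measurable: "(\<lambda>t. ess_norm X N (S t)) \<in> borel_measurable lborel01"
proof (rule borel_measurable_LIMSEQ_real)
  fix t :: real assume "t \<in> space lborel01"
  then show "(\<lambda>n. op_norm X N (\<lambda>f. S t (R n f))) \<longlonglongrightarrow> ess_norm X N (S t)"
    by (intro op_norm_R_tendsto S_op) simp
next
  fix n
  show "(\<lambda>t. op_norm X N (\<lambda>f. S t (R n f))) \<in> borel_measurable lborel01"
  proof (rule borel_measurable_lborel01_lower_semicontinuous)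
    fix a
    \<comment> \<open>The superlevel set is a union of relatively open sets, one for each f in the
      unit ball.\<close>
    have "{t \<in> {0<..<1}. a < op_norm X N (\<lambda>f. S t (R n f))} =
        (\<Union>f\<in>{f \<in> X. N f \<le> 1}. {0<..<1} \<inter> (\<lambda>t. N (S t (R n f))) -` {a<..})"
      using op_norm_less_iff[OF op_comp[OF S_op R_op]] by auto
    also have "openin (top_of_set {0<..<1}) \<dots>"
    proof (intro openin_Union ballI, clarify)
      fix f assume "f \<in> X" "N f \<le> 1"
      show "openin (top_of_set {0<..<1}) ({0<..<1} \<inter> (\<lambda>t. N (S t (R n f))) -` {a<..})"
        by (rule continuous_openin_preimage_gen[OF S_continuous[OF opD[OF R_op \<open>f \<in> X\<close>]]]) simp
    qed
    finally show "openin (top_of_set {0<..<1}) {t \<in> {0<..<1}. a < op_norm X N (\<lambda>f. S t (R n f))}" .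
  qed
qed

lemma ess_norm_integrable: "integrable lborel01 (\<lambda>t. ess_norm X N (S t))"
proof (rule Bochner_Integration.integrable_bound[OF S_int ess_norm_measurable AE_I2])
  fix t :: real assume "t \<in> space lborel01"
  then have t: "t \<in> {0<..<1}" by simp
  show "norm (ess_norm X N (S t)) \<le> norm (op_norm X N (S t))"
    using ess_norm_nonneg[OF S_op[OF t]] ess_norm_le_op_norm[OF S_op[OF t]] by simp
qed

abbreviation T where "T \<equiv> \<lambda>f. integral_in X N lborel01 (\<lambda>t. S t f)"

text \<open>Completeness yields existence and point values yield uniqueness; afterwards the integral
  is handled through these facts alone.\<close>

lemma T_props:
  assumes f: "f \<in> X"
  shows "T f \<in> X" "T f z = (LINT t|lborel01. S t f z)" "integrable lborel01 (\<lambda>t. S t f z)"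
    "N (T f) \<le> (LINT t|lborel01. N (S t f))"
proof -
  have SX: "S t f \<in> X" if "t \<in> {0<..<1}" for t by (rule opD[OF S_op[OF that] f])
  note M = finite_measure_lborel01
  obtain g where g: "has_integral_in X N lborel01 (\<lambda>t. S t f) g"
    using has_integral_in_exists[OF complete S_cont[OF f] _ S_integrable[OF f]] SX by blast
  have meas: "(\<lambda>t. S t f z) \<in> borel_measurable lborel01" for z
    by (rule borel_measurable_lborel01[OF norm_continuous_onD(2)[OF S_cont[OF f] _ zero_mem]]) (rule SX)
  have "T f = g" by (rule integral_in_eqI[OF M g meas S_integrable[OF f]])
  with has_integral_in_imp[OF M g meas S_integrable[OF f]]
  show "T f \<in> X" "T f z = (LINT t|lborel01. S t f z)" "integrable lborel01 (\<lambda>t. S t f z)"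
    "N (T f) \<le> (LINT t|lborel01. N (S t f))" by simp_all
qed

lemma T_op: "T \<in> B"
proof (rule bounded_opsI[where C = "LINT t|lborel01. op_norm X N (S t)"])
  fix f assume f: "f \<in> X"
  show "T f \<in> X" by (rule T_props(1)[OF f])
  have "(LINT t|lborel01. N (S t f)) \<le> (LINT t|lborel01. op_norm X N (S t) * N f)"
    by (rule integral_mono[OF S_integrable[OF f] integrable_mult_left[OF S_int]])
       (simp add: op_norm_upper[OF S_op f])
  then show "N (T f) \<le> (LINT t|lborel01. op_norm X N (S t)) * N f"
    using T_props(4)[OF f] by simp
next
  fix f g a b assume f: "f \<in> X" and g: "g \<in> X"
  show "T (\<lambda>z. a * f z + b * g z) = (\<lambda>z. a * T f z + b * T g z)"
  proof
    fix z
    have "T (\<lambda>z. a * f z + b * g z) z = (LINT t|lborel01. S t (\<lambda>z. a * f z + b * g z) z)"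
      by (rule T_props(2)[OF lin_mem[OF f g]])
    also have "\<dots> = (LINT t|lborel01. a * S t f z + b * S t g z)"
      by (rule Bochner_Integration.integral_cong[OF refl]) (simp add: op_lin[OF S_op f g])
    also have "\<dots> = a * T f z + b * T g z"
      unfolding T_props(2)[OF f] T_props(2)[OF g]
      using T_props(3)[OF f, of z] T_props(3)[OF g, of z] by simp
    finally show "T (\<lambda>z. a * f z + b * g z) z = a * T f z + b * T g z" .
  qed
qed

theorem ess_norm_integral_less:
  assumes no: "\<not> (\<exists>F \<in> weakly_null_sphere X N.
           AE t in lborel01. (\<lambda>n. N (S t (F n))) \<longlonglongrightarrow> ess_norm X N (S t))"
  shows "ess_norm X N T < (LINT t|lborel01. ess_norm X N (S t))"
proof (rule ccontr)
  assume "\<not> ?thesis"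
  then have ge: "(LINT t|lborel01. ess_norm X N (S t)) \<le> ess_norm X N T" by simp
  let ?E = "\<lambda>t. ess_norm X N (S t)"
  obtain F where F: "F \<in> weakly_null_sphere X N" "(\<lambda>n. N (T (F n))) \<longlonglongrightarrow> ess_norm X N T"
    by (rule ess_norm_attained[OF T_op])
  note FX = weakly_null_sphereD(2)[OF F(1)]
  define d where "d n t = N (S t (F n)) - ?E t" for n t
  have d_int: "integrable lborel01 (d n)" for n
    unfolding d_def by (rule Bochner_Integration.integrable_diff[OF S_integrable[OF FX] ess_norm_integrable])
  \<comment> \<open>The excess over the essential norm tends to 0 pointwise. It is dominated by
    \<open>op_norm X N (S t)\<close>, because \<open>F n\<close> has norm 1 and the essential norm
    is nonnegative.\<close>
  define d' where "d' n t = max (d n t) 0" for n t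
  have d'_int: "integrable lborel01 (d' n)" for n
    unfolding d'_def by (intro integrable_max d_int) simp
  have lim_d': "(\<lambda>n. LINT t|lborel01. d' n t) \<longlonglongrightarrow> (LINT t|lborel01. 0)"
  proof (rule integral_dominated_convergence[OF _ borel_measurable_integrable[OF d'_int] S_int])
    show "AE t in lborel01. (\<lambda>n. d' n t) \<longlonglongrightarrow> 0"
    proof (rule AE_I2)
      fix t :: real assume "t \<in> space lborel01"
      then have t: "t \<in> {0<..<1}" by simp
      show "(\<lambda>n. d' n t) \<longlonglongrightarrow> 0"
      proof (rule order_tendstoI)
        fix e :: real assume "0 < e"
        from ess_norm_limsup[OF S_op[OF t] F(1) this]
        show "\<forall>\<^sub>F n in sequentially. d' n t < e"
          by eventually_elim (use \<open>0 < e\<close> in \<open>simp add: d'_def d_def\<close>)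
      qed (simp add: d'_def less_max_iff_disj)
    qed
    show "AE t in lborel01. norm (d' n t) \<le> op_norm X N (S t)" for n
    proof (rule AE_I2)
      fix t :: real assume "t \<in> space lborel01"
      then have t: "t \<in> {0<..<1}" by simp
      show "norm (d' n t) \<le> op_norm X N (S t)"
        using op_norm_upper[OF S_op[OF t] FX, of n] weakly_null_sphereD(3)[OF F(1), of n]
          ess_norm_nonneg[OF S_op[OF t]] op_norm_nonneg[OF S_op[OF t]]
        by (simp add: d'_def d_def max_def)
    qed
  qed simp
  \<comment> \<open>Use \<open>\<bar>d\<bar> = 2 * d' - d\<close>. Under the assumption to be
    refuted, the integral of \<open>d n\<close> is at least
    \<open>N (T (F n)) - ess_norm X N T\<close>, which tends to 0; so no negative part can
    persist.\<close>
  have "(LINT t|lborel01. norm (d n t)) \<le> 2 * (LINT t|lborel01. d' n t) - (N (T (F n)) - ess_norm X N T)" for n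
  proof -
    have "(LINT t|lborel01. norm (d n t)) = (LINT t|lborel01. 2 * d' n t - d n t)"
      by (rule Bochner_Integration.integral_cong[OF refl]) (simp add: d'_def max_def)
    also have "\<dots> = 2 * (LINT t|lborel01. d' n t) - (LINT t|lborel01. d n t)"
      using d_int d'_int by simp
    also have "(LINT t|lborel01. d n t) = (LINT t|lborel01. N (S t (F n))) - (LINT t|lborel01. ?E t)"
      unfolding d_def by (rule Bochner_Integration.integral_diff[OF S_integrable[OF FX] ess_norm_integrable])
    finally show ?thesis using T_props(4)[OF FX[of n]] ge by linarith
  qed
  moreover have "(\<lambda>n. 2 * (LINT t|lborel01. d' n t) - (N (T (F n)) - ess_norm X N T)) \<longlonglongrightarrow> 0"
  proof -
    have "(\<lambda>n. 2 * (LINT t|lborel01. d' n t) - (N (T (F n)) - ess_norm X N T)) \<longlonglongrightarrow>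
        2 * (LINT t|lborel01. 0) - (ess_norm X N T - ess_norm X N T)"
      by (intro tendsto_diff tendsto_mult lim_d' F(2) tendsto_const)
    then show ?thesis by simp
  qed
  ultimately have "(\<lambda>n. LINT t|lborel01. norm (d n t)) \<longlonglongrightarrow> 0"
    by (rule null_sequence_squeeze[OF Bochner_Integration.integral_nonneg[OF norm_ge_zero]])
  \<comment> \<open>L^1 convergence gives convergence almost everywhere only along a subsequence,
    which is harmless: \<open>F \<circ> r\<close> is again a weakly null sequence on the
    sphere.\<close>
  from tendsto_L1_AE_subseq[OF d_int this]
  obtain r :: "nat \<Rightarrow> nat" where r: "strict_mono r" "AE t in lborel01. (\<lambda>n. d (r n) t) \<longlonglongrightarrow> 0"
    by blast
  have "AE t in lborel01. (\<lambda>n. N (S t (F (r n)))) \<longlonglongrightarrow> ?E t"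
    using r(2) by eventually_elim (simp add: d_def LIM_zero_iff)
  then have "\<exists>F \<in> weakly_null_sphere X N. AE t in lborel01. (\<lambda>n. N (S t (F n))) \<longlonglongrightarrow> ?E t"
    by (rule bexI[of "\<lambda>F. AE t in lborel01. (\<lambda>n. N (S t (F n))) \<longlonglongrightarrow> ?E t",
        OF _ weakly_null_sphere_subseq[OF F(1) r(1)]])
  with no show False ..
qed

end

end

section \<open>The mean value property over disks\<close>

lemma measurable_Complex [measurable]:
  assumes [measurable]: "f \<in> borel_measurable M" "g \<in> borel_measurable M"
  shows "(\<lambda>x. Complex (f x) (g x)) \<in> borel_measurable M"
  unfolding Complex_eq by measurable

text \<open>Complex boxes are products of intervals. Writing plane measure as a product reduces
  rotations to affine substitutions in one real variable.\<close>

lemma lborel_complex_eq_distr: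
  "(lborel :: complex measure) = distr (lborel \<Otimes>\<^sub>M lborel) borel (\<lambda>(x, y). Complex x y)"
proof (rule lborel_eqI)
  have [measurable]: "(\<lambda>(x, y). Complex x y) \<in> borel_measurable (lborel \<Otimes>\<^sub>M lborel)"
    by measurable
  fix l u :: complex assume lu: "\<And>b. b \<in> Basis \<Longrightarrow> l \<bullet> b \<le> u \<bullet> b"
  have le: "Re l \<le> Re u" "Im l \<le> Im u"
    using lu[of 1] lu[of \<i>] by (auto simp: Basis_complex_def)
  have vim: "(\<lambda>(x, y). Complex x y) -` box l u \<inter> space (lborel \<Otimes>\<^sub>M lborel) =
      {Re l<..<Re u} \<times> {Im l<..<Im u}"
    by (auto simp: in_box_complex_iff space_pair_measure)
  show "emeasure (distr (lborel \<Otimes>\<^sub>M lborel) borel (\<lambda>(x, y). Complex x y)) (box l u) =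
      ennreal (prod ((\<bullet>) (u - l)) Basis)"
    using le by (subst emeasure_distr)
      (auto simp: vim lborel.emeasure_pair_measure_Times Basis_complex_def ennreal_mult')
qed simp

lemma nn_integral_complex:
  assumes [measurable]: "f \<in> borel_measurable borel"
  shows "(\<integral>\<^sup>+ z. f z \<partial>lborel) = (\<integral>\<^sup>+ y. \<integral>\<^sup>+ x. f (Complex x y) \<partial>lborel \<partial>lborel)"
proof -
  have [measurable]: "(\<lambda>(x, y). Complex x y) \<in> borel_measurable (lborel \<Otimes>\<^sub>M lborel)"
    by measurable
  have "(\<integral>\<^sup>+ z. f z \<partial>lborel) = (\<integral>\<^sup>+ (x, y). f (Complex x y) \<partial>(lborel \<Otimes>\<^sub>M lborel))"
    by (subst lborel_complex_eq_distr, subst nn_integral_distr) (auto simp: split_def)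
  also have "\<dots> = (\<integral>\<^sup>+ y. \<integral>\<^sup>+ x. f (Complex x y) \<partial>lborel \<partial>lborel)"
    by (subst lborel_pair.nn_integral_snd[symmetric]) (auto simp: split_def)
  finally show ?thesis .
qed

text \<open>
  With \<open>\<omega> = c + \<i>s\<close>, first \<open>x\<close> is replaced by \<open>s x + c y\<close> for fixed \<open>y\<close>, and then, after exchanging the
  integrals, \<open>y\<close> by the remaining coordinate; the factors \<open>1 / \<bar>s\<bar>\<close> and \<open>\<bar>s\<bar>\<close> cancel.
\<close>

lemma nn_integral_rotate:
  assumes [measurable]: "f \<in> borel_measurable borel" and \<omega>: "norm \<omega> = 1" "Im \<omega> \<noteq> 0"
  shows "(\<integral>\<^sup>+ z. f (\<omega> * z) \<partial>lborel) = (\<integral>\<^sup>+ z. f z \<partial>lborel)"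
proof -
  define c s where "c = Re \<omega>" and "s = Im \<omega>"
  have cs: "c\<^sup>2 + s\<^sup>2 = 1" "s \<noteq> 0" using \<omega> by (auto simp: c_def s_def cmod_def)
  have *: "\<omega> * Complex x y = Complex (c * x - s * y) (s * x + c * y)" for x y
    by (simp add: complex_eq_iff c_def s_def)
  have "(\<integral>\<^sup>+ z. f (\<omega> * z) \<partial>lborel) =
      (\<integral>\<^sup>+ y. \<integral>\<^sup>+ x. f (Complex (c * x - s * y) (s * x + c * y)) \<partial>lborel \<partial>lborel)"
    by (subst nn_integral_complex) (auto simp: *)
  also have "\<dots> = (\<integral>\<^sup>+ y. \<integral>\<^sup>+ x. \<bar>1 / s\<bar> * f (Complex ((c / s) * x + (- 1 / s) * y) x) \<partial>lborel \<partial>lborel)"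
  proof (rule nn_integral_cong)
    fix y
    have eq: "c * (- (c / s) * y + 1 / s * x) - s * y = (c / s) * x + (- 1 / s) * y"
      "s * (- (c / s) * y + 1 / s * x) + c * y = x" for x
    proof -
      have "c * (- (c / s) * y + 1 / s * x) - s * y = (c / s) * x - ((c\<^sup>2 + s\<^sup>2) / s) * y"
        using cs(2) by (simp add: field_simps power2_eq_square)
      then show "c * (- (c / s) * y + 1 / s * x) - s * y = (c / s) * x + (- 1 / s) * y"
        unfolding cs(1) by simp
      show "s * (- (c / s) * y + 1 / s * x) + c * y = x"
        using cs(2) by (simp add: field_simps)
    qed
    show "(\<integral>\<^sup>+ x. f (Complex (c * x - s * y) (s * x + c * y)) \<partial>lborel) =
        (\<integral>\<^sup>+ x. \<bar>1 / s\<bar> * f (Complex ((c / s) * x + (- 1 / s) * y) x) \<partial>lborel)"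
      using cs nn_integral_real_affine[of "\<lambda>x. f (Complex (c * x - s * y) (s * x + c * y))" "1 / s" "- (c / s) * y"]
      unfolding eq by (simp add: nn_integral_cmult)
  qed
  also have "\<dots> = (\<integral>\<^sup>+ x. \<integral>\<^sup>+ y. \<bar>1 / s\<bar> * f (Complex ((c / s) * x + (- 1 / s) * y) x) \<partial>lborel \<partial>lborel)"
    by (rule lborel_pair.Fubini') measurable
  also have "\<dots> = (\<integral>\<^sup>+ y. \<integral>\<^sup>+ x. f (Complex x y) \<partial>lborel \<partial>lborel)"
  proof (rule nn_integral_cong)
    fix y
    show "(\<integral>\<^sup>+ x. \<bar>1 / s\<bar> * f (Complex ((c / s) * y + (- 1 / s) * x) y) \<partial>lborel) =
        (\<integral>\<^sup>+ x. f (Complex x y) \<partial>lborel)"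
      using cs nn_integral_real_affine[of "\<lambda>x. f (Complex x y)" "- 1 / s" "(c / s) * y"]
      by (simp add: nn_integral_cmult)
  qed
  also have "\<dots> = (\<integral>\<^sup>+ z. f z \<partial>lborel)"
    by (rule nn_integral_complex[symmetric]) simp
  finally show ?thesis .
qed

text \<open>As an identity of measures, the invariance also applies to complex-valued
  integrands.\<close>

lemma lborel_distr_rotate:
  assumes "norm \<omega> = 1" "Im \<omega> \<noteq> 0"
  shows "distr lborel borel (\<lambda>z. \<omega> * z) = lborel"
proof (rule measure_eqI)
  fix A assume "A \<in> sets (distr lborel borel (\<lambda>z. \<omega> * z))"
  then have [measurable]: "A \<in> sets borel" by simp
  have "emeasure (distr lborel borel (\<lambda>z. \<omega> * z)) A =
      (\<integral>\<^sup>+ z. indicator A z \<partial>distr lborel borel (\<lambda>z. \<omega> * z))"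
    by (subst nn_integral_indicator) simp_all
  also have "\<dots> = (\<integral>\<^sup>+ z. indicator A (\<omega> * z) \<partial>lborel)"
    by (rule nn_integral_distr) measurable
  also have "\<dots> = emeasure lborel A"
    using nn_integral_rotate[OF _ assms, of "indicator A"] by simp
  finally show "emeasure (distr lborel borel (\<lambda>z. \<omega> * z)) A = emeasure lborel A" .
qed simp

text \<open>A rotation preserves the disk but multiplies the integrand by the imaginary unit, so the
  integral equals that multiple of itself.\<close>

lemma integral_ball_power:
  assumes "k > 0"
  shows "(LINT z|lborel. indicator (ball 0 \<delta>) z * z ^ k :: complex) = 0"
proof -
  \<comment> \<open>The angle pi / (2 k) lies between 0 and pi / 2: its sine is positive, as the
    rotation lemma requires, and the k-th power of \<omega> differs from 1.\<close>
  define \<omega> where "\<omega> = cis (pi / (2 * k))"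
  have "sin (pi / (2 * k)) > 0"
    using assms by (intro sin_gt_zero) (auto simp: field_simps)
  then have \<omega>: "norm \<omega> = 1" "Im \<omega> \<noteq> 0" by (auto simp: \<omega>_def)
  have \<omega>k: "\<omega> ^ k = \<i>"
  proof -
    have eq: "real k * (pi / real (2 * k)) = pi / 2" using assms by simp
    have "\<omega> ^ k = cis (real k * (pi / real (2 * k)))" unfolding \<omega>_def by (rule Complex.DeMoivre)
    then show ?thesis unfolding eq by simp
  qed
  have [measurable]: "ball (0 :: complex) \<delta> \<in> sets borel" by simp
  let ?I = "LINT z|lborel. indicator (ball 0 \<delta>) z * z ^ k :: complex"
  have "?I = (LINT z|distr lborel borel (\<lambda>z. \<omega> * z). indicator (ball 0 \<delta>) z * z ^ k)"
    by (simp add: lborel_distr_rotate[OF \<omega>])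
  also have "\<dots> = (LINT z|lborel. indicator (ball 0 \<delta>) (\<omega> * z) * (\<omega> * z) ^ k)"
    by (rule integral_distr) measurable
  also have "\<dots> = (LINT z|lborel. \<i> * (indicator (ball 0 \<delta>) z * z ^ k))"
    by (rule Bochner_Integration.integral_cong[OF refl])
       (simp add: indicator_def norm_mult \<omega>(1) power_mult_distrib \<omega>k)
  also have "\<dots> = \<i> * ?I" by simp
  finally have "(1 - \<i>) * ?I = 0" by (simp add: algebra_simps)
  moreover have "1 - \<i> \<noteq> 0" by (simp add: complex_eq_iff)
  ultimately show ?thesis by simp
qed

lemma integrable_ball_continuous:
  fixes h :: "complex \<Rightarrow> complex"
  assumes "continuous_on (cball 0 \<delta>) h"
  shows "integrable lborel (\<lambda>z. indicator (ball 0 \<delta>) z * h z)"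
proof -
  have "set_integrable lborel (cball 0 \<delta>) h"
    by (rule borel_integrable_compact[unfolded set_integrable_def[symmetric]]) (use assms in auto)
  then have "set_integrable lborel (ball 0 \<delta>) h"
    by (rule set_integrable_subset) auto
  moreover have "(\<lambda>z. indicator (ball 0 \<delta>) z *\<^sub>R h z) = (\<lambda>z. indicator (ball 0 \<delta>) z * h z)"
    by (auto simp: indicator_def)
  ultimately show ?thesis unfolding set_integrable_def by simp
qed

text \<open>Integrate the power series term by term; all monomials except the constant one
  contribute 0.\<close>

lemma mean_value_ball:
  fixes h :: "complex \<Rightarrow> complex"
  assumes h: "h holomorphic_on ball 0 R" and \<delta>: "0 < \<delta>" "\<delta> < R"
  shows "(LINT z|lborel. indicator (ball 0 \<delta>) z * h z) = measure lborel (ball (0 :: complex) \<delta>) * h 0"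
proof -
  define a where "a n = (deriv ^^ n) h 0 / fact n" for n
  have sums: "(\<lambda>n. a n * z ^ n) sums h z" if "z \<in> ball 0 R" for z
    using holomorphic_power_series[OF h that] by (simp add: a_def)
  have summ: "summable (\<lambda>n. norm (a n) * \<delta> ^ n)"
  proof -
    \<comment> \<open>Convergence at a radius beyond \<delta> gives absolute convergence at
      \<delta>, whose sum is the dominating constant.\<close>
    obtain \<rho> where \<rho>: "\<delta> < \<rho>" "\<rho> < R" using dense \<delta>(2) by blast
    have "(\<lambda>n. a n * of_real \<rho> ^ n) sums h (of_real \<rho>)"
      using \<delta> \<rho> by (intro sums) simp
    then have "summable (\<lambda>n. norm (a n * of_real \<delta> ^ n))"
      by (intro powser_insidea[OF sums_summable]) (use \<delta> \<rho> in auto)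
    then show ?thesis using \<delta> by (simp add: norm_mult norm_power)
  qed
  have [measurable]: "ball (0 :: complex) \<delta> \<in> sets borel" by simp
  let ?s = "\<lambda>n z. indicator (ball 0 \<delta>) z * (\<Sum>k<n. a k * z ^ k)"
  have meas_ball: "emeasure lborel (ball (0 :: complex) \<delta>) < \<infinity>" by (rule emeasure_lborel_ball_finite)
  have int: "integrable lborel (\<lambda>z. indicator (ball 0 \<delta>) z * z ^ k :: complex)" for k
    by (rule integrable_ball_continuous) (intro continuous_intros)
  have "(LINT z|lborel. ?s n z) = (\<Sum>k<n. a k * (LINT z|lborel. indicator (ball 0 \<delta>) z * z ^ k))" for n
  proof -
    have "(LINT z|lborel. ?s n z) = (LINT z|lborel. (\<Sum>k<n. a k * (indicator (ball 0 \<delta>) z * z ^ k)))"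
      by (rule Bochner_Integration.integral_cong[OF refl]) (simp add: sum_distrib_left mult_ac)
    also have "\<dots> = (\<Sum>k<n. LINT z|lborel. a k * (indicator (ball 0 \<delta>) z * z ^ k))"
      by (rule Bochner_Integration.integral_sum) (intro integrable_mult_right int)
    finally show ?thesis by simp
  qed
  \<comment> \<open>Only the constant term survives, and for n = 0 the empty partial sum lacks even
    that.\<close>
  also have "(\<Sum>k<n. a k * (LINT z|lborel. indicator (ball 0 \<delta>) z * z ^ k)) =
      (if n = 0 then 0 else a 0 * measure lborel (ball (0 :: complex) \<delta>))" for n
  proof (cases n)
    case (Suc m)
    have "(\<Sum>k<n. a k * (LINT z|lborel. indicator (ball 0 \<delta>) z * z ^ k)) =
        (\<Sum>k<n. if k = 0 then a 0 * (LINT z|lborel. indicator (ball (0 :: complex) \<delta>) z) else 0)"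
      by (intro sum.cong) (auto simp: integral_ball_power)
    also have "(LINT z|lborel. indicator (ball (0 :: complex) \<delta>) z :: complex) =
        of_real (measure lborel (ball (0 :: complex) \<delta>))"
      using integral_complex_of_real[of lborel "indicator (ball (0 :: complex) \<delta>)"] meas_ball
      by (simp add: of_real_indicator)
    finally show ?thesis using Suc by simp
  qed simp
  finally have eq: "(LINT z|lborel. ?s n z) =
    (if n = 0 then 0 else a 0 * measure lborel (ball (0 :: complex) \<delta>))" for n .
  have "(\<lambda>n. LINT z|lborel. ?s n z) \<longlonglongrightarrow> (LINT z|lborel. indicator (ball 0 \<delta>) z * h z)"
  proof (rule integral_dominated_convergence)
    have cont: "continuous_on (cball 0 \<delta>) h"
      by (rule continuous_on_subset[OF holomorphic_on_imp_continuous_on[OF h]]) (use \<delta> in auto)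
    show "(\<lambda>z. indicator (ball 0 \<delta>) z * h z) \<in> borel_measurable lborel"
      by (rule borel_measurable_integrable[OF integrable_ball_continuous[OF cont]])
    show "?s n \<in> borel_measurable lborel" for n by measurable
    show "integrable lborel (\<lambda>z. indicator (ball (0 :: complex) \<delta>) z * (\<Sum>n. norm (a n) * \<delta> ^ n))"
      using meas_ball by (intro integrable_mult_left integrable_real_indicator) auto
    show "AE z in lborel. (\<lambda>n. ?s n z) \<longlonglongrightarrow> indicator (ball 0 \<delta>) z * h z"
    proof (rule AE_I2)
      fix z :: complex
      show "(\<lambda>n. ?s n z) \<longlonglongrightarrow> indicator (ball 0 \<delta>) z * h z"
        using sums[of z] \<delta> by (cases "z \<in> ball 0 \<delta>") (auto simp: sums_def)
    qed
    show "AE z in lborel. norm (?s n z) \<le> indicator (ball 0 \<delta>) z * (\<Sum>n. norm (a n) * \<delta> ^ n)" for n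
    proof (rule AE_I2)
      fix z :: complex
      have "norm (\<Sum>k<n. a k * z ^ k) \<le> (\<Sum>n. norm (a n) * \<delta> ^ n)" if "norm z < \<delta>"
      proof -
        have "norm (\<Sum>k<n. a k * z ^ k) \<le> (\<Sum>k<n. norm (a k) * \<delta> ^ k)"
          using that by (intro sum_norm_le) (auto simp: norm_mult norm_power intro!: mult_left_mono power_mono)
        also have "\<dots> \<le> (\<Sum>n. norm (a n) * \<delta> ^ n)"
          using \<delta> by (intro sum_le_suminf[OF summ]) auto
        finally show ?thesis .
      qed
      then show "norm (?s n z) \<le> indicator (ball 0 \<delta>) z * (\<Sum>n. norm (a n) * \<delta> ^ n)"
        by (simp add: indicator_def norm_mult)
    qed
  qed
  moreover have "(\<lambda>n. LINT z|lborel. ?s n z) \<longlonglongrightarrow> a 0 * measure lborel (ball (0 :: complex) \<delta>)"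
    unfolding eq by (rule tendsto_eventually, rule eventually_mono[OF eventually_gt_at_top[of 0]]) simp
  ultimately show ?thesis
    using LIMSEQ_unique by (force simp: a_def mult.commute)
qed

lemma nn_integral_lborel_scale:
  fixes f :: "complex \<Rightarrow> ennreal"
  assumes [measurable]: "f \<in> borel_measurable borel" and "c > 0"
  shows "(\<integral>\<^sup>+ z. f z \<partial>lborel) = ennreal (c\<^sup>2) * (\<integral>\<^sup>+ z. f (c *\<^sub>R z) \<partial>lborel)"
  using assms(2)
  by (subst lborel_affine[of c 0])
     (simp_all add: nn_integral_density nn_integral_distr nn_integral_cmult)

lemma nn_integral_lborel_translate:
  fixes f :: "complex \<Rightarrow> ennreal"
  assumes [measurable]: "f \<in> borel_measurable borel"
  shows "(\<integral>\<^sup>+ z. f (w + z) \<partial>lborel) = (\<integral>\<^sup>+ z. f z \<partial>lborel)"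
  by (subst (2) lborel_affine[of 1 w])
     (simp_all add: nn_integral_density nn_integral_distr)

section \<open>The weighted area measure\<close>

lemma bergman_norm_eq: "bergman_norm p \<alpha> = Lp_norm (dA \<alpha>) p"
  by (simp add: fun_eq_iff bergman_norm_def Lp_norm_def)

lemma space_dA [simp]: "space (dA \<alpha>) = unit_disk"
  by (simp add: dA_def space_restrict_space)

lemma sets_dA: "sets (dA \<alpha>) = sets (restrict_space lborel unit_disk)"
  by (simp add: dA_def)

lemma borel_subset_sets_dA: "A \<in> sets borel \<Longrightarrow> A \<subseteq> unit_disk \<Longrightarrow> A \<in> sets (dA \<alpha>)"
  by (simp add: sets_dA sets_restrict_space_iff)

lemma borel_measurable_dA:
  assumes "g \<in> borel_measurable borel"
  shows "g \<in> borel_measurable (dA \<alpha>)"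
proof -
  have "g \<in> borel_measurable (restrict_space lborel unit_disk)"
    using assms by (intro measurable_restrict_space1) simp
  then show ?thesis by (simp add: dA_def)
qed

definition weight :: "real \<Rightarrow> complex \<Rightarrow> real" where
  "weight \<alpha> z = (1 + \<alpha>) * (1 - (norm z)\<^sup>2) powr \<alpha> / pi"

lemma weight_measurable [measurable]: "weight \<alpha> \<in> borel_measurable borel"
  unfolding weight_def by measurable

lemma nn_integral_dA:
  assumes [measurable]: "g \<in> borel_measurable borel"
  shows "(\<integral>\<^sup>+ z. g z \<partial>dA \<alpha>) =
    (\<integral>\<^sup>+ z. indicator unit_disk z * (ennreal (weight \<alpha> z) * g z) \<partial>lborel)"
proof -
  have "(\<integral>\<^sup>+ z. g z \<partial>dA \<alpha>) = (\<integral>\<^sup>+ z. ennreal (weight \<alpha> z) * g z \<partial>restrict_space lborel unit_disk)"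
    unfolding dA_def weight_def[symmetric]
    by (intro nn_integral_density measurable_restrict_space1) simp_all
  also have "\<dots> = (\<integral>\<^sup>+ z. (ennreal (weight \<alpha> z) * g z) * indicator unit_disk z \<partial>lborel)"
    by (subst nn_integral_restrict_space) simp_all
  finally show ?thesis by (simp add: mult.commute)
qed

text \<open>For \<alpha> \<ge> 0 the weight decreases radially. This bounds it from below on smaller
  disks and lets it absorb the substitution z / r for dilations.\<close>

lemma weight_mono:
  assumes "\<alpha> \<ge> 0" "norm z \<le> norm w" "norm w \<le> 1"
  shows "weight \<alpha> w \<le> weight \<alpha> z"
proof -
  have "(1 - (norm w)\<^sup>2) powr \<alpha> \<le> (1 - (norm z)\<^sup>2) powr \<alpha>"
    using assms by (intro powr_mono2) (auto simp: power_le_one intro: power_mono)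
  then show ?thesis unfolding weight_def using assms
    by (intro divide_right_mono mult_left_mono) auto
qed

lemma weight_pos:
  assumes "\<alpha> \<ge> 0" "norm z < 1"
  shows "weight \<alpha> z > 0"
proof -
  have "(norm z)\<^sup>2 < 1" using assms by (simp add: power_less_one_iff abs_square_less_1)
  then show ?thesis using assms unfolding weight_def by simp
qed

lemma finite_measure_dA:
  assumes "\<alpha> \<ge> 0"
  shows "finite_measure (dA \<alpha>)"
proof (rule finite_measureI)
  have "emeasure (dA \<alpha>) (space (dA \<alpha>)) = (\<integral>\<^sup>+ z. 1 \<partial>dA \<alpha>)" by simp
  also have "\<dots> = (\<integral>\<^sup>+ z. indicator unit_disk z * (ennreal (weight \<alpha> z) * 1) \<partial>lborel)"
    by (rule nn_integral_dA) simp
  also have "\<dots> \<le> (\<integral>\<^sup>+ z. ennreal (weight \<alpha> 0) * indicator unit_disk (z :: complex) \<partial>lborel)"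
    by (rule nn_integral_mono)
       (use weight_mono[OF assms, of 0] in \<open>auto simp: indicator_def intro: ennreal_leI\<close>)
  also have "\<dots> = ennreal (weight \<alpha> 0) * emeasure lborel unit_disk"
    by (simp add: nn_integral_cmult_indicator)
  also have "\<dots> < \<infinity>"
    using emeasure_lborel_ball_finite[of "0 :: complex" 1] by (simp add: ennreal_mult_less_top)
  finally show "emeasure (dA \<alpha>) (space (dA \<alpha>)) \<noteq> \<infinity>" by simp
qed

lemma bergmanD:
  assumes "f \<in> bergman p \<alpha>"
  shows "f holomorphic_on unit_disk" "\<And>z. z \<notin> unit_disk \<Longrightarrow> f z = 0"
    "integrable (dA \<alpha>) (\<lambda>z. norm (f z) powr p)"
  using assms by (auto simp: bergman_def)

lemma holomorphic_disk_measurable: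
  assumes "f holomorphic_on unit_disk" "\<And>z. z \<notin> unit_disk \<Longrightarrow> f z = 0"
  shows "f \<in> borel_measurable borel"
proof -
  have "(\<lambda>z. indicator unit_disk z *\<^sub>R f z) \<in> borel_measurable borel"
    using holomorphic_on_imp_continuous_on[OF assms(1)]
    by (intro borel_measurable_continuous_on_indicator) simp_all
  moreover have "(\<lambda>z. indicator unit_disk z *\<^sub>R f z) = f"
    using assms(2) by (auto simp: indicator_def fun_eq_iff)
  ultimately show ?thesis by simp
qed

lemma bergman_measurable: "f \<in> bergman p \<alpha> \<Longrightarrow> f \<in> borel_measurable borel"
  by (rule holomorphic_disk_measurable[OF bergmanD(1,2)])

lemma bergman_Lp: "f \<in> bergman p \<alpha> \<Longrightarrow> f \<in> Lp_space (dA \<alpha>) p"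
  unfolding Lp_space_def by (simp add: bergmanD(3) borel_measurable_dA[OF bergman_measurable])

lemma bergmanI:
  assumes "f holomorphic_on unit_disk" "\<And>z. z \<notin> unit_disk \<Longrightarrow> f z = 0" "f \<in> Lp_space (dA \<alpha>) p"
  shows "f \<in> bergman p \<alpha>"
  using assms by (auto simp: bergman_def Lp_space_def)

lemma Lp_space_iff_nn_integral:
  assumes "f \<in> borel_measurable M"
  shows "f \<in> Lp_space M p \<longleftrightarrow> (\<integral>\<^sup>+ z. ennreal (norm (f z) powr p) \<partial>M) < \<infinity>"
proof -
  have "(\<lambda>z. norm (f z) powr p) \<in> borel_measurable M" using assms by measurable
  then show ?thesis using assms by (simp add: Lp_space_def integrable_iff_bounded)
qed

lemma Lp_norm_nn_integral:
  assumes "p > 0" "f \<in> Lp_space M p"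
  shows "(\<integral>\<^sup>+ z. ennreal (norm (f z) powr p) \<partial>M) = ennreal (Lp_norm M p f powr p)"
  unfolding Lp_norm_powr[OF assms(1)]
  by (rule nn_integral_eq_integral[OF Lp_spaceD(2)[OF assms(2)]]) simp

lemma Lp_norm_leI:
  assumes "p > 0" "f \<in> borel_measurable M" "C \<ge> 0"
    and "(\<integral>\<^sup>+ z. ennreal (norm (f z) powr p) \<partial>M) \<le> ennreal (C powr p)"
  shows "f \<in> Lp_space M p" "Lp_norm M p f \<le> C"
proof -
  show *: "f \<in> Lp_space M p"
    unfolding Lp_space_iff_nn_integral[OF assms(2)] using assms(4) by (rule le_less_trans) simp
  have "Lp_norm M p f powr p \<le> C powr p"
    using assms(4) unfolding Lp_norm_nn_integral[OF assms(1) *] by (simp add: ennreal_le_iff)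
  then show "Lp_norm M p f \<le> C"
    unfolding Lp_norm_powr[OF assms(1)] Lp_norm_le_iff[OF assms(1,3)] .
qed

section \<open>Point evaluations\<close>

lemma bergman_scale: "f \<in> bergman p \<alpha> \<Longrightarrow> (\<lambda>z. c * f z) \<in> bergman p \<alpha>"
  by (rule bergmanI[OF _ _ Lp_scale[OF bergman_Lp]])
     (auto simp: bergmanD(2) intro: holomorphic_intros bergmanD(1))

text \<open>The mean value over a disk of radius \<delta> about w bounds \<open>f w\<close> by an
  area integral, and that disk stays where the weight is at least c.\<close>

lemma bergman_unit_ball_eval_bound:
  assumes "p > 1" "\<alpha> \<ge> 0" "0 \<le> r" "r < 1"
  shows "\<exists>C>0. \<forall>f\<in>bergman p \<alpha>. \<forall>z. bergman_norm p \<alpha> f \<le> 1 \<longrightarrow> norm z \<le> r \<longrightarrow> norm (f z) \<le> C"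
proof -
  define \<delta> where "\<delta> = (1 - r) / 2"
  \<comment> \<open>The weight at radius (1 + r) / 2 = r + \<delta>, the largest modulus that the
    disks about w can reach.\<close>
  define c where "c = weight \<alpha> (of_real ((1 + r) / 2))"
  define m where "m = measure lborel (ball (0 :: complex) \<delta>)"
  have \<delta>: "\<delta> > 0" "\<delta> < 1 - r" using assms by (auto simp: \<delta>_def)
  have c: "c > 0" unfolding c_def
    by (rule weight_pos[OF assms(2)]) (use assms in \<open>simp only: norm_of_real, simp\<close>)
  have em: "emeasure lborel (ball (0 :: complex) \<delta>) = ennreal m"
    using emeasure_lborel_ball_finite[of "0 :: complex" \<delta>] by (simp add: m_def emeasure_eq_ennreal_measure)
  have m: "m > 0"
    unfolding m_def using content_ball_pos[of \<delta> "0 :: complex"] \<delta> by simp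
  have main: "norm (f w) * m \<le> m + 1 / c"
    if f: "f \<in> bergman p \<alpha>" "bergman_norm p \<alpha> f \<le> 1" and w: "norm w \<le> r" for f w
  proof -
    note [measurable] = bergman_measurable[OF f(1)]
    have sub: "ball w (1 - r) \<subseteq> unit_disk"
    proof
      fix z assume "z \<in> ball w (1 - r)"
      then have "norm (z - w) < 1 - r" by (simp add: dist_norm norm_minus_commute)
      then show "z \<in> unit_disk" using w norm_triangle_sub[of z w] by simp
    qed
    have hol: "(\<lambda>\<zeta>. f (w + \<zeta>)) holomorphic_on ball 0 (1 - r)"
    proof -
      have "(f \<circ> (\<lambda>\<zeta>. w + \<zeta>)) holomorphic_on ball 0 (1 - r)"
      proof (rule holomorphic_on_compose_gen[OF _ bergmanD(1)[OF f(1)]])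
        show "(\<lambda>\<zeta>. w + \<zeta>) ` ball 0 (1 - r) \<subseteq> unit_disk"
          using sub by (auto simp: dist_norm subset_iff)
      qed (intro holomorphic_intros)
      then show ?thesis by (simp add: o_def)
    qed
    have [measurable]: "ball (0 :: complex) \<delta> \<in> sets borel" "unit_disk \<in> sets borel" by simp_all
    define G where "G z = indicator (ball 0 \<delta>) z * f (w + z)" for z
    have [measurable]: "G \<in> borel_measurable borel" unfolding G_def by measurable
    have "integrable lborel G" unfolding G_def
    proof (rule integrable_ball_continuous)
      show "continuous_on (cball 0 \<delta>) (\<lambda>\<zeta>. f (w + \<zeta>))"
        by (rule continuous_on_subset[OF holomorphic_on_imp_continuous_on[OF hol]]) (use \<delta> in auto)
    qed
    then have "ennreal (norm (LINT z|lborel. G z)) \<le> (\<integral>\<^sup>+ z. norm (G z) \<partial>lborel)"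
      by (rule integral_norm_bound_ennreal)
    moreover have "(LINT z|lborel. G z) = m * f w"
      using mean_value_ball[OF hol \<delta>] by (simp add: G_def m_def)
    ultimately have "ennreal (norm (f w) * m) \<le> (\<integral>\<^sup>+ z. norm (G z) \<partial>lborel)"
      using m by (simp add: norm_mult mult.commute)
    also have "\<dots> \<le> (\<integral>\<^sup>+ z. indicator (ball 0 \<delta>) z + ennreal (1 / c) *
        (indicator unit_disk (w + z) * (ennreal (weight \<alpha> (w + z)) * ennreal (norm (f (w + z)) powr p))) \<partial>lborel)"
    proof (rule nn_integral_mono)
      fix z :: complex
      show "ennreal (norm (G z)) \<le> indicator (ball 0 \<delta>) z + ennreal (1 / c) *
        (indicator unit_disk (w + z) * (ennreal (weight \<alpha> (w + z)) * ennreal (norm (f (w + z)) powr p)))"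
      proof (cases "z \<in> ball 0 \<delta>")
        case True
        then have nz: "norm (w + z) \<le> (1 + r) / 2"
          using w norm_triangle_ineq[of w z] by (simp add: \<delta>_def field_simps)
        then have in_disk: "w + z \<in> unit_disk" using assms by simp
        have "c \<le> weight \<alpha> (w + z)"
          unfolding c_def by (rule weight_mono[OF assms(2)])
            (use nz assms in \<open>simp_all only: norm_of_real, simp_all\<close>)
        then have 1: "1 \<le> 1 / c * weight \<alpha> (w + z)" using c by simp
        \<comment> \<open>x <= 1 + x^p replaces Hoelder's inequality. The resulting bound is not
          homogeneous, hence the restriction to the unit ball.\<close>
        have "norm (f (w + z)) \<le> 1 + norm (f (w + z)) powr p"
        proof (cases "norm (f (w + z)) \<le> 1")
          case False
          then have "norm (f (w + z)) powr 1 \<le> norm (f (w + z)) powr p"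
            using assms by (intro powr_mono) auto
          with False show ?thesis by simp
        qed (simp add: add_increasing2)
        also have "norm (f (w + z)) powr p \<le> 1 / c * weight \<alpha> (w + z) * norm (f (w + z)) powr p"
          using mult_right_mono[OF 1, of "norm (f (w + z)) powr p"] by simp
        finally have "ennreal (norm (f (w + z))) \<le>
            ennreal (1 + 1 / c * (weight \<alpha> (w + z) * norm (f (w + z)) powr p))"
          by (intro ennreal_leI) (simp add: mult.assoc)
        then show ?thesis
          using True in_disk c weight_pos[OF assms(2), of "w + z"]
          by (simp add: G_def ennreal_mult' ennreal_plus[symmetric] del: ennreal_plus)
             (simp add: ennreal_mult'[symmetric] ennreal_plus[symmetric] ennreal_1[symmetric] del: ennreal_plus ennreal_1)
      qed (simp add: G_def)
    qed
    also have "\<dots> = ennreal m + ennreal (1 / c) * (\<integral>\<^sup>+ z.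
        indicator unit_disk (w + z) * (ennreal (weight \<alpha> (w + z)) * ennreal (norm (f (w + z)) powr p)) \<partial>lborel)"
      by (subst nn_integral_add) (simp_all add: nn_integral_cmult em)
    also have "(\<integral>\<^sup>+ z. indicator unit_disk (w + z) * (ennreal (weight \<alpha> (w + z)) * ennreal (norm (f (w + z)) powr p)) \<partial>lborel)
        = (\<integral>\<^sup>+ z. indicator unit_disk z * (ennreal (weight \<alpha> z) * ennreal (norm (f z) powr p)) \<partial>lborel)"
      by (rule nn_integral_lborel_translate) measurable
    also have "\<dots> = (\<integral>\<^sup>+ z. ennreal (norm (f z) powr p) \<partial>dA \<alpha>)"
      by (rule nn_integral_dA[symmetric]) measurable
    also have "\<dots> = ennreal (bergman_norm p \<alpha> f powr p)"
      using Lp_norm_nn_integral[OF _ bergman_Lp[OF f(1)]] assms(1) by (simp add: bergman_norm_eq)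
    also have "bergman_norm p \<alpha> f powr p \<le> 1"
      using f(2) assms(1) by (intro powr_le1) (auto simp: bergman_norm_eq)
    finally have "ennreal (norm (f w) * m) \<le> ennreal m + ennreal (1 / c) * ennreal 1"
      by (simp add: mult_left_mono add_left_mono ennreal_leI)
    also have "\<dots> = ennreal (m + 1 / c)"
      using m c by (simp add: ennreal_plus)
    finally show ?thesis using m c by (subst (asm) ennreal_le_iff) auto
  qed
  show ?thesis
  proof (intro exI[of _ "(m + 1 / c) / m"] conjI ballI allI impI)
    show "(m + 1 / c) / m > 0" using m c by (simp add: add_pos_pos)
    show "norm (f z) \<le> (m + 1 / c) / m"
      if "f \<in> bergman p \<alpha>" "bergman_norm p \<alpha> f \<le> 1" "norm z \<le> r" for f z
      using main[OF that] m by (simp add: le_divide_eq)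
  qed
qed

text \<open>Homogeneity is recovered by scaling f into the unit ball.\<close>

lemma bergman_eval_bound:
  assumes "p > 1" "\<alpha> \<ge> 0" "0 \<le> r" "r < 1"
  shows "\<exists>C>0. \<forall>f\<in>bergman p \<alpha>. \<forall>z. norm z \<le> r \<longrightarrow> norm (f z) \<le> C * bergman_norm p \<alpha> f"
proof -
  obtain C where "C > 0"
    and bound: "\<forall>f\<in>bergman p \<alpha>. \<forall>z. bergman_norm p \<alpha> f \<le> 1 \<longrightarrow> norm z \<le> r \<longrightarrow> norm (f z) \<le> C"
    using bergman_unit_ball_eval_bound[OF assms] by (elim exE conjE)
  have C: "C > 0" "norm (f z) \<le> C"
    if "f \<in> bergman p \<alpha>" "bergman_norm p \<alpha> f \<le> 1" "norm z \<le> r" for f z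
    using \<open>C > 0\<close> bspec[OF bound that(1)] that(2,3) by simp_all
  have "norm (f z) \<le> C * bergman_norm p \<alpha> f" if f: "f \<in> bergman p \<alpha>" and z: "norm z \<le> r" for f z
  proof (rule field_le_epsilon)
    fix e :: real assume "e > 0"
    \<comment> \<open>The extra e / C keeps b positive for functions of norm 0 and costs exactly e
      after multiplication by C.\<close>
    define b where "b = bergman_norm p \<alpha> f + e / C"
    have b: "b > 0" "bergman_norm p \<alpha> f \<le> b"
      using \<open>e > 0\<close> \<open>C > 0\<close> by (auto simp: b_def bergman_norm_eq add_nonneg_pos)
    have nb: "norm (complex_of_real (1 / b)) = 1 / b" using b by (simp add: norm_divide)
    have "norm (complex_of_real (1 / b) * f z) \<le> C"
    proof (rule C(2)[OF bergman_scale[OF f] _ z])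
      have "bergman_norm p \<alpha> (\<lambda>z. complex_of_real (1 / b) * f z) = 1 / b * bergman_norm p \<alpha> f"
        unfolding bergman_norm_eq using assms(1) nb by (subst Lp_norm_scale) auto
      then show "bergman_norm p \<alpha> (\<lambda>z. complex_of_real (1 / b) * f z) \<le> 1"
        using b by simp
    qed
    then have "1 / b * norm (f z) \<le> C" unfolding norm_mult nb .
    then have "norm (f z) \<le> C * b" using b by (simp add: divide_le_eq)
    then show "norm (f z) \<le> C * bergman_norm p \<alpha> f + e"
      using \<open>C > 0\<close> by (simp add: b_def distrib_left)
  qed
  then show ?thesis using \<open>C > 0\<close> by (intro exI[of _ C] conjI ballI allI impI)
qed

section \<open>Dilations\<close>

definition dilate :: "real \<Rightarrow> (complex \<Rightarrow> complex) \<Rightarrow> complex \<Rightarrow> complex" where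
  "dilate r f = (\<lambda>z. if z \<in> unit_disk then f (of_real r * z) else 0)"

text \<open>Dominated convergence along radii that start at \<rho>0 and increase to 1; the
  complements of the balls shrink to the empty set within the disk.\<close>

lemma Lp_norm_tail:
  assumes p: "p > 0" and f: "f \<in> Lp_space (dA \<alpha>) p" and "e > 0" "\<rho>0 < 1"
  shows "\<exists>\<rho>. \<rho>0 \<le> \<rho> \<and> \<rho> < 1 \<and> Lp_norm (dA \<alpha>) p (\<lambda>z. indicator (unit_disk - ball 0 \<rho>) z * f z) \<le> e"
proof -
  define \<rho> where "\<rho> n = 1 - (1 - \<rho>0) / real (Suc n)" for n
  have \<rho>: "\<rho>0 \<le> \<rho> n" "\<rho> n < 1" for n
  proof -
    have "(1 - \<rho>0) / real (Suc n) \<le> (1 - \<rho>0) / 1"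
      using assms(4) by (intro divide_left_mono) auto
    then show "\<rho>0 \<le> \<rho> n" "\<rho> n < 1" using assms(4) by (simp_all add: \<rho>_def)
  qed
  have lim: "\<rho> \<longlonglongrightarrow> 1"
  proof -
    have "(\<lambda>n. 1 - (1 - \<rho>0) * (1 / real (Suc n))) \<longlonglongrightarrow> 1 - (1 - \<rho>0) * 0"
      by (intro tendsto_diff tendsto_mult tendsto_const) (rule LIMSEQ_Suc[OF lim_1_over_n])
    then show ?thesis by (simp add: \<rho>_def[abs_def])
  qed
  have sets: "unit_disk - ball 0 (\<rho> n) \<in> sets (dA \<alpha>)" for n
    by (rule borel_subset_sets_dA) auto
  let ?g = "\<lambda>n z. norm (indicator (unit_disk - ball 0 (\<rho> n)) z * f z) powr p"
  have g_le: "?g n z \<le> norm (f z) powr p" for n z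
    by (simp add: indicator_def)
  have "(\<lambda>n. LINT z|dA \<alpha>. ?g n z) \<longlonglongrightarrow> (LINT z|dA \<alpha>. 0)"
  proof (rule integral_dominated_convergence[OF _ _ Lp_spaceD(2)[OF f]])
    show "?g n \<in> borel_measurable (dA \<alpha>)" for n
      by (rule borel_measurable_integrable[OF Lp_spaceD(2)[OF Lp_indicator(1)[OF p f sets]]])
    show "AE z in dA \<alpha>. (\<lambda>n. ?g n z) \<longlonglongrightarrow> 0"
    proof (rule AE_I2)
      fix z assume "z \<in> space (dA \<alpha>)"
      then have "norm z < 1" by simp
      from order_tendstoD(1)[OF lim this]
      have "\<forall>\<^sub>F n in sequentially. ?g n z = 0"
        by eventually_elim (simp add: indicator_def)
      then show "(\<lambda>n. ?g n z) \<longlonglongrightarrow> 0" by (rule tendsto_eventually)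
    qed
    show "AE z in dA \<alpha>. norm (?g n z) \<le> norm (f z) powr p" for n
      using g_le by simp
  qed simp
  then have "\<forall>\<^sub>F n in sequentially. (LINT z|dA \<alpha>. ?g n z) < e powr p"
    by (rule order_tendstoD) (use \<open>e > 0\<close> in simp)
  then obtain n where "(LINT z|dA \<alpha>. ?g n z) < e powr p"
    unfolding eventually_sequentially by blast
  then have "Lp_norm (dA \<alpha>) p (\<lambda>z. indicator (unit_disk - ball 0 (\<rho> n)) z * f z) \<le> e"
    using p \<open>e > 0\<close> by (subst Lp_norm_le_iff) auto
  then show ?thesis using \<rho> by blast
qed

locale bergman_setting =
  fixes p \<alpha> :: real
  assumes p: "p > 1" and \<alpha>: "\<alpha> \<ge> 0"
begin

abbreviation A where "A \<equiv> bergman p \<alpha>"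
abbreviation N where "N \<equiv> bergman_norm p \<alpha>"
abbreviation M where "M \<equiv> dA \<alpha>"

lemma p_pos: "p > 0" and p_ge: "p \<ge> 1" using p by auto

lemma N_nonneg: "0 \<le> N f" by (simp add: bergman_norm_eq)

lemma zero_bergman: "(\<lambda>_. 0) \<in> A"
  by (rule bergmanI[OF _ _ Lp_zero(1)]) auto

lemma add_bergman:
  assumes "f \<in> A" "g \<in> A"
  shows "(\<lambda>z. f z + g z) \<in> A"
  by (rule bergmanI[OF holomorphic_on_add[OF bergmanD(1)[OF assms(1)] bergmanD(1)[OF assms(2)]]
        _ Minkowski(1)[OF p_ge bergman_Lp[OF assms(1)] bergman_Lp[OF assms(2)]]])
     (simp add: bergmanD(2)[OF assms(1)] bergmanD(2)[OF assms(2)])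

lemma evaluation_space_bergman: "evaluation_space A N"
proof
  show "(\<lambda>_. 0) \<in> A" by (rule zero_bergman)
  show "(\<lambda>z. a * f z + b * g z) \<in> A" if "f \<in> A" "g \<in> A" for f g a b
    by (rule add_bergman[OF bergman_scale[OF that(1)] bergman_scale[OF that(2)]])
  show "0 \<le> N f" for f by (rule N_nonneg)
  show "N (\<lambda>z. f z + g z) \<le> N f + N g" if "f \<in> A" "g \<in> A" for f g
    unfolding bergman_norm_eq by (rule Minkowski(2)[OF p_ge bergman_Lp[OF that(1)] bergman_Lp[OF that(2)]])
  show "N (\<lambda>z. c * f z) = norm c * N f" for f c
    unfolding bergman_norm_eq by (rule Lp_norm_scale[OF p_pos])
  show "\<exists>C. \<forall>f\<in>A. norm (f z) \<le> C * N f" for z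
  proof (cases "z \<in> unit_disk")
    case True
    then have "norm z < 1" by simp
    then obtain C where C: "\<forall>f\<in>A. \<forall>w. norm w \<le> norm z \<longrightarrow> norm (f w) \<le> C * N f"
      using bergman_eval_bound[OF p \<alpha> norm_ge_zero] by blast
    have "\<forall>f\<in>A. norm (f z) \<le> C * N f"
    proof
      fix f assume "f \<in> A"
      then show "norm (f z) \<le> C * N f" using bspec[OF C] by simp
    qed
    then show ?thesis ..
  next
    case False
    have "\<forall>f\<in>A. norm (f z) \<le> 0 * N f" by (simp add: bergmanD(2)[OF _ False])
    then show ?thesis ..
  qed
qed

sublocale evaluation_space A N by (rule evaluation_space_bergman)

sublocale M: finite_measure M by (rule finite_measure_dA[OF \<alpha>])

lemma eval_bound_disk:
  assumes "0 \<le> r" "r < 1"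
  obtains C where "C > 0" "\<forall>f\<in>A. \<forall>z. norm z \<le> r \<longrightarrow> norm (f z) \<le> C * N f"
  using bergman_eval_bound[OF p \<alpha> assms] by (elim exE conjE)

text \<open>The L^p norm of the constant 1, hence the factor between sup norms and L^p
  norms.\<close>

definition \<mu> where "\<mu> = measure M (space M) powr (1 / p)"

lemma \<mu>_nonneg: "0 \<le> \<mu>" by (simp add: \<mu>_def)

lemma N_bounded:
  assumes "f \<in> borel_measurable M" "\<And>z. z \<in> unit_disk \<Longrightarrow> norm (f z) \<le> C" "C \<ge> 0"
  shows "f \<in> Lp_space M p" "Lp_norm M p f \<le> C * \<mu>"
proof -
  have "unit_disk \<in> sets M" by (rule borel_subset_sets_dA) auto
  then show "f \<in> Lp_space M p" "Lp_norm M p f \<le> C * \<mu>"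
    using M.Lp_bounded[OF p_pos assms(1), of C "space M"] assms(2,3) unfolding \<mu>_def by auto
qed

lemma bounded_bergman:
  assumes "f holomorphic_on unit_disk" "\<And>z. z \<notin> unit_disk \<Longrightarrow> f z = 0"
    and "\<And>z. z \<in> unit_disk \<Longrightarrow> norm (f z) \<le> C" "C \<ge> 0"
  shows "f \<in> A" "N f \<le> C * \<mu>"
proof -
  note b = N_bounded[OF borel_measurable_dA[OF holomorphic_disk_measurable[OF assms(1,2)]] assms(3,4)]
  show "f \<in> A" by (rule bergmanI[OF assms(1,2) b(1)])
  show "N f \<le> C * \<mu>" unfolding bergman_norm_eq by (rule b(2))
qed

lemma compact_in_disk:
  assumes "compact (Q :: complex set)" "Q \<subseteq> unit_disk"
  obtains r where "0 \<le> r" "r < 1" "Q \<subseteq> cball 0 r"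
proof (cases "Q = {}")
  case True
  then show ?thesis using that[of 0] by simp
next
  case False
  have "continuous_on Q norm" by (intro continuous_intros)
  then obtain x where x: "x \<in> Q" "\<forall>y\<in>Q. norm y \<le> norm x"
    using continuous_attains_sup[OF assms(1) False] by blast
  then have "norm x < 1" "Q \<subseteq> cball 0 (norm x)" using assms(2) by auto
  then show ?thesis using that[of "norm x"] by simp
qed

lemma dilate_holomorphic:
  assumes "g holomorphic_on unit_disk" "0 \<le> r" "r \<le> 1"
  shows "dilate r g holomorphic_on unit_disk"
proof -
  have "(g \<circ> (\<lambda>z. of_real r * z)) holomorphic_on unit_disk"
  proof (rule holomorphic_on_compose_gen[OF _ assms(1)])
    have "r * norm z < 1" if "norm z < 1" for z :: complex
      using mult_right_mono[OF assms(3) norm_ge_zero, of z] that by linarith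
    then show "(\<lambda>z. of_real r * z) ` unit_disk \<subseteq> unit_disk"
      using assms(2) by (auto simp: norm_mult)
  qed (intro holomorphic_intros)
  then show ?thesis
    by (rule holomorphic_transform) (simp add: dilate_def)
qed

text \<open>Substituting z / r costs the Jacobian r^(-2) <= 4, and the weight only decreases at the
  larger modulus.\<close>

lemma dilate_bergman:
  assumes f: "f \<in> A" and r: "1 / 2 \<le> r" "r < 1"
  shows "dilate r f \<in> A" "N (dilate r f) \<le> 4 * N f"
proof -
  have hol: "dilate r f holomorphic_on unit_disk"
    by (rule dilate_holomorphic[OF bergmanD(1)[OF f]]) (use r in auto)
  have zero: "dilate r f z = 0" if "z \<notin> unit_disk" for z using that by (simp add: dilate_def)
  note [measurable] = bergman_measurable[OF f] holomorphic_disk_measurable[OF hol zero]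
  have [measurable]: "unit_disk \<in> sets borel" by simp
  define g where "g z = indicator unit_disk z * (ennreal (weight \<alpha> z) * ennreal (norm (dilate r f z) powr p))" for z
  have [measurable]: "g \<in> borel_measurable borel" unfolding g_def by measurable
  have "(\<integral>\<^sup>+ z. ennreal (norm (dilate r f z) powr p) \<partial>M) = (\<integral>\<^sup>+ z. g z \<partial>lborel)"
    unfolding g_def by (rule nn_integral_dA) measurable
  also have "\<dots> = ennreal ((1 / r)\<^sup>2) * (\<integral>\<^sup>+ z. g ((1 / r) *\<^sub>R z) \<partial>lborel)"
    by (rule nn_integral_lborel_scale) (use r in simp_all)
  also have "\<dots> \<le> ennreal 4 * (\<integral>\<^sup>+ z. indicator unit_disk z * (ennreal (weight \<alpha> z) * ennreal (norm (f z) powr p)) \<partial>lborel)"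
  proof (rule mult_mono)
    have "1 / r \<le> 2" using r by (simp add: divide_le_eq)
    then have "(1 / r)\<^sup>2 \<le> 2\<^sup>2" using r by (intro power_mono) auto
    then show "ennreal ((1 / r)\<^sup>2) \<le> ennreal 4" by (intro ennreal_leI) simp
    show "(\<integral>\<^sup>+ z. g ((1 / r) *\<^sub>R z) \<partial>lborel) \<le>
        (\<integral>\<^sup>+ z. indicator unit_disk z * (ennreal (weight \<alpha> z) * ennreal (norm (f z) powr p)) \<partial>lborel)"
    proof (rule nn_integral_mono)
      fix z :: complex
      show "g ((1 / r) *\<^sub>R z) \<le> indicator unit_disk z * (ennreal (weight \<alpha> z) * ennreal (norm (f z) powr p))"
      proof (cases "(1 / r) *\<^sub>R z \<in> unit_disk")
        case True
        then have "norm z < r" using r by (simp add: divide_less_eq)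
        then have z: "z \<in> unit_disk" using r by simp
        have "norm z * r \<le> norm z" using r by (simp add: mult_left_le)
        then have "norm z \<le> norm ((1 / r) *\<^sub>R z)" using r by (simp add: le_divide_eq)
        then have "weight \<alpha> ((1 / r) *\<^sub>R z) \<le> weight \<alpha> z"
          by (rule weight_mono[OF \<alpha>]) (use True in simp)
        moreover have "dilate r f ((1 / r) *\<^sub>R z) = f z"
        proof -
          have "of_real r * ((1 / r) *\<^sub>R z) = z" using r by (simp add: scaleR_conv_of_real)
          then show ?thesis using True by (simp only: dilate_def if_True)
        qed
        ultimately show ?thesis using True z by (simp add: g_def mult_right_mono ennreal_leI)
      qed (simp add: g_def)
    qed
  qed auto
  also have "\<dots> = ennreal 4 * (\<integral>\<^sup>+ z. ennreal (norm (f z) powr p) \<partial>M)"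
    by (subst nn_integral_dA) simp_all
  also have "\<dots> = ennreal (4 * N f powr p)"
    unfolding Lp_norm_nn_integral[OF p_pos bergman_Lp[OF f]] bergman_norm_eq
    by (rule ennreal_mult'[symmetric]) simp
  also have "\<dots> \<le> ennreal ((4 * N f) powr p)"
  proof (rule ennreal_leI)
    \<comment> \<open>Since p \<ge> 1, the factor 4 in front of the integral of p-th powers is at
      most 4^p, which becomes the factor 4 for the norm.\<close>
    have "(4 :: real) powr 1 \<le> 4 powr p" using p_ge by (intro powr_mono) auto
    then show "4 * N f powr p \<le> (4 * N f) powr p"
      using N_nonneg[of f] by (simp add: powr_mult mult_right_mono)
  qed
  finally have le: "(\<integral>\<^sup>+ z. ennreal (norm (dilate r f z) powr p) \<partial>M) \<le> ennreal ((4 * N f) powr p)" .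
  have n: "0 \<le> 4 * N f" using N_nonneg[of f] by simp
  note L = Lp_norm_leI[OF p_pos borel_measurable_dA[OF holomorphic_disk_measurable[OF hol zero]] n le]
  show "dilate r f \<in> A" by (rule bergmanI[OF hol zero L(1)])
  show "N (dilate r f) \<le> 4 * N f" unfolding bergman_norm_eq using L(2) by (simp add: bergman_norm_eq)
qed

text \<open>A dilate depends only on values on the compact disk \<open>cball 0 r\<close>. Montel's
  theorem gives uniform convergence there along a subsequence, so the dilates converge uniformly on
  the whole unit disk.\<close>

lemma dilate_compact:
  assumes r: "1 / 2 \<le> r" "r < 1"
  shows "dilate r \<in> compact_ops A N"
  unfolding compact_ops_def mem_Collect_eq
proof (intro conjI allI impI)
  show "dilate r \<in> bounded_ops A N"
  proof (rule bounded_opsI[where C = 4])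
    show "dilate r f \<in> A" "N (dilate r f) \<le> 4 * N f" if "f \<in> A" for f
      by (rule dilate_bergman[OF that r])+
  qed (auto simp: dilate_def)
  fix F :: "nat \<Rightarrow> complex \<Rightarrow> complex" assume F: "\<forall>n. F n \<in> A \<and> N (F n) \<le> 1"
  have bdd: "\<exists>C. \<forall>h\<in>{f \<in> A. N f \<le> 1}. \<forall>z\<in>Q. norm (h z) \<le> C"
    if Q: "compact Q" "Q \<subseteq> unit_disk" for Q
  proof -
    obtain \<rho> where \<rho>: "0 \<le> \<rho>" "\<rho> < 1" "Q \<subseteq> cball 0 \<rho>" by (rule compact_in_disk[OF Q])
    obtain C where C: "C > 0" "\<forall>f\<in>A. \<forall>z. norm z \<le> \<rho> \<longrightarrow> norm (f z) \<le> C * N f"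
      by (rule eval_bound_disk[OF \<rho>(1,2)])
    have "norm (h z) \<le> C" if h: "h \<in> A" "N h \<le> 1" and z: "z \<in> Q" for h z
    proof -
      have "norm (h z) \<le> C * N h" using bspec[OF C(2) h(1)] z \<rho>(3) by auto
      also have "\<dots> \<le> C * 1" using C(1) h(2) by (intro mult_left_mono) auto
      finally show ?thesis by simp
    qed
    then show ?thesis by (intro exI[of _ C] ballI) simp
  qed
  obtain g and q :: "nat \<Rightarrow> nat" where g: "g holomorphic_on unit_disk" and q: "strict_mono q"
    and unif: "\<And>Q. compact Q \<Longrightarrow> Q \<subseteq> unit_disk \<Longrightarrow> uniform_limit Q (F \<circ> q) g sequentially"
  proof (rule Montel[of unit_disk "{f \<in> A. N f \<le> 1}" F])
    show "h holomorphic_on unit_disk" if "h \<in> {f \<in> A. N f \<le> 1}" for h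
      using bergmanD(1) that by blast
    show "range F \<subseteq> {f \<in> A. N f \<le> 1}" using F by blast
  next
    fix g and q :: "nat \<Rightarrow> nat"
    assume "g holomorphic_on unit_disk" "strict_mono q"
      "\<And>Q. compact Q \<Longrightarrow> Q \<subseteq> unit_disk \<Longrightarrow> uniform_limit Q (F \<circ> q) g sequentially"
    then show thesis by (rule that)
  qed (simp, rule bdd)
  have sub: "cball 0 r \<subseteq> (unit_disk :: complex set)" using r by auto
  have in_cball: "of_real r * z \<in> cball 0 r" if "z \<in> unit_disk" for z :: complex
    using that r by (simp add: norm_mult mult_left_le)
  define G where "G = dilate r g"
  have G_hol: "G holomorphic_on unit_disk"
    unfolding G_def by (rule dilate_holomorphic[OF g]) (use r in auto)
  have G_zero: "G z = 0" if "z \<notin> unit_disk" for z using that by (simp add: G_def dilate_def)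
  have "bounded (g ` cball 0 r)"
    by (intro compact_imp_bounded compact_continuous_image continuous_on_subset[OF holomorphic_on_imp_continuous_on[OF g] sub]) simp
  then obtain C where C: "\<forall>w\<in>cball 0 r. norm (g w) \<le> C" by (auto simp: bounded_iff)
  have GA: "G \<in> A"
  proof (rule bounded_bergman(1)[OF G_hol G_zero])
    show "norm (G z) \<le> max C 0" if "z \<in> unit_disk" for z
    proof -
      have "norm (G z) \<le> C" using bspec[OF C in_cball[OF that]] that by (simp add: G_def dilate_def)
      then show ?thesis by simp
    qed
  qed simp_all
  have "(\<lambda>n. N (\<lambda>z. dilate r (F (q n)) z - G z)) \<longlonglongrightarrow> 0"
  proof (rule order_tendstoI)
    fix e :: real assume "0 < e"
    \<comment> \<open>Adding 1 avoids division by 0 and makes \<open>d * \<mu>\<close> strictly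
      smaller than e.\<close>
    define d where "d = e / (\<mu> + 1)"
    have d: "d > 0" "d * \<mu> < e"
      using \<open>e > 0\<close> \<mu>_nonneg by (auto simp: d_def divide_less_eq mult.commute)
    from uniform_limitD[OF unif[OF _ sub] d(1)]
    have "\<forall>\<^sub>F n in sequentially. \<forall>w\<in>cball 0 r. dist ((F \<circ> q) n w) (g w) < d" by simp
    then show "\<forall>\<^sub>F n in sequentially. N (\<lambda>z. dilate r (F (q n)) z - G z) < e"
    proof eventually_elim
      case (elim n)
      have FA: "F (q n) \<in> A" using F by simp
      have D: "dilate r (F (q n)) \<in> A" by (rule dilate_bergman(1)[OF FA r])
      have "N (\<lambda>z. dilate r (F (q n)) z - G z) \<le> d * \<mu>"
      proof (rule bounded_bergman(2))
        show "(\<lambda>z. dilate r (F (q n)) z - G z) holomorphic_on unit_disk"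
          by (rule holomorphic_on_diff[OF bergmanD(1)[OF D] G_hol])
        show "dilate r (F (q n)) z - G z = 0" if "z \<notin> unit_disk" for z
          using that by (simp add: G_zero dilate_def)
        show "norm (dilate r (F (q n)) z - G z) \<le> d" if "z \<in> unit_disk" for z
        proof -
          have "dist ((F \<circ> q) n (of_real r * z)) (g (of_real r * z)) < d"
            by (rule bspec[OF elim in_cball[OF that]])
          then show ?thesis using that by (simp add: G_def dilate_def dist_norm)
        qed
      qed (use d in simp)
      then show ?case using d(2) by simp
    qed
  qed (auto intro!: always_eventually less_le_trans[OF _ N_nonneg])
  then show "\<exists>g\<in>A. \<exists>r'::nat \<Rightarrow> nat. strict_mono r' \<and> (\<lambda>n. N (\<lambda>z. dilate r (F (r' n)) z - g z)) \<longlonglongrightarrow> 0"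
    using GA q by blast
qed

text \<open>Cauchy's inequality on circles of radius \<delta> bounds the derivative by a multiple of
  the norm, and z moves by at most 1 - r. One r therefore serves all f.\<close>

lemma dilate_approximates:
  assumes "0 \<le> \<rho>" "\<rho> < 1" "e > 0"
  shows "\<exists>r. 1 / 2 \<le> r \<and> r < 1 \<and> (\<forall>f\<in>A. \<forall>z. norm z \<le> \<rho> \<longrightarrow> norm (f z - f (of_real r * z)) \<le> e * N f)"
proof -
  define \<delta> where "\<delta> = (1 - \<rho>) / 2"
  have \<delta>: "0 < \<delta>" "0 \<le> \<rho> + \<delta>" "\<rho> + \<delta> < 1" using assms by (auto simp: \<delta>_def field_simps)
  obtain C where C: "C > 0" "\<forall>f\<in>A. \<forall>z. norm z \<le> \<rho> + \<delta> \<longrightarrow> norm (f z) \<le> C * N f"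
    by (rule eval_bound_disk[OF \<delta>(2,3)])
  \<comment> \<open>This makes \<open>C / \<delta> * (1 - r)\<close> at most e; the value 1 / 2
    keeps r in the range of the norm bound for dilations.\<close>
  define r where "r = max (1 / 2) (1 - e * \<delta> / C)"
  have pos: "e * \<delta> / C > 0" using assms(3) \<delta>(1) C(1) by simp
  then have r: "1 / 2 \<le> r" "r < 1" "1 - r \<le> e * \<delta> / C" by (auto simp: r_def)
  have "norm (f z - f (of_real r * z)) \<le> e * N f" if f: "f \<in> A" and z: "norm z \<le> \<rho>" for f z
  proof -
    have near: "norm x \<le> \<rho> + \<delta>" if "norm w \<le> \<rho>" "norm (w - x) \<le> \<delta>" for w x :: complex
      using norm_triangle_ineq4[of w "w - x"] that by simp
    have deriv: "norm (deriv f w) \<le> C * N f / \<delta>" if w: "w \<in> cball 0 \<rho>" for w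
    proof -
      have sub: "cball w \<delta> \<subseteq> unit_disk"
      proof
        fix x assume "x \<in> cball w \<delta>"
        then have "norm x \<le> \<rho> + \<delta>" using near[of w x] w by (simp add: dist_norm)
        then show "x \<in> unit_disk" using \<delta>(3) by simp
      qed
      have "norm ((deriv ^^ 1) f w) \<le> fact 1 * (C * N f) / \<delta> ^ 1"
      proof (rule Cauchy_inequality[OF _ _ \<delta>(1)])
        show "f holomorphic_on ball w \<delta>"
          by (rule holomorphic_on_subset[OF bergmanD(1)[OF f]]) (use sub ball_subset_cball in blast)
        show "continuous_on (cball w \<delta>) f"
          by (rule continuous_on_subset[OF holomorphic_on_imp_continuous_on[OF bergmanD(1)[OF f]] sub])
        show "norm (f x) \<le> C * N f" if "norm (w - x) = \<delta>" for x
          using bspec[OF C(2) f] near[of w x] w that by simp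
      qed
      then show ?thesis by simp
    qed
    have "norm (f z - f (of_real r * z)) \<le> C * N f / \<delta> * norm (z - of_real r * z)"
    proof (rule field_differentiable_bound[OF convex_cball[of 0 \<rho>] _ deriv])
      show "(f has_field_derivative deriv f w) (at w within cball 0 \<rho>)" if "w \<in> cball 0 \<rho>" for w
        by (rule holomorphic_derivI[OF bergmanD(1)[OF f]]) (use that assms(2) in auto)
      show "z \<in> cball 0 \<rho>" using z by simp
      have "r * norm z \<le> 1 * norm z" using r by (intro mult_right_mono) auto
      then show "of_real r * z \<in> cball 0 \<rho>" using z r by (simp add: norm_mult)
    qed
    also have "\<dots> \<le> C * N f / \<delta> * (e * \<delta> / C)"
    proof (rule mult_left_mono)
      have "z - of_real r * z = of_real (1 - r) * z" by (simp add: algebra_simps)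
      then have "norm (z - of_real r * z) = (1 - r) * norm z" using r by (simp only: norm_mult norm_of_real)
      also have "\<dots> \<le> (1 - r) * 1" using z r assms(2) by (intro mult_left_mono) auto
      finally show "norm (z - of_real r * z) \<le> e * \<delta> / C" using r(3) by simp
      show "0 \<le> C * N f / \<delta>" using C(1) \<delta>(1) N_nonneg[of f] by simp
    qed
    also have "\<dots> = e * N f" using C(1) \<delta>(1) by simp
    finally show ?thesis .
  qed
  then show ?thesis using r by blast
qed

end

section \<open>Weak convergence in the Bergman space\<close>

text \<open>Dependent choice: each outer radius becomes the next inner radius. The chosen objects
  are indices of functions in one application and dilation ratios in the other.\<close>

lemma increasing_radii:
  fixes Q :: "'x \<Rightarrow> real \<Rightarrow> real \<Rightarrow> bool" and \<rho>0 :: real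
  assumes "0 \<le> \<rho>0" "\<rho>0 < 1"
    and step: "\<And>\<rho>. 0 \<le> \<rho> \<Longrightarrow> \<rho> < 1 \<Longrightarrow> \<exists>x \<rho>'. \<rho> \<le> \<rho>' \<and> \<rho>' < 1 \<and> Q x \<rho> \<rho>'"
  obtains x :: "nat \<Rightarrow> 'x" and \<rho> :: "nat \<Rightarrow> real"
  where "\<rho> 0 = \<rho>0" "\<And>k. 0 \<le> \<rho> k" "\<And>k. \<rho> k < 1" "mono \<rho>" "\<And>k. Q (x k) (\<rho> k) (\<rho> (Suc k))"
proof -
  define f where "f \<rho> = (SOME y. \<rho> \<le> snd y \<and> snd y < 1 \<and> Q (fst y) \<rho> (snd y))" for \<rho>
  have f: "\<rho> \<le> snd (f \<rho>)" "snd (f \<rho>) < 1" "Q (fst (f \<rho>)) \<rho> (snd (f \<rho>))"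
    if \<rho>: "0 \<le> \<rho>" "\<rho> < 1" for \<rho>
  proof -
    obtain x \<rho>' where "\<rho> \<le> \<rho>'" "\<rho>' < 1" "Q x \<rho> \<rho>'" using step[OF \<rho>] by (elim exE conjE)
    then have "\<exists>y. \<rho> \<le> snd y \<and> snd y < 1 \<and> Q (fst y) \<rho> (snd y)"
      by (intro exI[of _ "(x, \<rho>')"]) simp
    from someI_ex[OF this]
    show "\<rho> \<le> snd (f \<rho>)" "snd (f \<rho>) < 1" "Q (fst (f \<rho>)) \<rho> (snd (f \<rho>))"
      by (simp_all add: f_def)
  qed
  define \<rho> where "\<rho> = rec_nat \<rho>0 (\<lambda>_ r. snd (f r))"
  have \<rho>0: "\<rho> 0 = \<rho>0" and \<rho>S: "\<rho> (Suc k) = snd (f (\<rho> k))" for k by (simp_all add: \<rho>_def)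
  have rng: "0 \<le> \<rho> k \<and> \<rho> k < 1" for k
  proof (induction k)
    case 0
    then show ?case using assms by (simp add: \<rho>0)
  next
    case (Suc k)
    then show ?case using f(1,2)[of "\<rho> k"] unfolding \<rho>S by linarith
  qed
  show ?thesis
  proof (rule that[of \<rho> "\<lambda>k. fst (f (\<rho> k))"])
    show "mono \<rho>" unfolding mono_iff_le_Suc \<rho>S using f(1) rng by blast
    show "Q (fst (f (\<rho> k))) (\<rho> k) (\<rho> (Suc k))" for k unfolding \<rho>S using f(3) rng by blast
  qed (use rng \<rho>0 in auto)
qed

context bergman_setting
begin

text \<open>Consecutive radii bound disjoint annuli. Each function is small inside its inner and
  outside its outer circle, which gives the error 2 e per summand.\<close>

lemma annuli_sum:
  assumes \<rho>: "\<And>k. 0 \<le> \<rho> k" "\<And>k. \<rho> k < 1" "mono \<rho>"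
    and g: "\<And>k. g k \<in> Lp_space M p" "\<And>k. Lp_norm M p (g k) \<le> C" and C: "C \<ge> 0"
    and inner: "\<And>k. Lp_norm M p (\<lambda>z. indicator (ball 0 (\<rho> k)) z * g k z) \<le> e"
    and outer: "\<And>k. Lp_norm M p (\<lambda>z. indicator (unit_disk - ball 0 (\<rho> (Suc k))) z * g k z) \<le> e"
  shows "Lp_norm M p (\<lambda>z. \<Sum>k<n. g k z) \<le> C * real n powr (1 / p) + real n * (2 * e)"
proof -
  define B where "B k = ball 0 (\<rho> (Suc k)) - ball (0 :: complex) (\<rho> k)" for k
  have ball: "ball 0 (\<rho> k) \<in> sets M" for k
    by (rule borel_subset_sets_dA) (use \<rho>(2)[of k] in \<open>auto intro: less_trans\<close>)
  have disk: "unit_disk \<in> sets M" by (rule borel_subset_sets_dA) auto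
  have B: "B k \<in> sets M" for k unfolding B_def using ball by blast
  have disj: "disjoint_family_on B {..<n}"
    unfolding disjoint_family_on_def
  proof (intro ballI impI)
    fix i j :: nat assume "i \<noteq> j"
    have *: "B a \<inter> B b = {}" if "a < b" for a b
    proof -
      have "\<rho> (Suc a) \<le> \<rho> b" using \<rho>(3) that by (intro monoD[of \<rho>]) auto
      then show ?thesis by (auto simp: B_def)
    qed
    show "B i \<inter> B j = {}" using *[of i j] *[of j i] \<open>i \<noteq> j\<close> by (cases "i < j") auto
  qed
  have "Lp_norm M p (\<lambda>z. indicator (space M - B k) z * g k z) \<le> 2 * e" for k
  proof -
    let ?i = "\<lambda>z. indicator (ball 0 (\<rho> k)) z * g k z"
    let ?o = "\<lambda>z. indicator (unit_disk - ball 0 (\<rho> (Suc k))) z * g k z"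
    have i: "?i \<in> Lp_space M p" by (rule Lp_indicator(1)[OF p_pos g(1) ball])
    have o: "?o \<in> Lp_space M p" by (rule Lp_indicator(1)[OF p_pos g(1) sets.Diff[OF disk ball]])
    have "Lp_norm M p (\<lambda>z. indicator (space M - B k) z * g k z) = Lp_norm M p (\<lambda>z. ?i z + ?o z)"
    proof -
      have "\<rho> k \<le> \<rho> (Suc k)" using \<rho>(3) by (intro monoD[of \<rho>]) auto
      then have "indicator (space M - B k) z * g k z = ?i z + ?o z" if "z \<in> space M" for z
        using that by (auto simp: indicator_def B_def)
      then show ?thesis unfolding Lp_norm_def
        by (intro arg_cong2[where f = "(powr)"] Bochner_Integration.integral_cong refl) simp
    qed
    also have "\<dots> \<le> Lp_norm M p ?i + Lp_norm M p ?o" by (rule Minkowski(2)[OF p_ge i o])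
    finally show ?thesis using inner[of k] outer[of k] by linarith
  qed
  from Lp_norm_almost_disjoint_sum[OF p_ge finite_lessThan disj C B g this]
  show ?thesis by simp
qed

text \<open>Because p > 1, the exponent s = 1 - 1 / p is positive, so \<open>n powr (1 / p)\<close>
  is eventually negligible against n.\<close>

lemma sublinear_eventually:
  assumes "C \<ge> 0" "c > 0"
  obtains n :: nat where "n > 0" "C * real n powr (1 / p) < real n * c"
proof -
  define s where "s = 1 - 1 / p"
  have s: "s > 0" using p by (simp add: s_def)
  \<comment> \<open>Beyond this threshold n^s is at least (C + 1) / c; the added 1 makes the final
    inequality strict.\<close>
  obtain n :: nat where "max 1 (((C + 1) / c) powr (1 / s)) < real n"
    using reals_Archimedean2 by blast
  then have n: "n > 0" "((C + 1) / c) powr (1 / s) < real n" by auto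
  have "(C + 1) / c = (((C + 1) / c) powr (1 / s)) powr s"
    using s assms by (simp add: powr_powr)
  also have "\<dots> \<le> real n powr s" using n(2) s by (intro powr_mono2) auto
  finally have "C + 1 \<le> real n powr s * c" using assms by (simp add: divide_le_eq)
  then have "C < real n powr s * c" by simp
  then have "C * real n powr (1 / p) < real n powr s * c * real n powr (1 / p)"
    using n(1) by (intro mult_strict_right_mono) auto
  also have "\<dots> = real n * c"
    using n(1) by (simp add: s_def powr_add[symmetric] mult_ac)
  finally show ?thesis using that n(1) by blast
qed

text \<open>
  If \<open>\<bar>l (F n)\<bar> \<ge> \<eta>\<close> infinitely often, then \<open>n\<close> of these functions, concentrated on disjoint annuli and
  rotated so that \<open>l\<close> is positive on them, have a sum \<open>g\<close> of norm \<open>O(n powr (1 / p))\<close>, up to a small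
  multiple of \<open>n\<close>, although \<open>l g \<ge> n \<eta>\<close>.
\<close>

lemma locally_null_imp_functional_null:
  assumes F: "\<And>n. F n \<in> A" and C: "\<And>n. N (F n) \<le> C"
    and null: "\<And>r e. 0 \<le> r \<Longrightarrow> r < 1 \<Longrightarrow> e > 0 \<Longrightarrow>
      \<forall>\<^sub>F n in sequentially. \<forall>z. norm z \<le> r \<longrightarrow> norm (F n z) \<le> e"
    and l: "l \<in> bounded_functionals A N"
  shows "(\<lambda>n. l (F n)) \<longlonglongrightarrow> 0"
proof (rule ccontr)
  assume "\<not> ?thesis"
  then have "\<not> (\<lambda>n. norm (l (F n))) \<longlonglongrightarrow> 0" by (simp add: tendsto_norm_zero_iff)
  then obtain \<eta> and q :: "nat \<Rightarrow> nat" where \<eta>: "\<eta> > 0" "strict_mono q" "\<And>n. \<eta> \<le> norm (l (F (q n)))"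
    by (rule not_null_subseq) auto
  have l_lin: "l (\<lambda>z. a * f z + b * g z) = a * l f + b * l g" if "f \<in> A" "g \<in> A" for a b f g
    using l that unfolding bounded_functionals_def by blast
  obtain L0 where L0: "\<forall>f\<in>A. norm (l f) \<le> L0 * N f"
    using l unfolding bounded_functionals_def by blast
  define L where "L = max L0 1"
  have L: "L > 0" "norm (l f) \<le> L * N f" if "f \<in> A" for f
  proof -
    show "L > 0" by (simp add: L_def)
    have "L0 * N f \<le> L * N f" by (rule mult_right_mono[OF _ N_nonneg]) (simp add: L_def)
    then show "norm (l f) \<le> L * N f" using bspec[OF L0 that] by linarith
  qed
  have Lpos: "L > 0" by (simp add: L_def)
  have C0: "C \<ge> 0" using C[of 0] N_nonneg[of "F 0"] by linarith
  \<comment> \<open>The two parts off an annulus cost 2 e per function; multiplied by L this uses up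
    half of \<eta>.\<close>
  define e where "e = \<eta> / (4 * L)"
  have e: "e > 0" "L * (2 * e) = \<eta> / 2" using \<eta>(1) Lpos by (auto simp: e_def)
  define e' where "e' = e / (\<mu> + 1)"
  have e': "e' > 0" "e' * \<mu> \<le> e"
    using e(1) \<mu>_nonneg by (auto simp: e'_def divide_le_eq mult.commute mult_left_mono)
  define Q where "Q n \<rho> \<rho>' \<longleftrightarrow> \<eta> \<le> norm (l (F n)) \<and>
      Lp_norm M p (\<lambda>z. indicator (ball 0 \<rho>) z * F n z) \<le> e \<and>
      Lp_norm M p (\<lambda>z. indicator (unit_disk - ball 0 \<rho>') z * F n z) \<le> e" for n \<rho> \<rho>'
  \<comment> \<open>The order of choice matters: for a given inner radius a late member of the
    subsequence is small inside it, and only then is the outer radius adapted to that one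
    function.\<close>
  have step: "\<exists>n \<rho>'. \<rho> \<le> \<rho>' \<and> \<rho>' < 1 \<and> Q n \<rho> \<rho>'"
    if \<rho>: "0 \<le> \<rho>" "\<rho> < 1" for \<rho>
  proof -
    have "\<forall>\<^sub>F n in sequentially. \<forall>z. norm z \<le> \<rho> \<longrightarrow> norm (F (q n) z) \<le> e'"
      using filterlim_subseq[OF \<eta>(2)] null[OF \<rho> e'(1)] by (rule filterlim_iff[THEN iffD1, rule_format])
    then obtain k where k: "\<forall>z. norm z \<le> \<rho> \<longrightarrow> norm (F (q k) z) \<le> e'"
      unfolding eventually_sequentially by blast
    have [measurable]: "F (q k) \<in> borel_measurable borel" "ball (0 :: complex) \<rho> \<in> sets borel"
      using bergman_measurable[OF F] by simp_all
    have "Lp_norm M p (\<lambda>z. indicator (ball 0 \<rho>) z * F (q k) z) \<le> e' * \<mu>"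
      by (rule N_bounded(2)[OF borel_measurable_dA])
         (measurable, use k e'(1) in \<open>auto simp: indicator_def\<close>)
    then have 1: "Lp_norm M p (\<lambda>z. indicator (ball 0 \<rho>) z * F (q k) z) \<le> e" using e'(2) by linarith
    obtain \<rho>' where "\<rho> \<le> \<rho>'" "\<rho>' < 1" "Lp_norm M p (\<lambda>z. indicator (unit_disk - ball 0 \<rho>') z * F (q k) z) \<le> e"
      using Lp_norm_tail[OF p_pos bergman_Lp[OF F] e(1) \<rho>(2)] by blast
    with 1 \<eta>(3) show ?thesis unfolding Q_def by (intro exI[of _ "q k"] exI[of _ \<rho>'] conjI)
  qed
  obtain k :: "nat \<Rightarrow> nat" and \<rho> :: "nat \<Rightarrow> real"
    where \<rho>0: "\<rho> 0 = 0" and \<rho>: "\<And>i. 0 \<le> \<rho> i" "\<And>i. \<rho> i < 1" "mono \<rho>"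
    and Qk: "\<And>i. Q (k i) (\<rho> i) (\<rho> (Suc i))"
  proof (rule increasing_radii[of 0 Q, OF order_refl zero_less_one step])
    fix k :: "nat \<Rightarrow> nat" and \<rho> :: "nat \<Rightarrow> real"
    assume "\<rho> 0 = 0" "\<And>i. 0 \<le> \<rho> i" "\<And>i. \<rho> i < 1" "mono \<rho>" "\<And>i. Q (k i) (\<rho> i) (\<rho> (Suc i))"
    then show thesis by (rule that)
  qed
  note k = Qk[unfolded Q_def]
  \<comment> \<open>Phases of modulus at most 1 make the values of \<open>l\<close> nonnegative
    reals, so that they cannot cancel in the sum.\<close>
  define w where "w i = cnj (sgn (l (F (k i))))" for i
  have nw: "norm (w i) \<le> 1" for i unfolding w_def complex_mod_cnj norm_sgn by simp
  have lw: "w i * l (F (k i)) = of_real (norm (l (F (k i))))" for i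
    by (simp add: w_def sgn_eq norm_sgn complex_norm_square[symmetric] power2_eq_square mult.commute)
  define g where "g i = (\<lambda>z. w i * F (k i) z)" for i
  have gA: "g i \<in> A" for i unfolding g_def by (rule bergman_scale[OF F])
  have w_le: "Lp_norm M p (\<lambda>z. w i * f z) \<le> Lp_norm M p f" for f i
    unfolding Lp_norm_scale[OF p_pos] using mult_right_mono[OF nw[of i] Lp_norm_nonneg[of M p f]] by simp
  obtain n :: nat where n: "n > 0" "L * C * real n powr (1 / p) < real n * (\<eta> / 2)"
    by (rule sublinear_eventually[of "L * C" "\<eta> / 2"]) (use Lpos C0 \<eta>(1) in auto)
  have "Lp_norm M p (\<lambda>z. \<Sum>i<n. g i z) \<le> C * real n powr (1 / p) + real n * (2 * e)"
  proof (rule annuli_sum[OF \<rho> bergman_Lp[OF gA] _ C0])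
    fix i
    show "Lp_norm M p (g i) \<le> C"
      unfolding g_def using w_le[of i "F (k i)"] C[of "k i"] unfolding bergman_norm_eq by linarith
    show "Lp_norm M p (\<lambda>z. indicator (ball 0 (\<rho> i)) z * g i z) \<le> e"
      using w_le[of i "\<lambda>z. indicator (ball 0 (\<rho> i)) z * F (k i) z"] k[of i]
      by (simp add: g_def mult.left_commute)
    show "Lp_norm M p (\<lambda>z. indicator (unit_disk - ball 0 (\<rho> (Suc i))) z * g i z) \<le> e"
      using w_le[of i "\<lambda>z. indicator (unit_disk - ball 0 (\<rho> (Suc i))) z * F (k i) z"] k[of i]
      by (simp add: g_def mult.left_commute)
  qed
  then have up: "L * N (\<lambda>z. \<Sum>i<n. g i z) \<le> L * (C * real n powr (1 / p) + real n * (2 * e))"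
    unfolding bergman_norm_eq using Lpos by (intro mult_left_mono) auto
  have sum: "(\<lambda>z. \<Sum>i<m. g i z) \<in> A \<and> l (\<lambda>z. \<Sum>i<m. g i z) = of_real (\<Sum>i<m. norm (l (F (k i))))" for m
  proof (induction m)
    case 0
    have "l (\<lambda>_. 0) = 0" using l_lin[OF zero_bergman zero_bergman, of 0 0] by simp
    then show ?case by (simp add: zero_bergman)
  next
    case (Suc m)
    have "l (\<lambda>z. (\<Sum>i<m. g i z) + g m z) = l (\<lambda>z. \<Sum>i<m. g i z) + w m * l (F (k m))"
      using l_lin[of "\<lambda>z. \<Sum>i<m. g i z" "F (k m)" 1 "w m"] Suc F by (simp add: g_def)
    then show ?case using Suc add_bergman[OF _ gA, of "\<lambda>z. \<Sum>i<m. g i z" m] by (simp add: lw)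
  qed
  have "real n * \<eta> \<le> (\<Sum>i<n. norm (l (F (k i))))"
    using sum_mono[of "{..<n}" "\<lambda>_. \<eta>" "\<lambda>i. norm (l (F (k i)))"] k by simp
  also have "\<dots> = norm (l (\<lambda>z. \<Sum>i<n. g i z))"
    using sum[of n] by (simp add: sum_nonneg abs_of_nonneg del: of_real_sum)
  also have "\<dots> \<le> L * N (\<lambda>z. \<Sum>i<n. g i z)" using L(2) sum by blast
  also note up
  also have "L * (C * real n powr (1 / p) + real n * (2 * e)) = L * C * real n powr (1 / p) + real n * (\<eta> / 2)"
    using e(2) by (simp add: algebra_simps)
  also have "\<dots> < real n * \<eta>" using n(2) by (simp add: field_simps)
  finally show False by simp
qed

lemma locally_null_imp_weakly_null:
  assumes F: "\<And>n. F n \<in> A" and C: "\<And>n. N (F n) \<le> C"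
    and null: "\<And>r e. 0 \<le> r \<Longrightarrow> r < 1 \<Longrightarrow> e > 0 \<Longrightarrow>
      \<forall>\<^sub>F n in sequentially. \<forall>z. norm z \<le> r \<longrightarrow> norm (F n z) \<le> e"
  shows "weakly_null F"
  unfolding weakly_null_def
  using F C locally_null_imp_functional_null[OF F C null] by (intro conjI allI ballI exI[of _ C])

section \<open>Completeness of the Bergman space\<close>

text \<open>Point evaluations turn the Cauchy property into locally uniform convergence, so the
  limit is holomorphic; Fatou's lemma gives convergence in norm.\<close>

lemma bergman_complete:
  assumes F: "\<And>n. F n \<in> A"
    and Cauchy: "\<And>e. e > 0 \<Longrightarrow> \<exists>m0. \<forall>m\<ge>m0. \<forall>n\<ge>m0. N (\<lambda>z. F m z - F n z) < e"
  shows "\<exists>g\<in>A. (\<lambda>n. N (\<lambda>z. F n z - g z)) \<longlonglongrightarrow> 0"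
proof -
  have unif_Cauchy: "\<exists>m0. \<forall>m\<ge>m0. \<forall>n\<ge>m0. \<forall>z\<in>cball 0 r. norm (F m z - F n z) < e"
    if r: "0 \<le> r" "r < 1" and e: "e > 0" for r e
  proof -
    obtain C where C: "C > 0" "\<forall>f\<in>A. \<forall>z. norm z \<le> r \<longrightarrow> norm (f z) \<le> C * N f"
      by (rule eval_bound_disk[OF r])
    obtain m0 where m0: "\<forall>m\<ge>m0. \<forall>n\<ge>m0. N (\<lambda>z. F m z - F n z) < e / C"
      using Cauchy[of "e / C"] e C(1) by auto
    have "norm (F m z - F n z) < e" if "m \<ge> m0" "n \<ge> m0" "z \<in> cball 0 r" for m n z
    proof -
      have "norm (F m z - F n z) \<le> C * N (\<lambda>z. F m z - F n z)"
        using bspec[OF C(2) diff_mem[OF F F], of m n] that(3) by simp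
      also have "\<dots> < C * (e / C)" using m0 that(1,2) C(1) by (intro mult_strict_left_mono) auto
      finally show ?thesis using C(1) by simp
    qed
    then show ?thesis by blast
  qed
  define g where "g z = (if z \<in> unit_disk then lim (\<lambda>n. F n z) else 0)" for z
  have lim: "(\<lambda>n. F n z) \<longlonglongrightarrow> g z" for z
  proof (cases "z \<in> unit_disk")
    case True
    then have z: "norm z < 1" by simp
    have "Cauchy (\<lambda>n. F n z)"
    proof (rule CauchyI)
      fix e :: real assume "e > 0"
      from unif_Cauchy[OF norm_ge_zero z this]
      obtain m0 where "\<forall>m\<ge>m0. \<forall>n\<ge>m0. \<forall>x\<in>cball 0 (norm z). norm (F m x - F n x) < e" ..
      then show "\<exists>m0. \<forall>m\<ge>m0. \<forall>n\<ge>m0. norm (F m z - F n z) < e" by (intro exI[of _ m0]) simp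
    qed
    then show ?thesis using True by (simp add: g_def Cauchy_convergent_iff convergent_LIMSEQ_iff)
  next
    case False
    then show ?thesis by (simp add: g_def bergmanD(2)[OF F])
  qed
  have unif: "uniform_limit (cball 0 r) F g sequentially" if r: "0 \<le> r" "r < 1" for r
  proof (rule uniform_limitI)
    fix e :: real assume "e > 0"
    then have "e / 2 > 0" by simp
    from unif_Cauchy[OF r this]
    obtain m0 where m0: "\<forall>m\<ge>m0. \<forall>n\<ge>m0. \<forall>z\<in>cball 0 r. norm (F m z - F n z) < e / 2" ..
    have "dist (F n z) (g z) < e" if "n \<ge> m0" "z \<in> cball 0 r" for n z
    proof -
      have "(\<lambda>m. norm (F n z - F m z)) \<longlonglongrightarrow> norm (F n z - g z)"
        by (intro tendsto_norm tendsto_diff tendsto_const lim)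
      then have "norm (F n z - g z) \<le> e / 2"
        by (rule LIMSEQ_le_const2) (use m0 that in \<open>auto intro!: exI[of _ m0] less_imp_le\<close>)
      then show ?thesis using \<open>e > 0\<close> by (simp add: dist_norm)
    qed
    then show "\<forall>\<^sub>F n in sequentially. \<forall>z\<in>cball 0 r. dist (F n z) (g z) < e"
      unfolding eventually_sequentially by blast
  qed
  have g_hol: "g holomorphic_on unit_disk"
  proof (rule holomorphic_uniform_sequence[OF open_ball bergmanD(1)[OF F]])
    fix x :: complex assume x: "x \<in> unit_disk"
    define d where "d = (1 - norm x) / 2"
    have d: "d > 0" "norm x + d < 1" using x by (auto simp: d_def field_simps)
    have sub: "cball x d \<subseteq> cball 0 (norm x + d)"
    proof
      fix y assume "y \<in> cball x d"
      then show "y \<in> cball 0 (norm x + d)"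
        using norm_triangle_sub[of y x] by (simp add: dist_norm norm_minus_commute)
    qed
    have "uniform_limit (cball x d) F g sequentially"
      by (rule uniform_limit_on_subset[OF unif sub]) (use d in auto)
    moreover have "cball x d \<subseteq> unit_disk" using sub d by fastforce
    ultimately show "\<exists>d>0. cball x d \<subseteq> unit_disk \<and> uniform_limit (cball x d) F g sequentially"
      using d(1) by blast
  qed
  have g_zero: "g z = 0" if "z \<notin> unit_disk" for z using that by (simp add: g_def)
  note F_meas [measurable] = bergman_measurable[OF F]
    and g_meas [measurable] = holomorphic_disk_measurable[OF g_hol g_zero]
  \<comment> \<open>Letting m tend to infinity under Fatou's lemma carries the Cauchy estimate over
    to the limit g.\<close>
  have Fatou: "(\<lambda>z. F n z - g z) \<in> Lp_space M p" "Lp_norm M p (\<lambda>z. F n z - g z) \<le> e"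
    if e: "e > 0" and n: "\<forall>m\<ge>m0. N (\<lambda>z. F n z - F m z) < e" for n e m0
  proof -
    have meas: "(\<lambda>z. F n z - F m z) \<in> borel_measurable M" "(\<lambda>z. F n z - g z) \<in> borel_measurable M" for m
      by (rule borel_measurable_dA, measurable)+
    have meas': "(\<lambda>z. ennreal (norm (F n z - F m z) powr p)) \<in> borel_measurable M" for m
      using meas(1)[of m] by measurable
    have "(\<integral>\<^sup>+ z. ennreal (norm (F n z - g z) powr p) \<partial>M) =
        (\<integral>\<^sup>+ z. liminf (\<lambda>m. ennreal (norm (F n z - F m z) powr p)) \<partial>M)"
    proof (rule nn_integral_cong)
      fix z
      have "(\<lambda>m. ennreal (norm (F n z - F m z) powr p)) \<longlonglongrightarrow> ennreal (norm (F n z - g z) powr p)"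
        using p_pos by (intro tendsto_ennrealI tendsto_powr' tendsto_norm tendsto_diff tendsto_const lim) auto
      then show "ennreal (norm (F n z - g z) powr p) = liminf (\<lambda>m. ennreal (norm (F n z - F m z) powr p))"
        by (rule lim_imp_Liminf[OF sequentially_bot, THEN sym])
    qed
    also have "\<dots> \<le> liminf (\<lambda>m. \<integral>\<^sup>+ z. ennreal (norm (F n z - F m z) powr p) \<partial>M)"
      by (rule nn_integral_liminf[OF meas'])
    also have "\<dots> \<le> liminf (\<lambda>m. ennreal (e powr p))"
    proof (rule Liminf_mono, unfold eventually_sequentially, intro exI[of _ m0] allI impI)
      fix m assume "m \<ge> m0"
      then have "N (\<lambda>z. F n z - F m z) \<le> e" using n by (simp add: less_imp_le)
      then have "N (\<lambda>z. F n z - F m z) powr p \<le> e powr p"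
        using p_pos N_nonneg by (intro powr_mono2) auto
      then show "(\<integral>\<^sup>+ z. ennreal (norm (F n z - F m z) powr p) \<partial>M) \<le> ennreal (e powr p)"
        using Lp_norm_nn_integral[OF p_pos bergman_Lp[OF diff_mem[OF F F]], of n m]
        by (simp add: bergman_norm_eq ennreal_leI)
    qed
    also have "\<dots> = ennreal (e powr p)" by (rule Liminf_const) simp
    finally have le: "(\<integral>\<^sup>+ z. ennreal (norm (F n z - g z) powr p) \<partial>M) \<le> ennreal (e powr p)" .
    show "(\<lambda>z. F n z - g z) \<in> Lp_space M p" "Lp_norm M p (\<lambda>z. F n z - g z) \<le> e"
      using Lp_norm_leI[OF p_pos meas(2) less_imp_le[OF e] le] by blast+
  qed
  have gA: "g \<in> A"
  proof (rule bergmanI[OF g_hol g_zero])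
    obtain m0 where m0: "\<forall>m\<ge>m0. \<forall>n\<ge>m0. N (\<lambda>z. F m z - F n z) < 1" using Cauchy[of 1] by auto
    then have "(\<lambda>z. F m0 z - g z) \<in> Lp_space M p" by (intro Fatou(1)[of 1 m0]) auto
    \<comment> \<open>g equals \<open>F m0 - (F m0 - g)\<close>, a difference of two members of
      \<open>Lp_space\<close>.\<close>
    from Lp_diff(1)[OF p_ge bergman_Lp[OF F] this, of m0]
    show "g \<in> Lp_space M p" by simp
  qed
  have "(\<lambda>n. N (\<lambda>z. F n z - g z)) \<longlonglongrightarrow> 0"
  proof (rule LIMSEQ_I)
    fix e :: real assume "e > 0"
    obtain m0 where m0: "\<forall>m\<ge>m0. \<forall>n\<ge>m0. N (\<lambda>z. F m z - F n z) < e / 2"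
      using Cauchy[of "e / 2"] \<open>e > 0\<close> by auto
    have "norm (N (\<lambda>z. F n z - g z) - 0) < e" if "n \<ge> m0" for n
    proof -
      have "Lp_norm M p (\<lambda>z. F n z - g z) \<le> e / 2"
        by (rule Fatou(2)[of "e / 2" m0]) (use m0 that \<open>e > 0\<close> in auto)
      then show ?thesis using \<open>e > 0\<close> by (simp add: bergman_norm_eq)
    qed
    then show "\<exists>m0. \<forall>n\<ge>m0. norm (N (\<lambda>z. F n z - g z) - 0) < e" by blast
  qed
  with gA show ?thesis by blast
qed

section \<open>Compact approximations of the identity\<close>

text \<open>A dilate is bounded by C times the norm of f on the whole disk, so the tail of the
  constant 1 controls the tails of all dilates at once.\<close>

lemma dilate_tail:
  assumes r: "1 / 2 \<le> r" "r < 1" and "e > 0" "\<rho>0 < 1"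
  shows "\<exists>\<rho>. \<rho>0 \<le> \<rho> \<and> \<rho> < 1 \<and>
    (\<forall>f\<in>A. Lp_norm M p (\<lambda>z. indicator (unit_disk - ball 0 \<rho>) z * dilate r f z) \<le> e * N f)"
proof -
  have "0 \<le> r" using r by simp
  then obtain C where C: "C > 0" "\<forall>f\<in>A. \<forall>z. norm z \<le> r \<longrightarrow> norm (f z) \<le> C * N f"
    by (rule eval_bound_disk[OF _ r(2)])
  have one: "(\<lambda>_. 1) \<in> Lp_space M p" by (rule N_bounded(1)[of _ 1]) auto
  obtain \<rho> where \<rho>: "\<rho>0 \<le> \<rho>" "\<rho> < 1"
    and tail: "Lp_norm M p (\<lambda>z. indicator (unit_disk - ball 0 \<rho>) z * 1) \<le> e / C"
    using Lp_norm_tail[OF p_pos one, of "e / C" \<rho>0] assms(3,4) C(1) by auto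
  have sets: "unit_disk - ball 0 \<rho> \<in> sets M" by (rule borel_subset_sets_dA) auto
  have "Lp_norm M p (\<lambda>z. indicator (unit_disk - ball 0 \<rho>) z * dilate r f z) \<le> e * N f" if f: "f \<in> A" for f
  proof -
    let ?c = "\<lambda>z :: complex. complex_of_real (C * N f) * (indicator (unit_disk - ball 0 \<rho>) z * 1)"
    have "norm (dilate r f z) \<le> C * N f" if "z \<in> unit_disk" for z
    proof -
      have "norm (of_real r * z) \<le> r" using that \<open>0 \<le> r\<close> by (simp add: norm_mult mult_left_le)
      then show ?thesis using bspec[OF C(2) f] that by (simp add: dilate_def)
    qed
    then have "Lp_norm M p (\<lambda>z. indicator (unit_disk - ball 0 \<rho>) z * dilate r f z) \<le> Lp_norm M p ?c"
      using C(1) N_nonneg[of f]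
      by (intro Lp_dominated(2)[OF p_pos Lp_scale[OF Lp_indicator(1)[OF p_pos one sets]]]
            Lp_spaceD(1)[OF Lp_indicator(1)[OF p_pos bergman_Lp[OF dilate_bergman(1)[OF f r]] sets]])
         (auto simp: indicator_def norm_mult)
    also have "\<dots> = C * N f * Lp_norm M p (\<lambda>z. indicator (unit_disk - ball 0 \<rho>) z * 1)"
      unfolding Lp_norm_scale[OF p_pos] norm_of_real using C(1) N_nonneg[of f] by simp
    also have "\<dots> \<le> C * N f * (e / C)"
      by (rule mult_left_mono[OF tail]) (use C(1) N_nonneg[of f] in simp)
    also have "\<dots> = e * N f" using C(1) by simp
    finally show ?thesis .
  qed
  then show ?thesis using \<rho> by blast
qed

text \<open>
  \<open>J\<close> is an average of dilations \<open>D i\<close> with ratios \<open>r i\<close> and radii \<open>\<rho> i\<close> tending to \<open>1\<close> alternately: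
  \<open>D i f\<close> is close to \<open>f\<close> on the disk of radius \<open>\<rho> i\<close> and small off the disk of radius \<open>\<rho> (i + 1)\<close>.
  Hence \<open>g i = D i f - 1\<^bsub>ball 0 (\<rho> i)\<^esub> f\<close> lives on an annulus up to a small error, and the average of
  \<open>n\<close> such functions has norm \<open>O(n powr (1 / p - 1))\<close>, while the remaining part of \<open>f - J f\<close> is
  bounded by \<open>\<bar>f\<bar>\<close> pointwise.
\<close>

lemma almost_isometric_approximation:
  assumes e: "0 < e" and \<rho>0: "0 \<le> \<rho>0" "\<rho>0 < 1"
  shows "\<exists>J\<in>compact_ops A N.
    (\<forall>f\<in>A. N (\<lambda>z. f z - J f z) \<le> (1 + e) * N f) \<and>
    (\<forall>f\<in>A. \<forall>z. norm z < \<rho>0 \<longrightarrow> norm (f z - J f z) \<le> e * N f)"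
proof -
  \<comment> \<open>Error budget: the two small parts of each error cost 2 * e1 = e / 2, and the
    choice of \<open>n\<close> makes the main part of the average cost the other half.\<close>
  define e1 where "e1 = e / 4"
  \<comment> \<open>A bound for sup norms: multiplied by \<mu> it becomes an L^p bound of at most
    e1, while e2 \<le> e serves the pointwise claim.\<close>
  define e2 where "e2 = min e (e1 / (\<mu> + 1))"
  have e1: "e1 > 0" using e by (simp add: e1_def)
  have e2: "e2 > 0" "e2 \<le> e" using e e1 \<mu>_nonneg by (simp_all add: e2_def)
  have "e2 * \<mu> \<le> e1 / (\<mu> + 1) * \<mu>" by (rule mult_right_mono[OF _ \<mu>_nonneg]) (simp add: e2_def)
  also have "\<dots> \<le> e1" using e1 \<mu>_nonneg by (simp add: divide_le_eq)
  finally have e2\<mu>: "e2 * \<mu> \<le> e1" .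
  define Q where "Q r \<rho> \<rho>' \<longleftrightarrow> 1 / 2 \<le> r \<and> r < 1 \<and>
      (\<forall>f\<in>A. \<forall>z. norm z \<le> \<rho> \<longrightarrow> norm (f z - f (of_real r * z)) \<le> e2 * N f) \<and>
      (\<forall>f\<in>A. Lp_norm M p (\<lambda>z. indicator (unit_disk - ball 0 \<rho>') z * dilate r f z) \<le> e1 * N f)"
    for r \<rho> \<rho>'
  have step: "\<exists>r \<rho>'. \<rho> \<le> \<rho>' \<and> \<rho>' < 1 \<and> Q r \<rho> \<rho>'" if \<rho>: "0 \<le> \<rho>" "\<rho> < 1" for \<rho>
  proof -
    obtain r where r: "1 / 2 \<le> r" "r < 1"
      "\<forall>f\<in>A. \<forall>z. norm z \<le> \<rho> \<longrightarrow> norm (f z - f (of_real r * z)) \<le> e2 * N f"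
      using dilate_approximates[OF \<rho> e2(1)] by (elim exE conjE)
    obtain \<rho>' where "\<rho> \<le> \<rho>'" "\<rho>' < 1"
      "\<forall>f\<in>A. Lp_norm M p (\<lambda>z. indicator (unit_disk - ball 0 \<rho>') z * dilate r f z) \<le> e1 * N f"
      using dilate_tail[OF r(1,2) e1 \<rho>(2)] by (elim exE conjE)
    with r show ?thesis unfolding Q_def by (intro exI[of _ r] exI[of _ \<rho>'] conjI)
  qed
  obtain r \<rho> :: "nat \<Rightarrow> real"
    where r\<rho>0: "\<rho> 0 = \<rho>0" and \<rho>: "\<And>i. 0 \<le> \<rho> i" "\<And>i. \<rho> i < 1" "mono \<rho>"
    and Qr: "\<And>i. Q (r i) (\<rho> i) (\<rho> (Suc i))"
  proof (rule increasing_radii[of \<rho>0 Q, OF \<rho>0 step])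
    fix r \<rho> :: "nat \<Rightarrow> real"
    assume "\<rho> 0 = \<rho>0" "\<And>i. 0 \<le> \<rho> i" "\<And>i. \<rho> i < 1" "mono \<rho>" "\<And>i. Q (r i) (\<rho> i) (\<rho> (Suc i))"
    then show thesis by (rule that)
  qed
  have r: "1 / 2 \<le> r i" "r i < 1" for i using Qr[of i] unfolding Q_def by blast+
  have close: "norm (f z - f (of_real (r i) * z)) \<le> e2 * N f" if "f \<in> A" "norm z \<le> \<rho> i" for f z i
    using Qr[of i] that unfolding Q_def by blast
  have tail: "Lp_norm M p (\<lambda>z. indicator (unit_disk - ball 0 (\<rho> (Suc i))) z * dilate (r i) f z) \<le> e1 * N f"
    if "f \<in> A" for f i
    using Qr[of i] that unfolding Q_def by blast
  \<comment> \<open>5 = 4 + 1 bounds the norm of an error: 4 for the dilation and 1 for the cut-off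
    of f.\<close>
  obtain n :: nat where n: "n > 0" "5 * real n powr (1 / p) < real n * (e / 2)"
    by (rule sublinear_eventually[of 5 "e / 2"]) (use e in auto)
  define J where "J f z = complex_of_real (1 / real n) * (\<Sum>i<n. dilate (r i) f z)" for f z
  have J_compact: "J \<in> compact_ops A N"
    unfolding J_def[abs_def] by (rule compact_sum) (auto intro: dilate_compact[OF r])
  have diff: "f z - J f z = complex_of_real (1 / real n) * (\<Sum>i<n. f z - dilate (r i) f z)" for f z
    using n(1) by (simp add: J_def sum_subtractf field_simps)
  have bound: "N (\<lambda>z. f z - J f z) \<le> (1 + e) * N f" if f: "f \<in> A" for f
  proof -
    define g where "g i = (\<lambda>z. dilate (r i) f z - indicator (ball 0 (\<rho> i)) z * f z)" for i
    have ball: "ball 0 (\<rho> i) \<in> sets M" for i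
      by (rule borel_subset_sets_dA) (use \<rho>(2)[of i] in \<open>auto intro: less_trans\<close>)
    note D = dilate_bergman[OF f r]
    note If = Lp_indicator[OF p_pos bergman_Lp[OF f] ball]
    have g_Lp: "g i \<in> Lp_space M p" for i
      unfolding g_def by (rule Lp_diff(1)[OF p_ge bergman_Lp[OF D(1)] If(1)])
    have g_le: "Lp_norm M p (g i) \<le> 5 * N f" for i
      using Lp_diff(2)[OF p_ge bergman_Lp[OF D(1)] If(1), of i i] D(2)[of i] If(2)[of i]
      unfolding g_def bergman_norm_eq by linarith
    have inner: "Lp_norm M p (\<lambda>z. indicator (ball 0 (\<rho> i)) z * g i z) \<le> e1 * N f" for i
    proof -
      have "Lp_norm M p (\<lambda>z. indicator (ball 0 (\<rho> i)) z * g i z) \<le> e2 * N f * \<mu>"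
      proof (rule N_bounded(2)[OF Lp_spaceD(1)[OF Lp_indicator(1)[OF p_pos g_Lp ball]]])
        fix z :: complex assume "z \<in> unit_disk"
        then show "norm (indicator (ball 0 (\<rho> i)) z * g i z) \<le> e2 * N f"
          using close[OF f, of z i] e2(1) N_nonneg[of f]
          by (simp add: indicator_def g_def dilate_def norm_minus_commute)
      qed (use e2(1) N_nonneg[of f] in simp)
      also have "\<dots> \<le> e1 * N f" using mult_right_mono[OF e2\<mu> N_nonneg[of f]] by (simp add: mult_ac)
      finally show ?thesis .
    qed
    have outer: "Lp_norm M p (\<lambda>z. indicator (unit_disk - ball 0 (\<rho> (Suc i))) z * g i z) \<le> e1 * N f" for i
    proof -
      have "\<rho> i \<le> \<rho> (Suc i)" using \<rho>(3) by (intro monoD[of \<rho>]) auto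
      then have "(\<lambda>z. indicator (unit_disk - ball 0 (\<rho> (Suc i))) z * g i z) =
          (\<lambda>z. indicator (unit_disk - ball 0 (\<rho> (Suc i))) z * dilate (r i) f z)"
        by (auto simp: indicator_def g_def fun_eq_iff)
      then show ?thesis using tail[OF f, of i] by simp
    qed
    have "0 \<le> 5 * N f" using N_nonneg[of f] by simp
    from annuli_sum[OF \<rho> g_Lp g_le this inner outer]
    have sum_le: "Lp_norm M p (\<lambda>z. \<Sum>i<n. g i z) \<le> 5 * N f * real n powr (1 / p) + real n * (2 * (e1 * N f))" .
    \<comment> \<open>Each summand is f z or 0, so the average is dominated by f; this is the source
      of the 1 in 1 + e.\<close>
    define h where "h z = complex_of_real (1 / real n) * (\<Sum>i<n. f z - indicator (ball 0 (\<rho> i)) z * f z)" for z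
    have sum_g: "(\<lambda>z. \<Sum>i<n. g i z) \<in> Lp_space M p"
      using Lp_sum[OF p_ge finite_lessThan, of n g M] g_Lp by blast
    have h_Lp: "h \<in> Lp_space M p"
      unfolding h_def
      by (rule Lp_scale, rule conjunct1[OF Lp_sum[OF p_ge finite_lessThan]])
         (rule Lp_diff(1)[OF p_ge bergman_Lp[OF f] If(1)])
    have h_le: "Lp_norm M p h \<le> N f"
      unfolding bergman_norm_eq
    proof (rule Lp_dominated(2)[OF p_pos bergman_Lp[OF f] Lp_spaceD(1)[OF h_Lp]])
      fix z
      have "norm (\<Sum>i<n. f z - indicator (ball 0 (\<rho> i)) z * f z) \<le> (\<Sum>i<n. norm (f z))"
        by (rule sum_norm_le) (simp add: indicator_def)
      then show "norm (h z) \<le> norm (f z)"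
        using n(1) by (simp add: h_def norm_mult norm_divide divide_le_eq mult.commute)
    qed
    \<comment> \<open>Each f - D i f splits into f minus its cut-off to the i-th ball, averaged in
      \<open>h\<close>, and the error \<open>g i\<close>.\<close>
    have "(\<lambda>z. f z - J f z) = (\<lambda>z. h z - complex_of_real (1 / real n) * (\<Sum>i<n. g i z))"
      unfolding diff h_def right_diff_distrib[symmetric] sum_subtractf[symmetric]
      by (simp add: g_def algebra_simps)
    then have "N (\<lambda>z. f z - J f z) \<le> Lp_norm M p h + Lp_norm M p (\<lambda>z. complex_of_real (1 / real n) * (\<Sum>i<n. g i z))"
      unfolding bergman_norm_eq by (simp only: Lp_diff(2)[OF p_ge h_Lp Lp_scale[OF sum_g]])
    also have "Lp_norm M p (\<lambda>z. complex_of_real (1 / real n) * (\<Sum>i<n. g i z)) =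
        1 / real n * Lp_norm M p (\<lambda>z. \<Sum>i<n. g i z)"
      unfolding Lp_norm_scale[OF p_pos] norm_of_real by simp
    also have "\<dots> \<le> 1 / real n * (5 * N f * real n powr (1 / p) + real n * (2 * (e1 * N f)))"
      by (rule mult_left_mono[OF sum_le]) simp
    also have "\<dots> = (5 * real n powr (1 / p)) * (N f / real n) + e / 2 * N f"
      using n(1) by (simp add: e1_def field_simps)
    also have "\<dots> \<le> (real n * (e / 2)) * (N f / real n) + e / 2 * N f"
      using n N_nonneg[of f] by (intro add_right_mono mult_right_mono) auto
    also have "\<dots> = e * N f" using n(1) by (simp add: field_simps)
    finally show ?thesis using h_le by (simp add: distrib_right)
  qed
  have small: "norm (f z - J f z) \<le> e * N f" if f: "f \<in> A" and z: "norm z < \<rho>0" for f z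
  proof -
    have "norm (f z - dilate (r i) f z) \<le> e * N f" for i
    proof -
      have "\<rho>0 \<le> \<rho> i" using monoD[OF \<rho>(3), of 0 i] r\<rho>0 by simp
      then have "norm (f z - dilate (r i) f z) \<le> e2 * N f"
        using close[OF f, of z i] z \<rho>0 by (simp add: dilate_def)
      also have "\<dots> \<le> e * N f" by (rule mult_right_mono[OF e2(2) N_nonneg])
      finally show ?thesis .
    qed
    then have "norm (\<Sum>i<n. f z - dilate (r i) f z) \<le> (\<Sum>i<n. e * N f)"
      by (intro sum_norm_le)
    then show ?thesis
      using n(1) unfolding diff by (simp add: norm_mult norm_divide divide_le_eq mult_ac)
  qed
  show ?thesis using J_compact bound small by blast
qed

text \<open>Normalised monomials work. Instead of computing their norms, evaluation at a point s < 1
  bounds the norm of z^n from below by a multiple of s^n. The sequence is needed for operators of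
  essential norm 0.\<close>

lemma weakly_null_sphere_nonempty:
  "weakly_null_sphere A N \<noteq> {}"
proof -
  define \<epsilon> where "\<epsilon> n = (\<lambda>z::complex. if z \<in> unit_disk then z ^ n else 0)" for n :: nat
  have \<epsilon>: "\<epsilon> n \<in> A" for n
  proof (rule bounded_bergman(1)[where C = 1])
    have "(\<lambda>z::complex. z ^ n) holomorphic_on unit_disk" by (intro holomorphic_intros)
    then show "\<epsilon> n holomorphic_on unit_disk" by (rule holomorphic_transform) (simp add: \<epsilon>_def)
    show "norm (\<epsilon> n z) \<le> 1" if "z \<in> unit_disk" for z
      using that by (simp add: \<epsilon>_def norm_power power_le_one)
  qed (simp_all add: \<epsilon>_def)
  have lower: "\<exists>C>0. \<forall>n. s ^ n \<le> C * N (\<epsilon> n)" if s: "0 \<le> s" "s < 1" for s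
  proof -
    obtain C where C: "C > 0" "\<forall>f\<in>A. \<forall>z. norm z \<le> s \<longrightarrow> norm (f z) \<le> C * N f"
      by (rule eval_bound_disk[OF s])
    have "s ^ n \<le> C * N (\<epsilon> n)" for n
    proof -
      have "norm (\<epsilon> n (of_real s)) \<le> C * N (\<epsilon> n)" using bspec[OF C(2) \<epsilon>[of n]] s by simp
      then show ?thesis using s by (simp add: \<epsilon>_def norm_power)
    qed
    then show ?thesis using C(1) by blast
  qed
  have pos: "N (\<epsilon> n) > 0" for n
  proof -
    obtain C where C: "C > 0" "\<forall>n. (1 / 2) ^ n \<le> C * N (\<epsilon> n)" using lower[of "1 / 2"] by auto
    have "0 < (1 / 2 :: real) ^ n" by simp
    also have "\<dots> \<le> C * N (\<epsilon> n)" using C(2) by blast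
    finally show ?thesis using C(1) by (simp add: zero_less_mult_iff)
  qed
  define F where "F n = (\<lambda>z. complex_of_real (1 / N (\<epsilon> n)) * \<epsilon> n z)" for n
  have FA: "F n \<in> A" for n unfolding F_def by (rule bergman_scale[OF \<epsilon>])
  have F1: "N (F n) = 1" for n
    unfolding F_def scale[OF \<epsilon>] norm_of_real using pos[of n] by simp
  have "weakly_null F"
  proof (rule locally_null_imp_weakly_null[OF FA eq_refl[OF F1]])
    fix r e :: real assume r: "0 \<le> r" "r < 1" and e: "e > 0"
    \<comment> \<open>With s strictly between r and 1, the normalised monomials are at most
      \<open>C * (r / s) ^ n\<close> on the disk of radius r.\<close>
    define s where "s = (1 + r) / 2"
    have s: "0 \<le> s" "s < 1" "r < s" "0 < s" using r by (auto simp: s_def)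
    obtain C where C: "C > 0" "\<forall>n. s ^ n \<le> C * N (\<epsilon> n)" using lower[OF s(1,2)] by blast
    have "(\<lambda>n. C * (r / s) ^ n) \<longlonglongrightarrow> 0"
      by (rule tendsto_mult_right_zero[OF LIMSEQ_power_zero]) (use r s in simp)
    from order_tendstoD(2)[OF this e]
    show "\<forall>\<^sub>F n in sequentially. \<forall>z. norm z \<le> r \<longrightarrow> norm (F n z) \<le> e"
    proof eventually_elim
      case (elim n)
      show ?case
      proof (intro allI impI)
        fix z :: complex assume z: "norm z \<le> r"
        have "norm (F n z) = norm z ^ n / N (\<epsilon> n)"
          using z r pos[of n] by (simp add: F_def \<epsilon>_def norm_mult norm_divide norm_power)
        also have "\<dots> \<le> r ^ n / N (\<epsilon> n)"
          using z pos[of n] by (intro divide_right_mono power_mono) auto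
        also have "\<dots> \<le> C * (r / s) ^ n"
        proof -
          have "r ^ n * s ^ n \<le> r ^ n * (C * N (\<epsilon> n))"
            using C(2) r by (intro mult_left_mono) auto
          then show ?thesis using pos[of n] s(4) by (simp add: power_divide divide_le_eq le_divide_eq mult_ac)
        qed
        finally show "norm (F n z) \<le> e" using elim by simp
      qed
    qed
  qed
  then have "F \<in> weakly_null_sphere A N"
    using FA F1 unfolding weakly_null_def weakly_null_sphere_def by blast
  then show ?thesis by blast
qed

lemma bergman_complete_approximable:
  "\<exists>J \<delta>. complete_approximable_space A N J \<delta>"
proof -
  \<comment> \<open>The accuracy tends to 0 on disks whose radii tend to 1, uniformly on the unit
    ball. Hence the remainders of any sequence in it, with the operator changing along the sequence,
    vanish locally uniformly.\<close>
  define P where "P n J \<longleftrightarrow> J \<in> compact_ops A N \<and>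
    (\<forall>f\<in>A. N (\<lambda>z. f z - J f z) \<le> (1 + 1 / real (Suc n)) * N f) \<and>
    (\<forall>f\<in>A. \<forall>z. norm z < 1 - 1 / real (Suc n) \<longrightarrow> norm (f z - J f z) \<le> 1 / real (Suc n) * N f)"
    for n :: nat and J
  have "\<exists>J. P n J" for n
    using almost_isometric_approximation[of "1 / real (Suc n)" "1 - 1 / real (Suc n)"]
    unfolding P_def Bex_def by (simp add: divide_le_eq)
  then obtain J where P: "P n (J n)" for n using choice[of P] by blast
  have J: "J n \<in> compact_ops A N"
    "f \<in> A \<Longrightarrow> N (\<lambda>z. f z - J n f z) \<le> (1 + 1 / real (Suc n)) * N f"
    "f \<in> A \<Longrightarrow> norm z < 1 - 1 / real (Suc n) \<Longrightarrow> norm (f z - J n f z) \<le> 1 / real (Suc n) * N f"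
    for n f z
    using P[of n] unfolding P_def by simp_all
  have lim: "(\<lambda>n. 1 / real (Suc n)) \<longlonglongrightarrow> 0" by (rule LIMSEQ_Suc[OF lim_1_over_n])
  have "complete_approximable_space A N J (\<lambda>n. 1 / real (Suc n))"
  proof
    show "J n \<in> compact_ops A N" for n by (rule J(1))
    show "N (\<lambda>z. f z - J n f z) \<le> (1 + 1 / real (Suc n)) * N f" if "f \<in> A" for f n
      by (rule J(2)[OF that])
    show "(\<lambda>n. 1 / real (Suc n)) \<longlonglongrightarrow> 0" by (rule lim)
    show "0 \<le> 1 / real (Suc n)" for n by simp
    show "weakly_null_sphere A N \<noteq> {}" by (rule weakly_null_sphere_nonempty)
    show "\<exists>g\<in>A. (\<lambda>n. N (\<lambda>z. F n z - g z)) \<longlonglongrightarrow> 0"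
      if "\<And>n. F n \<in> A" "\<And>e. e > 0 \<Longrightarrow> \<exists>M. \<forall>m\<ge>M. \<forall>n\<ge>M. N (\<lambda>z. F m z - F n z) < e"
      for F :: "nat \<Rightarrow> complex \<Rightarrow> complex"
      by (rule bergman_complete[OF that])
    show "weakly_null (\<lambda>n z. F n z - J n (F n) z)"
      if F: "\<And>n. F n \<in> A" "\<And>n. N (F n) \<le> 1" for F
    proof (rule locally_null_imp_weakly_null)
      show "(\<lambda>z. F n z - J n (F n) z) \<in> A" for n
        by (rule diff_mem[OF F(1) opD[OF compactD[OF J(1)] F(1)]])
      show "N (\<lambda>z. F n z - J n (F n) z) \<le> 2" for n
      proof -
        have "N (\<lambda>z. F n z - J n (F n) z) \<le> (1 + 1 / real (Suc n)) * N (F n)" by (rule J(2)[OF F(1)])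
        also have "\<dots> \<le> 2 * 1" using F(2)[of n] N_nonneg by (intro mult_mono) auto
        finally show ?thesis by simp
      qed
      fix r e :: real assume "0 \<le> r" "r < 1" "e > 0"
      then have "\<forall>\<^sub>F n in sequentially. 1 / real (Suc n) < min e (1 - r)"
        by (intro order_tendstoD[OF lim]) simp
      then show "\<forall>\<^sub>F n in sequentially. \<forall>z. norm z \<le> r \<longrightarrow> norm (F n z - J n (F n) z) \<le> e"
      proof eventually_elim
        case (elim n)
        show ?case
        proof (intro allI impI)
          fix z :: complex assume "norm z \<le> r"
          then have "norm z < 1 - 1 / real (Suc n)" using elim by simp
          then have "norm (F n z - J n (F n) z) \<le> 1 / real (Suc n) * N (F n)" by (rule J(3)[OF F(1)])
          also have "\<dots> \<le> 1 / real (Suc n) * 1" by (rule mult_left_mono[OF F(2)]) simp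
          finally show "norm (F n z - J n (F n) z) \<le> e" using elim by simp
        qed
      qed
    qed
  qed
  then show ?thesis by blast
qed

end

theorem proposition3p1:
  fixes p \<alpha> :: real
    and u \<phi> :: "real \<Rightarrow> complex \<Rightarrow> complex"
  defines "A \<equiv> bergman p \<alpha>"
    and "N \<equiv> bergman_norm p \<alpha>"
    and "S \<equiv> (\<lambda>t. wcomp (u t) (\<phi> t))"
  assumes "p > 1" and "\<alpha> \<ge> 0"
    and "\<And>t. t \<in> {0<..<1} \<Longrightarrow> u t holomorphic_on unit_disk"
    and "\<And>t. t \<in> {0<..<1} \<Longrightarrow> \<phi> t holomorphic_on unit_disk"
    and "\<And>t. t \<in> {0<..<1} \<Longrightarrow> \<phi> t ` unit_disk \<subseteq> unit_disk"
    and "\<And>t. t \<in> {0<..<1} \<Longrightarrow> S t \<in> bounded_ops A N"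
    and "\<And>f. f \<in> A \<Longrightarrow> norm_continuous_on N {0<..<1} (\<lambda>t. S t f)"
    and "integrable lborel01 (\<lambda>t. op_norm A N (S t))"
    and "\<not> (\<exists>F \<in> weakly_null_sphere A N.
           AE t in lborel01. (\<lambda>n. N (S t (F n))) \<longlonglongrightarrow> ess_norm A N (S t))"
  shows "ess_norm A N (\<lambda>f. integral_in A N lborel01 (\<lambda>t. S t f))
           < (LINT t|lborel01. ess_norm A N (S t))"
proof -
  interpret bergman_setting p \<alpha> by (unfold_locales) fact+
  obtain J \<delta> where "complete_approximable_space (bergman p \<alpha>) (bergman_norm p \<alpha>) J \<delta>"
    using bergman_complete_approximable by (elim exE)
  then interpret C: complete_approximable_space A N J \<delta> unfolding A_def N_def .
  show ?thesis by (rule C.ess_norm_integral_less) fact+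
qed

end
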